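(* Let $G$ be a connected graph and $k\geq 1$ an integer. Then $\omega^{4k+1}_G$ is a projective differential form on $\mathbb{P}^{E_G}\setminus X_G$. The forms satisfy: (compatibility) for every edge $e$ of $G$ with two distinct endpoints, $\iota_e^*\,\omega^{4k+1}_G=\omega^{4k+1}_{G/e}$, where $\iota_e:\mathbb{P}^{E_{G/e}}\to\mathbb{P}^{E_G}$ is the inclusion of the coordinate hyperplane $x_e=0$; (equivariance) for every isomorphism of graphs $\pi: G\to G'$, $\pi^*\omega^{4k+1}_{G'}=\omega^{4k+1}_G$, where $\pi$ also denotes the induced isomorphism $\mathbb{P}^{E_G}\to\mathbb{P}^{E_{G'}}$ permuting the coordinates. Moreover $$\omega^{4k+1}_G=\frac{N_G}{\Psi_G^{k+1}},$$ where $N_G$ is a polynomial in the $x_e$ and their differentials $dx_e$ ($e\in E_G$), with coefficients in $\mathbb{Q}$; that is, $\omega_G^{4k+1}$ has a pole along $X_G$ of order at most $k+1$.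
   Context: Graphs are finite; multiple edges and self-loops (tadpoles) are allowed. $E_G$ is the edge set of $G$. $\mathbb{P}^{E_G}$ denotes the projective space over $\mathbb{Q}$ of dimension $|E_G|-1$ with homogeneous coordinates $x_e$, $e\in E_G$. $G/e$ is the graph obtained by contracting the edge $e$ (remove $e$ and identify its endpoints); its edge set is $E_G\setminus\{e\}$. Graph Laplacian: choose an orientation of each edge; then $H_1(G;\mathbb{Z})\subset\mathbb{Z}^{E_G}$. Choose a basis of $H_1(G;\mathbb{Z})$ (rank $h_G$), let $\mathcal{H}_G$ be the $|E_G|\times h_G$ matrix of the inclusion, and let $D_G$ be the diagonal matrix with entries $x_e$. Then $\Lambda_G=\mathcal{H}_G^T D_G\mathcal{H}_G$ is a graph Laplacian matrix and $\Psi_G=\det\Lambda_G$ is the graph polynomial (equal to $1$ if $h_G=0$). The graph hypersurface is $X_G=V(\Psi_G)\subset\mathbb{P}^{E_G}$. For $k\ge1$, $$\omega^{4k+1}_G=\mathrm{tr}\big((\Lambda_G^{-1}d\Lambda_G)^{4k+1}\big),$$ which does not depend on the choices made. A differential form in the $x_e$ is projective if it is homogeneous of degree $0$ and annihilated by contraction with the Euler vector field $\sum_e x_e\,\partial/\partial x_e$. *)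

theory Defs
  imports
    "HOL-Library.Poly_Mapping"
    "HOL-Library.Uprod"
    "HOL-Computational_Algebra.Polynomial_Factorial"
    "Jordan_Normal_Form.Determinant"
    "Jordan_Normal_Form.Gauss_Jordan_Elimination"
begin

section \<open>Graphs\<close>

text \<open>The endpoints of an edge form an unordered pair, possibly \<open>Upair v v\<close> (a self-loop).
  Several edges may have the same endpoints.\<close>

record ('v, 'e) multigraph =
  verts :: "'v set"
  edges :: "'e set"
  ends :: "'e \<Rightarrow> 'v uprod"

definition finite_graph :: "('v, 'e) multigraph \<Rightarrow> bool" where
  "finite_graph G \<longleftrightarrow> finite (verts G) \<and> finite (edges G) \<and>
     (\<forall>e\<in>edges G. set_uprod (ends G e) \<subseteq> verts G)"

definition connected_graph :: "('v, 'e) multigraph \<Rightarrow> bool" where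
  "connected_graph G \<longleftrightarrow> verts G \<noteq> {} \<and>
     (\<forall>u\<in>verts G. \<forall>v\<in>verts G. (u, v) \<in> {(a, b). \<exists>e\<in>edges G. ends G e = Upair a b}\<^sup>*)"

text \<open>Contraction of an edge. The vertices of the quotient are the classes of the equivalence
  relation generated by identifying the two endpoints.\<close>

definition contract_class :: "('v, 'e) multigraph \<Rightarrow> 'e \<Rightarrow> 'v \<Rightarrow> 'v set" where
  "contract_class G e v = (if v \<in> set_uprod (ends G e) then set_uprod (ends G e) else {v})"

definition contract_edge :: "('v, 'e) multigraph \<Rightarrow> 'e \<Rightarrow> ('v set, 'e) multigraph" where
  "contract_edge G e =
     \<lparr>verts = contract_class G e ` verts G,
      edges = edges G - {e},
      ends = (\<lambda>a. map_uprod (contract_class G e) (ends G a))\<rparr>"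

definition graph_iso ::
  "('v \<Rightarrow> 'w) \<Rightarrow> ('e \<Rightarrow> 'f) \<Rightarrow> ('v, 'e) multigraph \<Rightarrow> ('w, 'f) multigraph \<Rightarrow> bool" where
  "graph_iso \<phi> \<pi> G G' \<longleftrightarrow>
     bij_betw \<phi> (verts G) (verts G') \<and> bij_betw \<pi> (edges G) (edges G') \<and>
     (\<forall>e\<in>edges G. ends G' (\<pi> e) = map_uprod \<phi> (ends G e))"

section \<open>Homology\<close>

definition orientation :: "('v, 'e) multigraph \<Rightarrow> ('e \<Rightarrow> 'v) \<Rightarrow> ('e \<Rightarrow> 'v) \<Rightarrow> bool" where
  "orientation G src tgt \<longleftrightarrow> (\<forall>e\<in>edges G. ends G e = Upair (src e) (tgt e))"

text \<open>\<open>H\<^sub>1(G;\<int>) \<subseteq> \<int>\<^bsup>E\<^esup>\<close> is the kernel of the boundary map \<open>e \<mapsto> tgt e - src e\<close>. An element of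
  \<open>\<int>\<^bsup>E\<^esup>\<close> is represented by a function that vanishes outside the edge set.\<close>

definition H1 :: "('v, 'e) multigraph \<Rightarrow> ('e \<Rightarrow> 'v) \<Rightarrow> ('e \<Rightarrow> 'v) \<Rightarrow> ('e \<Rightarrow> int) set" where
  "H1 G src tgt = {z. (\<forall>e. e \<notin> edges G \<longrightarrow> z e = 0) \<and>
     (\<forall>v\<in>verts G. (\<Sum>e | e \<in> edges G \<and> tgt e = v. z e) - (\<Sum>e | e \<in> edges G \<and> src e = v. z e) = 0)}"

definition int_basis :: "('e \<Rightarrow> int) list \<Rightarrow> ('e \<Rightarrow> int) set \<Rightarrow> bool" where
  "int_basis bs L \<longleftrightarrow> set bs \<subseteq> L \<and>
     (\<forall>z\<in>L. \<exists>!c. length c = length bs \<and> (\<forall>e. z e = (\<Sum>i<length bs. c ! i * (bs ! i) e)))"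

section \<open>Polynomials and rational functions in the edge variables\<close>

text \<open>The linear order on the edge labels is the one under which the library makes the polynomial
  ring an integral domain. It also fixes below the order of the factors in the monomials
  \<open>dx\<^sub>I\<close>.\<close>

type_synonym 'e qpoly = "('e \<Rightarrow>\<^sub>0 nat) \<Rightarrow>\<^sub>0 rat"
type_synonym 'e qratfun = "'e qpoly fract"

definition xvar :: "'e \<Rightarrow> 'e qpoly" where
  "xvar e = Poly_Mapping.single (Poly_Mapping.single e 1) 1"

definition pvars :: "'e qpoly \<Rightarrow> 'e set" where
  "pvars p = (\<Union>m\<in>Poly_Mapping.keys p. Poly_Mapping.keys m)"

definition homogeneous_poly :: "nat \<Rightarrow> 'e qpoly \<Rightarrow> bool" where
  "homogeneous_poly n p \<longleftrightarrow> (\<forall>m\<in>Poly_Mapping.keys p. (\<Sum>e\<in>Poly_Mapping.keys m. Poly_Mapping.lookup m e) = n)"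

definition homogeneous_ratfun :: "int \<Rightarrow> ('e::linorder) qratfun \<Rightarrow> bool" where
  "homogeneous_ratfun d f \<longleftrightarrow> (\<exists>p q a b. f = Fract p q \<and> q \<noteq> 0 \<and>
     homogeneous_poly a p \<and> homogeneous_poly b q \<and> int a - int b = d)"

text \<open>\<open>\<partial>p/\<partial>x\<^sub>e\<close>; the terms with \<open>lookup m e = 0\<close>, where the subtraction of exponents
  is truncated, have coefficient \<open>0\<close>.\<close>

definition partial_deriv :: "'e \<Rightarrow> 'e qpoly \<Rightarrow> 'e qpoly" where
  "partial_deriv e p = (\<Sum>m\<in>Poly_Mapping.keys p.
     Poly_Mapping.single (m - Poly_Mapping.single e 1) (of_nat (Poly_Mapping.lookup m e) * Poly_Mapping.lookup p m))"

text \<open>The ring homomorphism \<open>x\<^sub>e \<mapsto> \<sigma> e\<close>, and its extension to those fractions that have a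
  representation whose denominator is not sent to \<open>0\<close>.\<close>

definition poly_subst :: "('e \<Rightarrow> 'f qpoly) \<Rightarrow> 'e qpoly \<Rightarrow> 'f qpoly" where
  "poly_subst \<sigma> p = (\<Sum>m\<in>Poly_Mapping.keys p.
     Poly_Mapping.single 0 (Poly_Mapping.lookup p m) * (\<Prod>e\<in>Poly_Mapping.keys m. \<sigma> e ^ Poly_Mapping.lookup m e))"

definition ratfun_subst_defined ::
  "('e::linorder \<Rightarrow> ('f::linorder) qpoly) \<Rightarrow> 'e qratfun \<Rightarrow> bool" where
  "ratfun_subst_defined \<sigma> f \<longleftrightarrow> (\<exists>p q. f = Fract p q \<and> q \<noteq> 0 \<and> poly_subst \<sigma> q \<noteq> 0)"

definition ratfun_subst ::
  "('e::linorder \<Rightarrow> ('f::linorder) qpoly) \<Rightarrow> 'e qratfun \<Rightarrow> 'f qratfun" where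
  "ratfun_subst \<sigma> f = (THE g. \<exists>p q. f = Fract p q \<and> q \<noteq> 0 \<and> poly_subst \<sigma> q \<noteq> 0 \<and>
     g = Fract (poly_subst \<sigma> p) (poly_subst \<sigma> q))"

section \<open>Exterior algebras\<close>

text \<open>The exterior algebra over \<open>'k\<close> on generators \<open>dx\<^sub>e\<close>, as the free module with basis the
  monomials \<open>dx\<^sub>I = dx\<^bsub>i1\<^esub> \<and> \<dots> \<and> dx\<^bsub>in\<^esub>\<close> for \<open>I = {i1 < \<dots> < in}\<close>.\<close>

typedef (overloaded) ('e, 'k) exterior =
  "{f :: 'e set \<Rightarrow> 'k::zero. finite {I. f I \<noteq> 0} \<and> (\<forall>I. f I \<noteq> 0 \<longrightarrow> finite I)}"
  morphisms ext_coeff Abs_exterior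
  by (rule exI[of _ "\<lambda>_. 0"]) simp

setup_lifting type_definition_exterior

text \<open>\<open>dx\<^sub>A \<and> dx\<^sub>B = shuffle_sign A B dx\<^bsub>A \<union> B\<^esub>\<close> for disjoint \<open>A\<close> and \<open>B\<close>.\<close>

definition shuffle_sign :: "'e::linorder set \<Rightarrow> 'e set \<Rightarrow> 'k::ring_1" where
  "shuffle_sign A B = (- 1) ^ card {(a, b). a \<in> A \<and> b \<in> B \<and> b < a}"

lemma shuffle_sign_empty [simp]: "shuffle_sign {} B = 1" "shuffle_sign A {} = 1"
  by (simp_all add: shuffle_sign_def)

lemma shuffle_sign_Un_left:
  assumes "finite A" "finite B" "finite C" "A \<inter> B = {}"
  shows "shuffle_sign (A \<union> B) C = shuffle_sign A C * (shuffle_sign B C :: 'k::ring_1)"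
proof -
  have "{(a, b). a \<in> A \<union> B \<and> b \<in> C \<and> b < a} =
        {(a, b). a \<in> A \<and> b \<in> C \<and> b < a} \<union> {(a, b). a \<in> B \<and> b \<in> C \<and> b < a}"
    by auto
  moreover have "finite {(a, b). a \<in> A \<and> b \<in> C \<and> b < a}" "finite {(a, b). a \<in> B \<and> b \<in> C \<and> b < a}"
    by (rule finite_subset[of _ "A \<times> C"] finite_subset[of _ "B \<times> C"]; use assms in auto)+
  moreover have "{(a, b). a \<in> A \<and> b \<in> C \<and> b < a} \<inter> {(a, b). a \<in> B \<and> b \<in> C \<and> b < a} = {}"
    using assms by auto
  ultimately show ?thesis
    unfolding shuffle_sign_def by (simp add: card_Un_disjoint power_add)
qed

lemma shuffle_sign_Un_right:
  assumes "finite A" "finite B" "finite C" "B \<inter> C = {}"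
  shows "shuffle_sign A (B \<union> C) = shuffle_sign A B * (shuffle_sign A C :: 'k::ring_1)"
proof -
  have "{(a, b). a \<in> A \<and> b \<in> B \<union> C \<and> b < a} =
        {(a, b). a \<in> A \<and> b \<in> B \<and> b < a} \<union> {(a, b). a \<in> A \<and> b \<in> C \<and> b < a}"
    by auto
  moreover have "finite {(a, b). a \<in> A \<and> b \<in> B \<and> b < a}" "finite {(a, b). a \<in> A \<and> b \<in> C \<and> b < a}"
    by (rule finite_subset[of _ "A \<times> B"] finite_subset[of _ "A \<times> C"]; use assms in auto)+
  moreover have "{(a, b). a \<in> A \<and> b \<in> B \<and> b < a} \<inter> {(a, b). a \<in> A \<and> b \<in> C \<and> b < a} = {}"
    using assms by auto
  ultimately show ?thesis
    unfolding shuffle_sign_def by (simp add: card_Un_disjoint power_add)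
qed

instantiation exterior :: (type, ab_group_add) ab_group_add
begin

lift_definition zero_exterior :: "('a, 'b) exterior" is "\<lambda>_. 0" by simp

lift_definition plus_exterior :: "('a, 'b) exterior \<Rightarrow> ('a, 'b) exterior \<Rightarrow> ('a, 'b) exterior"
  is "\<lambda>f g I. f I + g I"
proof -
  fix f g :: "'a set \<Rightarrow> 'b"
  assume f: "finite {I. f I \<noteq> 0} \<and> (\<forall>I. f I \<noteq> 0 \<longrightarrow> finite I)"
    and g: "finite {I. g I \<noteq> 0} \<and> (\<forall>I. g I \<noteq> 0 \<longrightarrow> finite I)"
  have "finite {I. f I + g I \<noteq> 0}"
    by (rule finite_subset[of _ "{I. f I \<noteq> 0} \<union> {I. g I \<noteq> 0}"]) (use f g in auto)
  then show "finite {I. f I + g I \<noteq> 0} \<and> (\<forall>I. f I + g I \<noteq> 0 \<longrightarrow> finite I)"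
    using f g by force
qed

lift_definition uminus_exterior :: "('a, 'b) exterior \<Rightarrow> ('a, 'b) exterior"
  is "\<lambda>f I. - f I" by simp

definition minus_exterior :: "('a, 'b) exterior \<Rightarrow> ('a, 'b) exterior \<Rightarrow> ('a, 'b) exterior" where
  "minus_exterior f g = f + - g"

instance
  by standard (simp_all add: minus_exterior_def, (transfer, simp add: ac_simps)+)

end

instantiation exterior :: (linorder, comm_ring_1) ring_1
begin

lift_definition one_exterior :: "('a, 'b) exterior" is "\<lambda>I. if I = {} then 1 else 0" by simp

lift_definition times_exterior :: "('a, 'b) exterior \<Rightarrow> ('a, 'b) exterior \<Rightarrow> ('a, 'b) exterior"
  is "\<lambda>f g I. \<Sum>A\<in>Pow I. shuffle_sign A (I - A) * f A * g (I - A)"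
proof -
  fix f g :: "'a set \<Rightarrow> 'b"
  assume f: "finite {I. f I \<noteq> 0} \<and> (\<forall>I. f I \<noteq> 0 \<longrightarrow> finite I)"
    and g: "finite {I. g I \<noteq> 0} \<and> (\<forall>I. g I \<noteq> 0 \<longrightarrow> finite I)"
  let ?h = "\<lambda>I. \<Sum>A\<in>Pow I. shuffle_sign A (I - A) * f A * g (I - A)"
  have *: "I \<in> (\<lambda>(A, B). A \<union> B) ` ({I. f I \<noteq> 0} \<times> {I. g I \<noteq> 0})" if nz: "?h I \<noteq> 0" for I
  proof -
    obtain A where "A \<in> Pow I" "shuffle_sign A (I - A) * f A * g (I - A) \<noteq> 0"
      using nz by (meson sum.not_neutral_contains_not_neutral)
    then have "(A, I - A) \<in> {I. f I \<noteq> 0} \<times> {I. g I \<noteq> 0}" "(\<lambda>(A, B). A \<union> B) (A, I - A) = I"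
      by auto
    then show ?thesis by (metis (lifting) image_eqI)
  qed
  then have "finite {I. ?h I \<noteq> 0}"
    by (intro finite_subset[of "{I. ?h I \<noteq> 0}" "(\<lambda>(A, B). A \<union> B) ` ({I. f I \<noteq> 0} \<times> {I. g I \<noteq> 0})"])
       (use f g in auto)
  moreover have "\<forall>I. ?h I \<noteq> 0 \<longrightarrow> finite I"
    using * f g by fastforce
  ultimately show "finite {I. ?h I \<noteq> 0} \<and> (\<forall>I. ?h I \<noteq> 0 \<longrightarrow> finite I)" by blast
qed

instance
proof
  fix a b c :: "('a, 'b) exterior"
  show "a * b * c = a * (b * c)"
  proof (transfer, rule ext)
    fix f g h :: "'a set \<Rightarrow> 'b" and I :: "'a set"
    let ?s = "shuffle_sign :: 'a set \<Rightarrow> 'a set \<Rightarrow> 'b"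
    show "(\<Sum>B\<in>Pow I. ?s B (I - B) * (\<Sum>A\<in>Pow B. ?s A (B - A) * f A * g (B - A)) * h (I - B)) =
      (\<Sum>A\<in>Pow I. ?s A (I - A) * f A * (\<Sum>C\<in>Pow (I - A). ?s C (I - A - C) * g C * h (I - A - C)))"
      (is "?L = ?R")
    proof (cases "finite I")
      case True
      have key: "?s A (I - A) * f A * (?s (B - A) (I - A - (B - A)) * g (B - A) * h (I - A - (B - A))) =
          ?s B (I - B) * (?s A (B - A) * f A * g (B - A)) * h (I - B)"
        if BA: "B \<subseteq> I" "A \<subseteq> B" for A B
      proof -
        have fin: "finite A" "finite B" "finite (B - A)" "finite (I - B)"
          using BA True by (auto intro: finite_subset)
        have "?s B (I - B) = ?s A (I - B) * ?s (B - A) (I - B)"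
          using shuffle_sign_Un_left[of A "B - A" "I - B", where ?'k = 'b] fin BA
          by (simp add: Un_absorb1)
        moreover have "?s A (I - A) = ?s A (B - A) * ?s A (I - B)"
        proof -
          have "I - A = (B - A) \<union> (I - B)" using BA by auto
          then show ?thesis
            using shuffle_sign_Un_right[of A "B - A" "I - B", where ?'k = 'b] fin by auto
        qed
        moreover have "I - A - (B - A) = I - B" using BA by auto
        ultimately show ?thesis by (simp add: ac_simps)
      qed
      have fin: "finite (Pow I)" "\<And>B. B \<in> Pow I \<Longrightarrow> finite (Pow B)" "\<And>A. finite (Pow (I - A))"
        using True by (auto intro: finite_subset)
      have "?L = (\<Sum>B\<in>Pow I. \<Sum>A\<in>Pow B. ?s B (I - B) * (?s A (B - A) * f A * g (B - A)) * h (I - B))"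
        by (simp only: sum_distrib_left sum_distrib_right)
      also have "\<dots> = (\<Sum>(B, A)\<in>Sigma (Pow I) Pow.
              ?s B (I - B) * (?s A (B - A) * f A * g (B - A)) * h (I - B))"
        by (rule sum.Sigma) (use fin in blast)+
      also have "\<dots> = (\<Sum>(A, C)\<in>Sigma (Pow I) (\<lambda>A. Pow (I - A)).
              ?s A (I - A) * f A * (?s C (I - A - C) * g C * h (I - A - C)))"
      proof (rule sum.reindex_bij_witness[of _ "\<lambda>(A, C). (A \<union> C, A)" "\<lambda>(B, A). (A, B - A)"], goal_cases)
        case (5 x)
        then show ?case using key[of "fst x" "snd x"] by (cases x) auto
      qed auto
      also have "\<dots> = (\<Sum>A\<in>Pow I. \<Sum>C\<in>Pow (I - A).
              ?s A (I - A) * f A * (?s C (I - A - C) * g C * h (I - A - C)))"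
        by (rule sum.Sigma[symmetric]) (use fin in blast)+
      also have "\<dots> = ?R"
        by (simp only: sum_distrib_left)
      finally show ?thesis .
    next
      case False
      then show ?thesis by simp
    qed
  qed
  show "1 * a = a"
  proof (transfer, rule ext)
    fix f :: "'a set \<Rightarrow> 'b" and I :: "'a set"
    assume f: "finite {I. f I \<noteq> 0} \<and> (\<forall>I. f I \<noteq> 0 \<longrightarrow> finite I)"
    show "(\<Sum>A\<in>Pow I. shuffle_sign A (I - A) * (if A = {} then 1 else 0) * f (I - A)) = f I"
    proof (cases "finite I")
      case True
      have "(\<Sum>A\<in>Pow I. shuffle_sign A (I - A) * (if A = {} then 1 else 0) * f (I - A)) =
        (\<Sum>A\<in>{{}}. shuffle_sign A (I - A) * (if A = {} then 1 else 0) * f (I - A))"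
        by (rule sum.mono_neutral_right) (use True in auto)
      then show ?thesis by simp
    qed (use f in auto)
  qed
  show "a * 1 = a"
  proof (transfer, rule ext)
    fix f :: "'a set \<Rightarrow> 'b" and I :: "'a set"
    assume f: "finite {I. f I \<noteq> 0} \<and> (\<forall>I. f I \<noteq> 0 \<longrightarrow> finite I)"
    show "(\<Sum>A\<in>Pow I. shuffle_sign A (I - A) * f A * (if I - A = {} then 1 else 0)) = f I"
    proof (cases "finite I")
      case True
      have "(\<Sum>A\<in>Pow I. shuffle_sign A (I - A) * f A * (if I - A = {} then 1 else 0)) =
        (\<Sum>A\<in>{I}. shuffle_sign A (I - A) * f A * (if I - A = {} then 1 else 0))"
        by (rule sum.mono_neutral_right) (use True in auto)
      then show ?thesis by simp
    qed (use f in auto)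
  qed
  show "(a + b) * c = a * c + b * c"
    by transfer (simp add: fun_eq_iff algebra_simps sum.distrib)
  show "a * (b + c) = a * b + a * c"
    by transfer (simp add: fun_eq_iff algebra_simps sum.distrib)
  show "(0 :: ('a, 'b) exterior) \<noteq> 1"
    by transfer (auto simp: fun_eq_iff)
qed

end

lift_definition ext_const :: "'k \<Rightarrow> ('e, 'k::zero) exterior" is "\<lambda>c I. if I = {} then c else 0"
  by simp

lift_definition dx :: "'e \<Rightarrow> ('e, 'k::zero_neq_one) exterior" is "\<lambda>e I. if I = {e} then 1 else 0"
  by simp

text \<open>Coefficientwise application of a function; \<open>h 0 = 0\<close> is forced.\<close>

lift_definition ext_map :: "('k \<Rightarrow> 'l) \<Rightarrow> ('e, 'k::zero) exterior \<Rightarrow> ('e, 'l::zero) exterior"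
  is "\<lambda>h f I. if f I = 0 then 0 else h (f I)"
  by (auto elim: rev_finite_subset)

text \<open>Contraction with the vector field \<open>\<Sum>\<^bsub>e \<in> E\<^esub> v\<^sub>e \<partial>/\<partial>x\<^sub>e\<close>. The coefficient of
  \<open>dx\<^sub>I\<close> receives, for each \<open>e \<in> E - I\<close>, a contribution from
  \<open>dx\<^sub>e \<and> dx\<^sub>I = shuffle_sign {e} I dx\<^bsub>insert e I\<^esub>\<close>.\<close>

lift_definition ext_contraction ::
  "('e::linorder) set \<Rightarrow> ('e \<Rightarrow> 'k) \<Rightarrow> ('e, 'k::comm_ring_1) exterior \<Rightarrow> ('e, 'k) exterior"
  is "\<lambda>E v f I. \<Sum>e\<in>E - I. shuffle_sign {e} I * v e * f (insert e I)"
proof -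
  fix E :: "'e set" and f :: "'e set \<Rightarrow> 'k" and v :: "'e \<Rightarrow> 'k"
  assume f: "finite {I. f I \<noteq> 0} \<and> (\<forall>I. f I \<noteq> 0 \<longrightarrow> finite I)"
  let ?h = "\<lambda>I. \<Sum>e\<in>E - I. shuffle_sign {e} I * v e * f (insert e I)"
  have *: "\<exists>J. f J \<noteq> 0 \<and> I \<subseteq> J" if nz: "?h I \<noteq> 0" for I
  proof -
    obtain e where "shuffle_sign {e} I * v e * f (insert e I) \<noteq> 0"
      using nz by (meson sum.not_neutral_contains_not_neutral)
    then show ?thesis by (intro exI[of _ "insert e I"]) auto
  qed
  have "finite {I. ?h I \<noteq> 0}"
    by (rule finite_subset[of _ "\<Union>J\<in>{J. f J \<noteq> 0}. Pow J"]) (use * f in blast, use f in auto)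
  moreover have "\<forall>I. ?h I \<noteq> 0 \<longrightarrow> finite I"
    using * f by (meson finite_subset)
  ultimately show "finite {I. ?h I \<noteq> 0} \<and> (\<forall>I. ?h I \<noteq> 0 \<longrightarrow> finite I)" by blast
qed

section \<open>Differential forms\<close>

text \<open>Forms with polynomial coefficients, and forms with rational coefficients.\<close>

type_synonym 'e poly_form = "('e, 'e qpoly) exterior"
type_synonym 'e rat_form = "('e, 'e qratfun) exterior"

definition rat_of_poly_form :: "('e::linorder) poly_form \<Rightarrow> 'e rat_form" where
  "rat_of_poly_form = ext_map to_fract"

definition dpoly :: "('e::linorder) qpoly \<Rightarrow> 'e poly_form" where
  "dpoly p = (\<Sum>e\<in>pvars p. ext_const (partial_deriv e p) * dx e)"

definition euler_contraction :: "('e::linorder) set \<Rightarrow> 'e rat_form \<Rightarrow> 'e rat_form" where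
  "euler_contraction E = ext_contraction E (\<lambda>e. to_fract (xvar e))"

text \<open>Both \<open>x\<^sub>e\<close> and \<open>dx\<^sub>e\<close> have degree \<open>1\<close>.\<close>

definition homogeneous_form :: "int \<Rightarrow> ('e::linorder) rat_form \<Rightarrow> bool" where
  "homogeneous_form d \<omega> \<longleftrightarrow> (\<forall>I. homogeneous_ratfun (d - int (card I)) (ext_coeff \<omega> I))"

text \<open>Forms in \<open>x\<^sub>e, dx\<^sub>e\<close> (\<open>e \<in> E\<close>) that are regular away from the zero locus of \<open>\<Psi>\<close>, i.e.
  with coefficients in \<open>\<rat>[x\<^sub>e : e \<in> E][1/\<Psi>]\<close>.\<close>

definition regular_off :: "('e::linorder) set \<Rightarrow> 'e qpoly \<Rightarrow> 'e rat_form \<Rightarrow> bool" where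
  "regular_off E \<Psi> \<omega> \<longleftrightarrow> (\<forall>I. ext_coeff \<omega> I \<noteq> 0 \<longrightarrow> I \<subseteq> E \<and>
     (\<exists>p n. pvars p \<subseteq> E \<and> ext_coeff \<omega> I = to_fract p / to_fract \<Psi> ^ n))"

definition projective_form_off :: "('e::linorder) set \<Rightarrow> 'e qpoly \<Rightarrow> 'e rat_form \<Rightarrow> bool" where
  "projective_form_off E \<Psi> \<omega> \<longleftrightarrow>
     regular_off E \<Psi> \<omega> \<and> homogeneous_form 0 \<omega> \<and> euler_contraction E \<omega> = 0"

definition poly_form_in :: "('e::linorder) set \<Rightarrow> 'e poly_form \<Rightarrow> bool" where
  "poly_form_in E N \<longleftrightarrow> (\<forall>I. ext_coeff N I \<noteq> 0 \<longrightarrow> I \<subseteq> E \<and> pvars (ext_coeff N I) \<subseteq> E)"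

text \<open>Pullback along the polynomial map \<open>x\<^sub>e = \<sigma> e\<close>, with \<open>dx\<^sub>e \<mapsto> d(\<sigma> e)\<close>. It is meaningful for
  forms whose poles do not contain the image of the map.\<close>

definition pullback_defined ::
  "('e::linorder \<Rightarrow> ('f::linorder) qpoly) \<Rightarrow> 'e rat_form \<Rightarrow> bool" where
  "pullback_defined \<sigma> \<omega> \<longleftrightarrow> (\<forall>I. ratfun_subst_defined \<sigma> (ext_coeff \<omega> I))"

definition pullback ::
  "('e::linorder \<Rightarrow> ('f::linorder) qpoly) \<Rightarrow> 'e rat_form \<Rightarrow> 'f rat_form" where
  "pullback \<sigma> \<omega> = (\<Sum>I | ext_coeff \<omega> I \<noteq> 0. ext_const (ratfun_subst \<sigma> (ext_coeff \<omega> I)) *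
     prod_list (map (\<lambda>e. rat_of_poly_form (dpoly (\<sigma> e))) (sorted_list_of_set I)))"

text \<open>The inclusion of the hyperplane \<open>x\<^sub>e = 0\<close>.\<close>

definition hyperplane_incl :: "'e \<Rightarrow> 'e \<Rightarrow> 'e qpoly" where
  "hyperplane_incl e = (\<lambda>a. if a = e then 0 else xvar a)"

text \<open>The isomorphism sending a point \<open>(x\<^sub>e)\<^sub>e\<close> to the point whose coordinate at \<open>\<pi> e\<close>
  is \<open>x\<^sub>e\<close>.\<close>

definition coord_perm :: "'e set \<Rightarrow> ('e \<Rightarrow> 'f) \<Rightarrow> 'f \<Rightarrow> 'e qpoly" where
  "coord_perm E \<pi> = (\<lambda>a. xvar (inv_into E \<pi> a))"

section \<open>Graph Laplacians and canonical forms\<close>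

text \<open>The matrix of \<open>H\<^sub>1(G;\<int>) \<subseteq> \<int>\<^bsup>E\<^esup>\<close> and the diagonal matrix of the variables, both with the edges
  listed in increasing order.\<close>

definition homology_mat :: "('e::linorder) set \<Rightarrow> ('e \<Rightarrow> int) list \<Rightarrow> 'e qpoly mat" where
  "homology_mat E bs =
     mat (card E) (length bs) (\<lambda>(a, i). of_int ((bs ! i) (sorted_list_of_set E ! a)))"

definition variable_mat :: "('e::linorder) set \<Rightarrow> 'e qpoly mat" where
  "variable_mat E = mat_diag (card E) (\<lambda>a. xvar (sorted_list_of_set E ! a))"

text \<open>A graph Laplacian of \<open>G\<close> depends on an orientation and a basis of the homology.\<close>

definition graph_laplacian :: "('v, 'e::linorder) multigraph \<Rightarrow> 'e qpoly mat \<Rightarrow> bool" where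
  "graph_laplacian G \<Lambda> \<longleftrightarrow> (\<exists>src tgt bs. orientation G src tgt \<and> int_basis bs (H1 G src tgt) \<and>
     \<Lambda> = transpose_mat (homology_mat (edges G) bs) * variable_mat (edges G) * homology_mat (edges G) bs)"

text \<open>\<open>tr((\<Lambda>\<^sup>-\<^sup>1 d\<Lambda>)\<^sup>n)\<close>, a product of matrices over the exterior algebra.\<close>

definition canonical_form :: "nat \<Rightarrow> ('e::linorder) qpoly mat \<Rightarrow> 'e rat_form" where
  "canonical_form n \<Lambda> =
    (let M = (map_mat ext_const (the (mat_inverse (map_mat to_fract \<Lambda>))) *
              map_mat (\<lambda>p. rat_of_poly_form (dpoly p)) \<Lambda>) ^\<^sub>m n
     in \<Sum>i<dim_row M. M $$ (i, i))"

lemma int_basis_exists: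
  fixes L :: "('e \<Rightarrow> int) set"
  assumes "finite E" "(\<lambda>_. 0) \<in> L" "\<And>z w k. z \<in> L \<Longrightarrow> w \<in> L \<Longrightarrow> (\<lambda>e. z e - k * w e) \<in> L"
    "\<And>z e. z \<in> L \<Longrightarrow> e \<notin> E \<Longrightarrow> z e = 0"
  shows "\<exists>bs. int_basis bs L"
  using assms
proof (induction E arbitrary: L rule: finite_induct)
  case empty
  then have "L = {\<lambda>_. 0}" by force
  then show ?case by (intro exI[of _ "[]"]) (simp add: int_basis_def)
next
  case (insert e F)
  define L0 where "L0 = {z \<in> L. z e = 0}"
  have "\<exists>bs. int_basis bs L0"
  proof (rule insert.IH)
    show "(\<lambda>_. 0) \<in> L0" using insert.prems by (simp add: L0_def)
    show "\<And>z w k. z \<in> L0 \<Longrightarrow> w \<in> L0 \<Longrightarrow> (\<lambda>e. z e - k * w e) \<in> L0"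
      using insert.prems by (simp add: L0_def)
    show "\<And>z a. z \<in> L0 \<Longrightarrow> a \<notin> F \<Longrightarrow> z a = 0"
      using insert.prems(3) unfolding L0_def by (metis (mono_tags, lifting) insertE mem_Collect_eq)
  qed
  then obtain bs where bs: "int_basis bs L0" ..
  show ?case
  proof (cases "\<forall>z\<in>L. z e = 0")
    case True
    then have "L0 = L" by (auto simp: L0_def)
    then show ?thesis using bs by blast
  next
    case False
    define P where "P = (\<lambda>n. n > 0 \<and> (\<exists>z\<in>L. z e = int n))"
    obtain z where z: "z \<in> L" "z e \<noteq> 0" using False by blast
    have "(\<lambda>a. 0 - 1 * z a) \<in> L" by (rule insert.prems(2)) (use insert.prems(1) z in auto)
    then have "P (nat \<bar>z e\<bar>)" unfolding P_def using z
      by (cases "z e > 0") (auto intro: bexI[of _ z] bexI[of _ "\<lambda>a. 0 - 1 * z a"])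
    then have "P (Least P)" by (rule LeastI)
    then obtain b where b: "b \<in> L" "b e = int (Least P)" "b e > 0" by (auto simp: P_def)
    have dvd: "b e dvd w e" if w: "w \<in> L" for w
    proof (rule ccontr)
      assume "\<not> b e dvd w e"
      then have pos: "w e mod b e > 0" using b(3)
        by (metis dvd_eq_mod_eq_0 order_le_less pos_mod_sign)
      have "(\<lambda>a. w a - (w e div b e) * b a) \<in> L" by (rule insert.prems(2)[OF w b(1)])
      moreover have "w e - (w e div b e) * b e = w e mod b e"
        by (simp add: minus_div_mult_eq_mod)
      ultimately have "P (nat (w e mod b e))" using pos unfolding P_def by fastforce
      then have "Least P \<le> nat (w e mod b e)" by (rule Least_le)
      moreover have "w e mod b e < b e" using b(3) by simp
      ultimately show False using b pos by linarith
    qed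
    have be0: "(\<Sum>i<length bs. c ! i * (bs ! i) e) = 0" for c
      using bs by (intro sum.neutral) (auto simp: int_basis_def L0_def dest!: nth_mem)
    have "int_basis (b # bs) L"
      unfolding int_basis_def
    proof (intro conjI ballI)
      show "set (b # bs) \<subseteq> L" using bs b by (auto simp: int_basis_def L0_def)
      fix w assume w: "w \<in> L"
      define q where "q = w e div b e"
      have wq: "w e = q * b e" using dvd[OF w] by (simp add: q_def)
      have "(\<lambda>a. w a - q * b a) \<in> L0"
        using insert.prems(2)[OF w b(1), of q] wq by (simp add: L0_def)
      then have ex1: "\<exists>!c. length c = length bs \<and>
          (\<forall>a. w a - q * b a = (\<Sum>i<length bs. c ! i * (bs ! i) a))"
        using bs by (simp add: int_basis_def)
      then obtain c where c: "length c = length bs"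
        "\<forall>a. w a - q * b a = (\<Sum>i<length bs. c ! i * (bs ! i) a)" by blast
      show "\<exists>!c. length c = length (b # bs) \<and>
          (\<forall>a. w a = (\<Sum>i<length (b # bs). c ! i * ((b # bs) ! i) a))"
      proof (rule ex1I[of _ "q # c"])
        have "w a = q * b a + (\<Sum>i<length bs. c ! i * (bs ! i) a)" for a
          using spec[OF c(2), of a] by linarith
        then show "length (q # c) = length (b # bs) \<and>
            (\<forall>a. w a = (\<Sum>i<length (b # bs). (q # c) ! i * ((b # bs) ! i) a))"
          using c(1) by (simp add: sum.lessThan_Suc_shift del: sum.lessThan_Suc)
      next
        fix d assume d: "length d = length (b # bs) \<and>
            (\<forall>a. w a = (\<Sum>i<length (b # bs). d ! i * ((b # bs) ! i) a))"
        then obtain r d' where rd: "d = r # d'" "length d' = length bs"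
          by (cases d) auto
        have eq: "w a = r * b a + (\<Sum>i<length bs. d' ! i * (bs ! i) a)" for a
          using d rd by (simp add: sum.lessThan_Suc_shift del: sum.lessThan_Suc)
        have "r = q" using eq[of e] wq be0 b(3) by simp
        have "w a - q * b a = (\<Sum>i<length bs. d' ! i * (bs ! i) a)" for a
          using eq[of a] \<open>r = q\<close> by simp
        then have "d' = c" using ex1 c rd by blast
        then show "d = q # c" using rd \<open>r = q\<close> by simp
      qed
    qed
    then show ?thesis by blast
  qed
qed

lemma graph_laplacian_exists:
  fixes G :: "('v, 'e::linorder) multigraph"
  assumes "finite_graph G"
  shows "\<exists>\<Lambda>. graph_laplacian G \<Lambda>"
proof -
  have "\<forall>e. \<exists>st. ends G e = Upair (fst st) (snd st)"
    by (metis uprod_exhaust fst_conv snd_conv)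
  then obtain st where st: "\<And>e. ends G e = Upair (fst (st e)) (snd (st e))" by metis
  let ?s = "\<lambda>e. fst (st e)" and ?t = "\<lambda>e. snd (st e)"
  have "\<exists>bs. int_basis bs (H1 G ?s ?t)"
  proof (rule int_basis_exists[of "edges G"])
    show "finite (edges G)" using assms by (simp add: finite_graph_def)
    fix z w :: "'e \<Rightarrow> int" and k :: int
    assume "z \<in> H1 G ?s ?t" "w \<in> H1 G ?s ?t"
    then show "(\<lambda>e. z e - k * w e) \<in> H1 G ?s ?t"
      unfolding H1_def by (simp add: sum_subtractf flip: sum_distrib_left)
  qed (simp_all add: H1_def)
  moreover have "orientation G ?s ?t" by (simp add: orientation_def st)
  ultimately show ?thesis unfolding graph_laplacian_def by blast
qed

end

theory Submission
  imports Defs "Jordan_Normal_Form.Char_Poly"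
begin

text \<open>The pole order is a statement about any symmetric matrix \<open>X\<close> with entries in a domain of
  characteristic \<open>0\<close>. Write \<open>d = det X\<close>, \<open>A = adj X\<close>, let \<open>w\<close> be the first column of \<open>A\<close> and \<open>\<delta>\<close> its
  corner. Then \<open>\<delta> A = d C + w w\<^sup>T\<close> with \<open>C\<close> symmetric. In the expansion of
  \<open>((d C + w w\<^sup>T) dX)\<^bsup>4k+1\<^esup>\<close>, two consecutive occurrences of \<open>w w\<^sup>T\<close> enclose a scalar
  \<open>q\<^sub>j = w\<^sup>T dX (C dX)\<^sup>j w\<close>. Reversing a product of \<open>m\<close> one-forms costs the sign
  \<open>(-1)\<close> to the power \<open>m (m - 1) / 2\<close>, so by symmetry \<open>q\<^sub>j\<close> vanishes unless \<open>j + 1\<close> is \<open>0\<close> or \<open>1\<close>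
  modulo \<open>4\<close>, and the one-form \<open>q\<^sub>0\<close> has square zero. Hence \<open>w w\<^sup>T\<close> occurs at most \<open>k + 1\<close> times
  and \<open>d\<^bsup>3k\<^esup>\<close> divides \<open>\<delta>\<^bsup>4k+1\<^esup> (A dX)\<^bsup>4k+1\<^esup>\<close>. The factor \<open>\<delta>\<close> is removed by perturbing \<open>X\<close> with two
  parameters so that \<open>\<delta>\<close> becomes monic and coprime to \<open>d\<close>. Dividing by \<open>d\<^bsup>4k+1\<^esup>\<close> leaves a pole of
  order \<open>k + 1\<close>.

  Projectivity holds because contraction with the Euler field sends \<open>\<Lambda>\<^sup>-\<^sup>1 d\<Lambda>\<close> to the identity
  matrix, which turns the form into the trace of \<open>(\<Lambda>\<^sup>-\<^sup>1 d\<Lambda>)\<^bsup>4k\<^esup>\<close>, zero by graded cyclicity.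
  Compatibility and equivariance hold because restriction of cycles identifies the homology groups
  up to the signs of the orientations, and the trace is unchanged when \<open>\<Lambda>\<close> is replaced by
  \<open>P\<^sup>T \<Lambda> P\<close> with \<open>P\<close> invertible over \<open>\<int>\<close>.\<close>

section \<open>The exterior algebra\<close>

text \<open>Clearing denominators by the adjugate alone leaves a pole of order 4k+1, so 3k factors
  \<open>d\<close> have to be found in the numerator. If \<open>w w^T\<close> occurs r times in a
  term, it encloses r - 1 scalars \<open>q j\<close>; at most one of them is \<open>q 0\<close>, and
  the other nonzero ones have j \<ge> 3. Hence r + 3(r - 2) \<le> 4k+1, so r \<le> k+1, and every
  one of the at least 3k remaining factors carries a \<open>d\<close>. Cancelling \<delta>
  afterwards is a genuine obstacle: for a block diagonal matrix \<delta> and \<open>d\<close> can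
  share the determinant of a block, and for a general symmetric matrix \<delta> may be zero.
  Moreover a domain need not be factorial, so coprimality is expressed as injectivity of
  multiplication by \<open>d\<close> modulo \<delta>. Adding \<open>t\<close> to the diagonal makes
  \<delta> monic but does not separate the blocks; the second parameter \<open>s\<close> joins the
  matrix to one where no root of \<delta> is a root of \<open>d\<close>, and monicity carries the
  conclusion from s = 0 to all s.\<close>

lemma exterior_eqI: "(\<And>I. ext_coeff f I = ext_coeff g I) \<Longrightarrow> f = g"
  by (simp add: ext_coeff_inject[symmetric] fun_eq_iff)

lemma ext_coeff_infinite: "infinite I \<Longrightarrow> ext_coeff f I = 0"
  by transfer auto

lemma finite_ext_support: "finite {I. ext_coeff f I \<noteq> 0}"
  by transfer auto

lemma ext_coeff_zero [simp]: "ext_coeff 0 I = 0"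
  by transfer simp

lemma ext_coeff_add [simp]: "ext_coeff (f + g) I = ext_coeff f I + ext_coeff g I"
  by transfer simp

lemma ext_coeff_uminus [simp]: "ext_coeff (- f) I = - ext_coeff f I"
  by transfer simp

lemma ext_coeff_diff [simp]: "ext_coeff (f - g) I = ext_coeff f I - ext_coeff g I"
  unfolding minus_exterior_def ext_coeff_add ext_coeff_uminus by simp

lemma ext_coeff_sum [simp]: "ext_coeff (\<Sum>i\<in>A. f i) I = (\<Sum>i\<in>A. ext_coeff (f i) I)"
  by (induction A rule: infinite_finite_induct) simp_all

lemma ext_coeff_one: "ext_coeff 1 I = (if I = {} then 1 else 0)"
  by transfer simp

lemma ext_coeff_const: "ext_coeff (ext_const c) I = (if I = {} then c else 0)"
  by transfer simp

lemma ext_coeff_dx: "ext_coeff (dx e) I = (if I = {e} then 1 else 0)"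
  by transfer simp

lemma ext_coeff_mult:
  "ext_coeff (f * g) I = (\<Sum>A\<in>Pow I. shuffle_sign A (I - A) * ext_coeff f A * ext_coeff g (I - A))"
  by transfer simp

lemma ext_coeff_map: "h 0 = 0 \<Longrightarrow> ext_coeff (ext_map h f) I = h (ext_coeff f I)"
  by transfer simp

lemma ext_coeff_contraction:
  "ext_coeff (ext_contraction E v f) I =
     (\<Sum>e\<in>E - I. shuffle_sign {e} I * v e * ext_coeff f (insert e I))"
  by transfer simp

lemma ext_coeff_const_mult [simp]: "ext_coeff (ext_const c * f) I = c * ext_coeff f I"
proof (cases "finite I")
  case True
  have "ext_coeff (ext_const c * f) I =
      (\<Sum>A\<in>{{}}. shuffle_sign A (I - A) * ext_coeff (ext_const c) A * ext_coeff f (I - A))"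
    unfolding ext_coeff_mult
    by (rule sum.mono_neutral_right) (use True in \<open>auto simp: ext_coeff_const\<close>)
  then show ?thesis by (simp add: ext_coeff_const)
qed (simp add: ext_coeff_infinite)

lemma ext_coeff_mult_const [simp]: "ext_coeff (f * ext_const c) I = c * ext_coeff f I"
proof (cases "finite I")
  case True
  have "ext_coeff (f * ext_const c) I =
      (\<Sum>A\<in>{I}. shuffle_sign A (I - A) * ext_coeff f A * ext_coeff (ext_const c) (I - A))"
    unfolding ext_coeff_mult
    by (rule sum.mono_neutral_right) (use True in \<open>auto simp: ext_coeff_const\<close>)
  then show ?thesis by (simp add: ext_coeff_const)
qed (simp add: ext_coeff_infinite)

lemma ext_const_commute: "f * ext_const c = ext_const c * f"
  by (rule exterior_eqI) simp

lemma ext_const_left_commute: "f * (ext_const c * g) = ext_const c * (f * g)"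
  by (metis ext_const_commute mult.assoc)

lemma ext_const_0 [simp]: "ext_const 0 = 0"
  by (rule exterior_eqI) (simp add: ext_coeff_const)

lemma ext_const_1 [simp]: "ext_const 1 = 1"
  by (rule exterior_eqI) (simp add: ext_coeff_const ext_coeff_one)

lemma ext_const_add: "ext_const (a + b) = ext_const a + ext_const b"
  by (rule exterior_eqI) (simp add: ext_coeff_const)

lemma ext_const_uminus: "ext_const (- a) = - ext_const a"
  by (rule exterior_eqI) (simp add: ext_coeff_const)

lemma ext_const_mult:
  fixes a b :: "'k::comm_ring_1"
  shows "(ext_const (a * b) :: ('e::linorder, 'k) exterior) = ext_const a * ext_const b"
  by (rule exterior_eqI) (simp add: ext_coeff_const)

lemma ext_const_sum: "ext_const (\<Sum>i\<in>A. f i) = (\<Sum>i\<in>A. ext_const (f i))"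
  by (rule exterior_eqI) (simp add: ext_coeff_const)

lemma (in comm_ring_hom) shuffle_sign_hom: "hom (shuffle_sign A B) = shuffle_sign A B"
  by (simp add: shuffle_sign_def hom_distribs)

lemma (in comm_ring_hom) ext_map_ring_hom:
  "Ring_Hom.ring_hom (ext_map hom :: ('e::linorder, _) exterior \<Rightarrow> _)"
proof
  fix f g :: "('e, 'a) exterior"
  note [simp] = ext_coeff_map[where h = hom]
  show "ext_map hom (f + g) = ext_map hom f + ext_map hom g"
    by (rule exterior_eqI) (simp add: hom_distribs)
  show "ext_map hom (f * g) = ext_map hom f * ext_map hom g"
    by (rule exterior_eqI) (simp add: ext_coeff_mult hom_distribs shuffle_sign_hom)
  show "ext_map hom (1 :: ('e, 'a) exterior) = 1"
    by (rule exterior_eqI) (simp add: ext_coeff_one)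
  show "ext_map hom (0 :: ('e, 'a) exterior) = 0"
    by (rule exterior_eqI) simp
qed

lemma (in comm_ring_hom) ext_map_const: "ext_map hom (ext_const c) = ext_const (hom c)"
  by (rule exterior_eqI) (simp add: ext_coeff_map ext_coeff_const)

lemma (in comm_ring_hom) ext_map_dx: "ext_map hom (dx e) = dx e"
  by (rule exterior_eqI) (simp add: ext_coeff_map ext_coeff_dx)

section \<open>Exterior degree and graded commutativity\<close>

definition ext_homogeneous :: "nat \<Rightarrow> ('e, 'k::zero) exterior \<Rightarrow> bool" where
  "ext_homogeneous m f \<longleftrightarrow> (\<forall>I. ext_coeff f I \<noteq> 0 \<longrightarrow> card I = m)"

lemma ext_homogeneous_sum:
  "(\<And>i. i \<in> A \<Longrightarrow> ext_homogeneous m (f i)) \<Longrightarrow> ext_homogeneous m (\<Sum>i\<in>A. f i)"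
  unfolding ext_homogeneous_def by (metis ext_coeff_sum sum.not_neutral_contains_not_neutral)

lemma ext_homogeneous_const [simp]: "ext_homogeneous 0 (ext_const c)"
  by (simp add: ext_homogeneous_def ext_coeff_const)

lemma ext_homogeneous_dx [simp]: "ext_homogeneous 1 (dx e)"
  by (simp add: ext_homogeneous_def ext_coeff_dx)

lemma ext_homogeneous_one [simp]: "ext_homogeneous 0 1"
  by (simp add: ext_homogeneous_def ext_coeff_one)

lemma ext_homogeneous_zero [simp]: "ext_homogeneous m 0"
  by (simp add: ext_homogeneous_def)

lemma ext_homogeneous_mult:
  assumes "ext_homogeneous m f" "ext_homogeneous n g"
  shows "ext_homogeneous (m + n) (f * g)"
  unfolding ext_homogeneous_def
proof (intro allI impI)
  fix I assume nz: "ext_coeff (f * g) I \<noteq> 0"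
  then have "finite I" using ext_coeff_infinite by blast
  obtain A where A: "A \<subseteq> I" "ext_coeff f A \<noteq> 0" "ext_coeff g (I - A) \<noteq> 0"
    using nz unfolding ext_coeff_mult
    by (metis (no_types, lifting) PowD mult_zero_left mult_zero_right sum.not_neutral_contains_not_neutral)
  then have "card A = m" "card (I - A) = n" using assms by (auto simp: ext_homogeneous_def)
  then show "card I = m + n"
    using A \<open>finite I\<close> card_mono[of I A] by (simp add: card_Diff_subset finite_subset[of A I])
qed

lemma ext_homogeneous_map: "h 0 = 0 \<Longrightarrow> ext_homogeneous m f \<Longrightarrow> ext_homogeneous m (ext_map h f)"
  unfolding ext_homogeneous_def by (metis ext_coeff_map)

text \<open>Every pair in A x B is an inversion for exactly one of the two orders of the factors, so
  the two inversion counts add up to \<open>card A * card B\<close>.\<close>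

lemma shuffle_sign_swap:
  assumes "finite A" "finite B" "A \<inter> B = {}"
  shows "shuffle_sign B A = (-1) ^ (card A * card B) * (shuffle_sign A B :: 'k::comm_ring_1)"
proof -
  let ?X = "{(a, b). a \<in> A \<and> b \<in> B \<and> b < a}" and ?Y = "{(a, b). a \<in> B \<and> b \<in> A \<and> b < a}"
  have fin: "finite ?X" by (rule finite_subset[of _ "A \<times> B"]) (use assms in auto)
  have fin': "finite ?Y" by (rule finite_subset[of _ "B \<times> A"]) (use assms in auto)
  have eq: "?X \<union> prod.swap ` ?Y = A \<times> B" using assms(3) by (force simp: image_iff)
  have "card (?X \<union> prod.swap ` ?Y) = card ?X + card (prod.swap ` ?Y)"
    by (rule card_Un_disjoint) (use fin fin' in auto)
  moreover have "card (prod.swap ` ?Y) = card ?Y" by (rule card_image) (auto simp: inj_on_def)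
  ultimately have c: "card A * card B = card ?X + card ?Y" using eq by (simp add: card_cartesian_product)
  have "(-1 :: 'k) ^ card ?X * (-1) ^ card ?X = 1" by (simp flip: power_mult_distrib)
  moreover have "(-1 :: 'k) ^ (card ?X + card ?Y) * (-1) ^ card ?X =
      ((-1) ^ card ?X * (-1) ^ card ?X) * (-1) ^ card ?Y"
    by (simp only: power_add mult_ac)
  ultimately have "(-1) ^ (card ?X + card ?Y) * (-1 :: 'k) ^ card ?X = (-1) ^ card ?Y" by simp
  then show ?thesis unfolding shuffle_sign_def c by simp
qed

lemma shuffle_sign_square: "shuffle_sign A B * shuffle_sign A B = (1 :: 'k::comm_ring_1)"
  by (simp add: shuffle_sign_def flip: power_add mult_2)

lemma graded_commute:
  assumes "ext_homogeneous m f" "ext_homogeneous n g"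
  shows "g * f = ext_const ((-1) ^ (m * n)) * (f * g)"
proof (rule exterior_eqI)
  fix I
  show "ext_coeff (g * f) I = ext_coeff (ext_const ((-1) ^ (m * n)) * (f * g)) I"
  proof (cases "finite I")
    case True
    have "ext_coeff (g * f) I = (\<Sum>A\<in>Pow I. shuffle_sign (I - A) A * ext_coeff g (I - A) * ext_coeff f A)"
      unfolding ext_coeff_mult
      by (rule sum.reindex_bij_witness[of _ "\<lambda>A. I - A" "\<lambda>A. I - A"]) (auto simp: double_diff)
    also have "\<dots> = (\<Sum>A\<in>Pow I. (-1) ^ (m * n) * (shuffle_sign A (I - A) * ext_coeff f A * ext_coeff g (I - A)))"
    proof (rule sum.cong[OF refl])
      fix A assume "A \<in> Pow I"
      then have fin: "finite A" "finite (I - A)" using True by (auto intro: finite_subset)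
      show "shuffle_sign (I - A) A * ext_coeff g (I - A) * ext_coeff f A =
          (-1) ^ (m * n) * (shuffle_sign A (I - A) * ext_coeff f A * ext_coeff g (I - A))"
      proof (cases "ext_coeff f A = 0 \<or> ext_coeff g (I - A) = 0")
        case False
        then have "card A = m" "card (I - A) = n" using assms by (auto simp: ext_homogeneous_def)
        then show ?thesis using shuffle_sign_swap[OF fin, where 'k = 'b] by (simp add: mult_ac)
      qed auto
    qed
    finally show ?thesis by (simp only: ext_coeff_const_mult ext_coeff_mult[of f g] sum_distrib_left)
  qed (simp add: ext_coeff_infinite)
qed

text \<open>The vanishing results obtained from symmetry, from squares of one-forms and from
  cyclicity of the trace all end with this step, which is where 2 must be cancellable.\<close>

lemma eq_minus_self_imp_zero:
  fixes f :: "('e::linorder, 'k::{idom, ring_char_0}) exterior"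
  assumes "f = ext_const (-1) * f"
  shows "f = 0"
proof (rule exterior_eqI)
  fix I
  have "ext_coeff f I = - ext_coeff f I"
    using arg_cong[OF assms, of "\<lambda>f. ext_coeff f I"] by (simp only: ext_coeff_const_mult mult_minus1)
  then show "ext_coeff f I = ext_coeff 0 I"
    by (simp add: eq_neg_iff_add_eq_0 flip: mult_2)
qed

lemma one_form_square:
  fixes f :: "('e::linorder, 'k::{idom, ring_char_0}) exterior"
  assumes "ext_homogeneous 1 f"
  shows "f * f = 0"
  by (rule eq_minus_self_imp_zero) (use graded_commute[OF assms assms] in simp)

section \<open>Divisibility of forms by scalars\<close>

definition ext_dvd :: "'k::comm_ring_1 \<Rightarrow> ('e, 'k) exterior \<Rightarrow> bool" where
  "ext_dvd a f \<longleftrightarrow> (\<forall>I. a dvd ext_coeff f I)"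

lemma ext_dvd_zero [simp]: "ext_dvd a 0"
  by (simp add: ext_dvd_def)

lemma ext_dvd_add: "ext_dvd a f \<Longrightarrow> ext_dvd a g \<Longrightarrow> ext_dvd a (f + g)"
  by (simp add: ext_dvd_def)

lemma ext_dvd_sum: "(\<And>i. i \<in> A \<Longrightarrow> ext_dvd a (f i)) \<Longrightarrow> ext_dvd a (\<Sum>i\<in>A. f i)"
  by (simp add: ext_dvd_def dvd_sum)

lemma ext_dvd_mult: "ext_dvd a f \<Longrightarrow> ext_dvd b g \<Longrightarrow> ext_dvd (a * b) (f * g)"
  unfolding ext_dvd_def ext_coeff_mult
  by (intro allI dvd_sum) (simp add: mult.assoc mult_dvd_mono)

lemma ext_dvd_one [simp]: "ext_dvd 1 f"
  by (simp add: ext_dvd_def)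

lemma ext_dvd_const: "a dvd c \<Longrightarrow> ext_dvd a (ext_const c)"
  by (simp add: ext_dvd_def ext_coeff_const)

lemma ext_dvd_trans: "ext_dvd b f \<Longrightarrow> a dvd b \<Longrightarrow> ext_dvd a f"
  by (meson dvd_trans ext_dvd_def)

section \<open>Contraction with a vector field\<close>

lemma dx_mult_coeff:
  "ext_coeff (dx e * f) I = (if e \<in> I then shuffle_sign {e} (I - {e}) * ext_coeff f (I - {e}) else 0)"
proof (cases "finite I")
  case True
  have "ext_coeff (dx e * f) I =
      (\<Sum>A\<in>(if e \<in> I then {{e}} else {}). shuffle_sign A (I - A) * ext_coeff (dx e) A * ext_coeff f (I - A))"
    unfolding ext_coeff_mult
    by (rule sum.mono_neutral_right) (use True in \<open>auto simp: ext_coeff_dx split: if_splits\<close>)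
  then show ?thesis by (simp add: ext_coeff_dx)
qed (simp add: ext_coeff_infinite)

text \<open>Products are later expanded from the left, so the antiderivation rule is wanted for a
  left factor of degree one, where the sign is always minus.\<close>

lemma contraction_dx_mult:
  assumes "e \<in> E" "finite E"
  shows "ext_contraction E v (dx e * f) = ext_const (v e) * f - dx e * ext_contraction E v f"
proof (rule exterior_eqI)
  fix I
  let ?l = "\<lambda>a. shuffle_sign {a} I * v a * ext_coeff (dx e * f) (insert a I)"
  show "ext_coeff (ext_contraction E v (dx e * f)) I =
      ext_coeff (ext_const (v e) * f - dx e * ext_contraction E v f) I"
  proof (cases "finite I")
    case fin: True
    show ?thesis
    proof (cases "e \<in> I")
      case False
      have "(\<Sum>a\<in>E - I. ?l a) = (\<Sum>a\<in>{e}. ?l a)"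
        by (rule sum.mono_neutral_right) (use assms False in \<open>auto simp: dx_mult_coeff\<close>)
      moreover have "shuffle_sign {e} I * v e * (shuffle_sign {e} I * x) = v e * x" for x
        by (simp add: shuffle_sign_square mult_ac flip: mult.assoc[of "shuffle_sign {e} I" "shuffle_sign {e} I"])
      ultimately show ?thesis
        using False by (simp add: ext_coeff_contraction dx_mult_coeff)
    next
      case True
      let ?J = "I - {e}"
      \<comment> \<open>Taking \<open>e\<close> out of the index set admits \<open>e\<close> to the
        contraction sum. The extra term is \<open>v e * ext_coeff f I\<close>, and it cancels the
        contribution of \<open>ext_const (v e) * f\<close>.\<close>
      have E: "E - ?J = insert e (E - I)" using True assms by auto
      have IJ: "I = insert e ?J" using True by auto
      have *: "shuffle_sign {a} I * v a * ext_coeff (dx e * f) (insert a I) =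
          - (shuffle_sign {e} ?J * (shuffle_sign {a} ?J * v a * ext_coeff f (insert a ?J)))"
        if a: "a \<in> E - I" for a
      proof -
        have ae: "a \<noteq> e" "a \<notin> ?J" using a True by auto
        have 1: "shuffle_sign {a} I = shuffle_sign {a} {e} * (shuffle_sign {a} ?J :: 'b)"
          using shuffle_sign_Un_right[of "{a}" "{e}" ?J, where ?'k = 'b] fin IJ by simp
        have 2: "shuffle_sign {e} (insert a ?J) = shuffle_sign {e} {a} * (shuffle_sign {e} ?J :: 'b)"
          using shuffle_sign_Un_right[of "{e}" "{a}" ?J, where ?'k = 'b] fin ae by simp
        have 3: "shuffle_sign {e} {a} = - (shuffle_sign {a} {e} :: 'b)"
          using shuffle_sign_swap[of "{a}" "{e}", where 'k = 'b] ae by simp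
        have 4: "insert a I - {e} = insert a ?J" using ae True by auto
        have sq: "shuffle_sign {a} {e} * (shuffle_sign {a} {e} * x) = (x::'b)" for x
          by (simp add: shuffle_sign_square flip: mult.assoc)
        show ?thesis
          using True unfolding dx_mult_coeff 4 1 2 3 by (simp add: mult_ac sq)
      qed
      have sq: "shuffle_sign {e} ?J * (shuffle_sign {e} ?J * x) = (x::'b)" for x
        by (simp add: shuffle_sign_square flip: mult.assoc)
      have "ext_coeff (dx e * ext_contraction E v f) I =
          shuffle_sign {e} ?J * (shuffle_sign {e} ?J * v e * ext_coeff f I +
            (\<Sum>a\<in>E - I. shuffle_sign {a} ?J * v a * ext_coeff f (insert a ?J)))"
        using True assms IJ by (simp add: dx_mult_coeff ext_coeff_contraction E)
      also have "\<dots> = v e * ext_coeff f I +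
          (\<Sum>a\<in>E - I. shuffle_sign {e} ?J * (shuffle_sign {a} ?J * v a * ext_coeff f (insert a ?J)))"
        by (simp add: distrib_left sum_distrib_left mult.assoc sq)
      finally show ?thesis
        by (simp add: ext_coeff_contraction * sum_negf)
    qed
  qed (simp add: ext_coeff_infinite)
qed

lemma contraction_add: "ext_contraction E v (f + g) = ext_contraction E v f + ext_contraction E v g"
  by (rule exterior_eqI) (simp add: ext_coeff_contraction algebra_simps sum.distrib)

lemma contraction_zero [simp]: "ext_contraction E v 0 = 0"
  by (rule exterior_eqI) (simp add: ext_coeff_contraction)

lemma contraction_sum: "ext_contraction E v (\<Sum>i\<in>A. f i) = (\<Sum>i\<in>A. ext_contraction E v (f i))"
  by (induction A rule: infinite_finite_induct) (simp_all add: contraction_add)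

lemma contraction_const_mult: "ext_contraction E v (ext_const c * f) = ext_const c * ext_contraction E v f"
  by (rule exterior_eqI) (simp add: ext_coeff_contraction sum_distrib_left mult_ac)

lemma contraction_one [simp]: "ext_contraction E v 1 = 0"
  by (rule exterior_eqI) (simp add: ext_coeff_contraction ext_coeff_one)

lemma contraction_one_form_mult:
  assumes "finite E"
  shows "ext_contraction E v ((\<Sum>e\<in>E. ext_const (c e) * dx e) * f) =
    ext_const (\<Sum>e\<in>E. c e * v e) * f - (\<Sum>e\<in>E. ext_const (c e) * dx e) * ext_contraction E v f"
proof -
  have "ext_contraction E v ((\<Sum>e\<in>E. ext_const (c e) * dx e) * f) =
      (\<Sum>e\<in>E. ext_const (c e) * (ext_const (v e) * f - dx e * ext_contraction E v f))"
    using assms by (simp add: sum_distrib_right mult.assoc contraction_sum contraction_const_mult contraction_dx_mult)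
  then show ?thesis
    by (simp add: right_diff_distrib sum_subtractf sum_distrib_right ext_const_sum ext_const_mult mult.assoc)
qed

section \<open>Matrices of one-forms\<close>

lemma mult_mat_entry:
  assumes "A \<in> carrier_mat nr n" "B \<in> carrier_mat n nc" "i < nr" "j < nc"
  shows "(A * B) $$ (i, j) = (\<Sum>k<n. A $$ (i, k) * B $$ (k, j))"
  using assms by (simp add: scalar_prod_def lessThan_atLeast0)

lemma pow_mat_carrier [simp]: "A \<in> carrier_mat n n \<Longrightarrow> A ^\<^sub>m k \<in> carrier_mat n n"
  by (rule pow_carrier_mat)

text \<open>Entries of products are to unfold by \<open>mult_mat_entry\<close> into finite sums
  instead of scalar products of rows and columns.\<close>

declare index_mult_mat(1) [simp del]

lemma mult_square_carrier [simp]: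
  "A \<in> carrier_mat n n \<Longrightarrow> B \<in> carrier_mat n n \<Longrightarrow> A * B \<in> carrier_mat n n"
  by (rule mult_carrier_mat)

lemma pow_mat_Suc_left:
  assumes "A \<in> carrier_mat n n"
  shows "A ^\<^sub>m Suc k = A * A ^\<^sub>m k"
proof (induction k)
  case (Suc k)
  have "A ^\<^sub>m Suc (Suc k) = A * A ^\<^sub>m k * A" using Suc by simp
  also have "\<dots> = A * (A ^\<^sub>m k * A)" by (rule assoc_mult_mat) (use assms in auto)
  finally show ?case by simp
qed (use assms in simp)

lemma even_sum_atMost_iff: "even (\<Sum>{..m::nat}) \<longleftrightarrow> m mod 4 = 0 \<or> m mod 4 = 3"
proof (induction m)
  case (Suc m)
  have "m mod 4 = 0 \<or> m mod 4 = 1 \<or> m mod 4 = 2 \<or> m mod 4 = 3" by linarith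
  then show ?case using Suc by (auto simp: mod_Suc even_even_mod_4_iff[of m] elim: evenE)
qed simp

section \<open>Products of symmetric matrices of one-forms\<close>

locale symmetric_one_forms =
  fixes h :: nat and C :: "'k::{idom, ring_char_0} mat" and Y :: "('e::linorder, 'k) exterior mat"
  assumes C: "C \<in> carrier_mat h h" and Y: "Y \<in> carrier_mat h h"
    and C_sym: "\<And>i j. i < h \<Longrightarrow> j < h \<Longrightarrow> C $$ (i, j) = C $$ (j, i)"
    and Y_sym: "\<And>i j. i < h \<Longrightarrow> j < h \<Longrightarrow> Y $$ (i, j) = Y $$ (j, i)"
    and Y_form: "\<And>i j. i < h \<Longrightarrow> j < h \<Longrightarrow> ext_homogeneous 1 (Y $$ (i, j))"
begin

definition "Q = map_mat ext_const C * Y"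
text \<open>This is Y C Y ... C Y with m + 1 factors \<open>Y\<close>. Unlike a power of
  \<open>Q\<close> it begins and ends with \<open>Y\<close>, so that reading it backwards gives a
  product of the same shape.\<close>

definition "Z m = Y * Q ^\<^sub>m m"

lemma Q_carrier [simp]: "Q \<in> carrier_mat h h"
  using C Y by (simp add: Q_def)

lemma Q_dim [simp]: "dim_row Q = h"
  using Q_carrier by (rule carrier_matD)

lemma Z_0 [simp]: "Z 0 = Y"
  using Y by (simp add: Z_def)

lemma Z_carrier [simp]: "Z m \<in> carrier_mat h h"
  using Y by (simp add: Z_def)

text \<open>The last \<open>Y\<close> is split off in one expansion and the first in the other;
  transposition exchanges the two, which drives the induction in \<open>Z_transpose\<close>.\<close>

lemma Z_Suc:
  assumes "i < h" "j < h"
  shows "Z (Suc m) $$ (i, j) = (\<Sum>b<h. \<Sum>a<h. ext_const (C $$ (a, b)) * (Z m $$ (i, a) * Y $$ (b, j)))"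
    and "Z (Suc m) $$ (i, j) = (\<Sum>b<h. \<Sum>a<h. ext_const (C $$ (b, a)) * (Y $$ (i, b) * Z m $$ (a, j)))"
proof -
  let ?C = "map_mat ext_const C :: ('e, 'k) exterior mat"
  note [simp] = C Y carrier_matD[OF C] carrier_matD[OF Y]
  have "Z (Suc m) = Z m * Q"
    unfolding Z_def by (simp add: assoc_mult_mat[of _ h h _ h _ h])
  also have "\<dots> = Z m * ?C * Y"
    unfolding Q_def by (rule assoc_mult_mat[symmetric, of _ h h _ h _ h]) simp_all
  finally show "Z (Suc m) $$ (i, j) = (\<Sum>b<h. \<Sum>a<h. ext_const (C $$ (a, b)) * (Z m $$ (i, a) * Y $$ (b, j)))"
    using assms C by (simp add: mult_mat_entry[of _ h h _ h] sum_distrib_right mult.assoc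
        ext_const_left_commute cong: sum.cong_simp)
  have "Z (Suc m) = Y * (Q * Q ^\<^sub>m m)"
    unfolding Z_def using pow_mat_Suc_left[OF Q_carrier, of m] by simp
  also have "\<dots> = Y * (?C * (Y * Q ^\<^sub>m m))"
    unfolding Q_def by (subst assoc_mult_mat[of ?C h h Y h _ h]) (simp_all flip: Q_def)
  also have "\<dots> = Y * ?C * Z m"
    unfolding Z_def by (rule assoc_mult_mat[symmetric, of _ h h _ h _ h]) simp_all
  finally have "Z (Suc m) $$ (i, j) = (\<Sum>a<h. \<Sum>b<h. ext_const (C $$ (b, a)) * (Y $$ (i, b) * Z m $$ (a, j)))"
    using assms C by (simp add: mult_mat_entry[of _ h h _ h] sum_distrib_right mult.assoc
        ext_const_left_commute cong: sum.cong_simp)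
  also have "\<dots> = (\<Sum>b<h. \<Sum>a<h. ext_const (C $$ (b, a)) * (Y $$ (i, b) * Z m $$ (a, j)))"
    by (rule sum.swap)
  finally show "Z (Suc m) $$ (i, j) = (\<Sum>b<h. \<Sum>a<h. ext_const (C $$ (b, a)) * (Y $$ (i, b) * Z m $$ (a, j)))" .
qed

lemma Z_homogeneous: "i < h \<Longrightarrow> j < h \<Longrightarrow> ext_homogeneous (Suc m) (Z m $$ (i, j))"
proof (induction m arbitrary: i j)
  case 0
  then show ?case using Y_form by simp
next
  case (Suc m)
  have "ext_homogeneous (0 + (Suc m + 1)) (ext_const (C $$ (a, b)) * (Z m $$ (i, a) * Y $$ (b, j)))"
    if "a < h" "b < h" for a b
    using Suc that Y_form by (intro ext_homogeneous_mult ext_homogeneous_const) auto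
  then show ?case unfolding Z_Suc(1)[OF Suc.prems]
    by (intro ext_homogeneous_sum) simp
qed

text \<open>Transposing a product of matrices of forms reverses the order of the factors; for
  \<open>m + 1\<close> one-forms this costs the sign \<open>(-1)\<close> to the power \<open>m (m + 1) / 2\<close>.\<close>

lemma Z_transpose: "i < h \<Longrightarrow> j < h \<Longrightarrow> Z m $$ (j, i) = ext_const ((-1) ^ \<Sum>{..m}) * Z m $$ (i, j)"
proof (induction m arbitrary: i j)
  case 0
  then show ?case using Y_sym by simp
next
  case (Suc m)
  have "ext_const (C $$ (a, b)) * (Z m $$ (j, a) * Y $$ (b, i)) =
      ext_const ((-1) ^ \<Sum>{..Suc m}) * (ext_const (C $$ (b, a)) * (Y $$ (i, b) * Z m $$ (a, j)))"
    if "a < h" "b < h" for a b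
  proof -
    have "Z m $$ (j, a) * Y $$ (b, i) = ext_const ((-1) ^ \<Sum>{..m}) * (Z m $$ (a, j) * Y $$ (i, b))"
      unfolding Suc.IH[OF that(1) Suc.prems(2)] Y_sym[OF that(2) Suc.prems(1)] by (rule mult.assoc)
    \<comment> \<open>The one-form that was split off passes m + 1 others. Their number is the
      summand that turns the sign exponent for \<open>m\<close> into the one for
      \<open>Suc m\<close>.\<close>
    also have "Z m $$ (a, j) * Y $$ (i, b) = ext_const ((-1) ^ Suc m) * (Y $$ (i, b) * Z m $$ (a, j))"
      using graded_commute[of 1 "Y $$ (i, b)" "Suc m" "Z m $$ (a, j)"] Y_form Z_homogeneous Suc.prems that by simp
    finally show ?thesis
      by (simp only: C_sym[OF that] sum.atMost_Suc power_add mult.assoc ext_const_mult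
          ext_const_left_commute[of _ "C $$ (b, a)"])
  qed
  then have "Z (Suc m) $$ (j, i) = (\<Sum>b<h. \<Sum>a<h. ext_const ((-1) ^ \<Sum>{..Suc m}) *
      (ext_const (C $$ (b, a)) * (Y $$ (i, b) * Z m $$ (a, j))))"
    unfolding Z_Suc(1)[OF Suc.prems(2,1)] by (intro sum.cong refl) blast
  then show ?case
    unfolding Z_Suc(2)[OF Suc.prems(1,2)] sum_distrib_left .
qed

end

section \<open>Powers after a rank-one update\<close>

locale rank_one_update = symmetric_one_forms h C Y
  for h and C :: "'k::{idom, ring_char_0} mat" and Y :: "('e::linorder, 'k) exterior mat" +
  fixes c :: 'k and w :: "nat \<Rightarrow> 'k"
begin

definition "M = map_mat ext_const (mat h h (\<lambda>(i, j). c * C $$ (i, j) + w i * w j)) * Y"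
definition "y j = (\<Sum>k<h. ext_const (w k) * Y $$ (k, j))"
definition "v j a = (\<Sum>p<h. (Q ^\<^sub>m j) $$ (a, p) * ext_const (w p))"
definition "q j = (\<Sum>a<h. y a * v j a)"
text \<open>Mixed products make an induction on the number of factors \<open>M\<close> possible:
  since \<open>M\<close> is \<open>c\<close> times \<open>Q\<close> plus the product of the column
  \<open>w\<close> and the row \<open>y\<close>, expanding the leftmost \<open>M\<close> either
  lengthens the run of \<open>Q\<close> and yields a \<open>c\<close>, or ends the run with
  \<open>w\<close> and leaves a row of type \<open>T 0\<close>.\<close>

definition "U j m = Q ^\<^sub>m j * M ^\<^sub>m m"
definition "T j m l = (\<Sum>a<h. y a * U j m $$ (a, l))"

lemma M_carrier [simp]: "M \<in> carrier_mat h h"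
  using Y by (simp add: M_def)

lemma M_entry:
  assumes "i < h" "j < h"
  shows "M $$ (i, j) = ext_const c * Q $$ (i, j) + ext_const (w i) * y j"
  using assms C Y unfolding M_def Q_def y_def
  by (simp add: mult_mat_entry[of _ h h _ h] ext_const_add ext_const_mult distrib_right
      sum.distrib sum_distrib_left mult.assoc)

text \<open>As the value at \<open>w\<close> of the quadratic form with matrix \<open>Z j\<close>,
  the scalar \<open>q j\<close> sees only the symmetric part of \<open>Z j\<close>; this gives
  \<open>q_eq_0\<close>.\<close>

lemma q_eq: "q j = (\<Sum>k<h. \<Sum>p<h. ext_const (w k * w p) * Z j $$ (k, p))"
proof -
  have "q j = (\<Sum>a<h. \<Sum>k<h. \<Sum>p<h. ext_const (w k * w p) * (Y $$ (k, a) * (Q ^\<^sub>m j) $$ (a, p)))"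
    unfolding q_def y_def v_def sum_product
    by (intro sum.cong refl) (simp only: ext_const_mult mult.assoc
        ext_const_commute[of "(Q ^\<^sub>m j) $$ _"] ext_const_left_commute[of "Y $$ _"])
  also have "\<dots> = (\<Sum>k<h. \<Sum>a<h. \<Sum>p<h. ext_const (w k * w p) * (Y $$ (k, a) * (Q ^\<^sub>m j) $$ (a, p)))"
    by (rule sum.swap)
  also have "\<dots> = (\<Sum>k<h. \<Sum>p<h. \<Sum>a<h. ext_const (w k * w p) * (Y $$ (k, a) * (Q ^\<^sub>m j) $$ (a, p)))"
    by (intro sum.cong refl sum.swap)
  finally show ?thesis
    using Y by (simp add: Z_def mult_mat_entry[of _ h h _ h] sum_distrib_left)
qed

lemma q_homogeneous: "ext_homogeneous (Suc j) (q j)"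
  unfolding q_eq
proof (intro ext_homogeneous_sum)
  fix k p assume "k \<in> {..<h}" "p \<in> {..<h}"
  then show "ext_homogeneous (Suc j) (ext_const (w k * w p) * Z j $$ (k, p))"
    using ext_homogeneous_mult[OF ext_homogeneous_const Z_homogeneous] by simp
qed

lemma q_eq_0:
  assumes "j mod 4 = 1 \<or> j mod 4 = 2"
  shows "q j = 0"
proof (rule eq_minus_self_imp_zero)
  have odd: "odd (\<Sum>{..j})" using even_sum_atMost_iff[of j] assms by auto
  have "q j = (\<Sum>k<h. \<Sum>p<h. ext_const (w p * w k) * Z j $$ (p, k))"
    unfolding q_eq by (rule sum.swap)
  also have "\<dots> = (\<Sum>k<h. \<Sum>p<h. ext_const (-1) * (ext_const (w k * w p) * Z j $$ (k, p)))"
  proof (intro sum.cong refl)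
    fix k p assume "k \<in> {..<h}" "p \<in> {..<h}"
    then have "Z j $$ (p, k) = ext_const (-1) * Z j $$ (k, p)"
      using Z_transpose[of k p j] odd by simp
    then show "ext_const (w p * w k) * Z j $$ (p, k) = ext_const (-1) * (ext_const (w k * w p) * Z j $$ (k, p))"
      by (simp only: mult.commute[of "w p"] ext_const_left_commute[of _ "-1"])
  qed
  also have "\<dots> = ext_const (-1) * q j" unfolding q_eq by (simp add: sum_distrib_left)
  finally show "q j = ext_const (-1) * q j" .
qed

lemma q0_square: "q 0 * q 0 = 0"
  using one_form_square[of "q 0"] q_homogeneous[of 0] by simp

lemma q_q0: "q j * q 0 = ext_const ((-1) ^ Suc j) * (q 0 * q j)"
  using graded_commute[OF q_homogeneous[of 0] q_homogeneous[of j]] by simp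

lemma U_Suc:
  assumes "a < h" "l < h"
  shows "U j (Suc m) $$ (a, l) = ext_const c * U (Suc j) m $$ (a, l) + v j a * T 0 m l"
proof -
  have QM: "(Q ^\<^sub>m j * M) $$ (a, b) = ext_const c * (Q ^\<^sub>m Suc j) $$ (a, b) + v j a * y b" if "b < h" for b
    using assms that by (simp add: mult_mat_entry[of _ h h _ h] M_entry v_def distrib_left sum.distrib
        sum_distrib_left sum_distrib_right mult.assoc ext_const_left_commute[of _ c] cong: sum.cong_simp)
  have U0: "U 0 m = M ^\<^sub>m m"
    using left_mult_one_mat[of "M ^\<^sub>m m" h h] by (simp add: U_def)
  have "U j (Suc m) = Q ^\<^sub>m j * M * M ^\<^sub>m m"
    unfolding U_def pow_mat_Suc_left[OF M_carrier]
    by (rule assoc_mult_mat[symmetric, of _ h h _ h _ h]) simp_all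
  then have "U j (Suc m) $$ (a, l) = (\<Sum>b<h. (Q ^\<^sub>m j * M) $$ (a, b) * (M ^\<^sub>m m) $$ (b, l))"
    using assms mult_mat_entry[of "Q ^\<^sub>m j * M" h h "M ^\<^sub>m m" h a l] by simp
  also have "\<dots> = (\<Sum>b<h. ext_const c * ((Q ^\<^sub>m Suc j) $$ (a, b) * (M ^\<^sub>m m) $$ (b, l)) +
       v j a * (y b * (M ^\<^sub>m m) $$ (b, l)))"
    by (intro sum.cong refl) (simp add: QM distrib_right mult.assoc del: pow_mat.simps)
  also have "\<dots> = ext_const c * U (Suc j) m $$ (a, l) + v j a * T 0 m l"
    using assms mult_mat_entry[of "Q ^\<^sub>m Suc j" h h "M ^\<^sub>m m" h a l] pow_mat_carrier[OF Q_carrier, of "Suc j"]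
    by (simp add: U_def[of "Suc j"] T_def U0 sum.distrib sum_distrib_left del: pow_mat.simps)
  finally show ?thesis .
qed

lemma T_Suc:
  assumes "l < h"
  shows "T j (Suc m) l = ext_const c * T (Suc j) m l + q j * T 0 m l"
  using assms unfolding T_def[of j] T_def[of "Suc j"] q_def
  by (simp add: U_Suc distrib_left sum.distrib sum_distrib_left sum_distrib_right mult.assoc
      ext_const_left_commute[of _ c] cong: sum.cong_simp)

lemma ext_dvd_power_const:
  assumes "ext_dvd (c ^ b) f" "s \<le> j + b"
  shows "ext_dvd (c ^ s) (ext_const (c ^ j) * f)"
  using ext_dvd_mult[OF ext_dvd_const[of "c ^ j" "c ^ j"] assms(1)] le_imp_power_dvd[OF assms(2), of c]
  by (auto simp: power_add elim: ext_dvd_trans)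

text \<open>Between two consecutive occurrences of the rank one term, \<open>q j\<close> appears with \<open>j\<close> factors of
  \<open>c\<close>; by the symmetry it vanishes unless \<open>j = 0\<close> or \<open>j \<ge> 3\<close>, and \<open>q 0\<close> can be used only once
  since it squares to zero.\<close>

lemma T_decomposition:
  assumes "l < h"
  shows "\<exists>\<alpha> \<beta>. ext_const (c ^ j) * T j m l = \<alpha> + q 0 * \<beta> \<and>
      ext_dvd (c ^ (j + m - (j + m) div 4)) \<alpha> \<and>
      ext_dvd (c ^ (j + m - 1 - (j + m - 1) div 4)) \<beta> \<and> (j + m = 0 \<longrightarrow> \<beta> = 0)"
\<comment> \<open>Origin of the exponents, with n = j + m: in \<alpha> every rank-one term ends a
  run of at least three factors \<open>Q\<close>, so there are at most n div 4 such terms and all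
  other factors yield a \<open>c\<close>. In \<beta> the rank-one term belonging to
  \<open>q 0\<close> uses up one factor, and the same count applies to the remaining n - 1.\<close>
proof (induction m arbitrary: j)
  case 0
  have "ext_dvd (c ^ (j - j div 4)) (ext_const (c ^ j) * T j 0 l)"
    by (rule ext_dvd_power_const[of 0]) simp_all
  then show ?case by (intro exI[of _ "ext_const (c ^ j) * T j 0 l"] exI[of _ 0]) simp
next
  case (Suc m)
  obtain \<alpha> \<beta> where 1: "ext_const (c ^ Suc j) * T (Suc j) m l = \<alpha> + q 0 * \<beta>"
      "ext_dvd (c ^ (Suc j + m - (Suc j + m) div 4)) \<alpha>"
      "ext_dvd (c ^ (Suc j + m - 1 - (Suc j + m - 1) div 4)) \<beta>"
    using Suc.IH[of "Suc j"] by blast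
  obtain \<alpha>' \<beta>' where "ext_const (c ^ 0) * T 0 m l = \<alpha>' + q 0 * \<beta>'"
      and 2: "ext_dvd (c ^ (0 + m - (0 + m) div 4)) \<alpha>'"
      "ext_dvd (c ^ (0 + m - 1 - (0 + m - 1) div 4)) \<beta>'" "0 + m = 0 \<longrightarrow> \<beta>' = 0"
    using Suc.IH[of 0] by blast
  then have T0: "T 0 m l = \<alpha>' + q 0 * \<beta>'" by simp
  have eq: "ext_const (c ^ j) * T j (Suc m) l =
      \<alpha> + q 0 * \<beta> + ext_const (c ^ j) * (q j * \<alpha>' + q j * (q 0 * \<beta>'))"
    unfolding T_Suc[OF assms] distrib_left 1(1)[symmetric] T0
    by (simp add: ext_const_mult mult.assoc distrib_left ext_const_left_commute[of "ext_const (c ^ j)" c])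
  have "j = 0 \<or> j = 1 \<or> j = 2 \<or> j \<ge> 3" by linarith
  then consider "j = 0" | "q j = 0" | "j \<ge> 3" using q_eq_0[of j] by fastforce
  then show ?case
  proof cases
    case 1
    \<comment> \<open>A second \<open>q 0\<close> annihilates \<beta>', while \<alpha>' acquires its
      first \<open>q 0\<close> and passes to the second summand.\<close>
    have "q 0 * (q 0 * \<beta>') = 0" by (simp add: q0_square flip: mult.assoc)
    then have "ext_const (c ^ j) * T j (Suc m) l = \<alpha> + q 0 * (\<beta> + \<alpha>')"
      using eq 1 by (simp add: distrib_left)
    moreover have "ext_dvd (c ^ (j + Suc m - 1 - (j + Suc m - 1) div 4)) (\<beta> + \<alpha>')"
      using \<open>ext_dvd _ \<beta>\<close> 2(1) 1 by (intro ext_dvd_add) simp_all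
    ultimately show ?thesis using \<open>ext_dvd _ \<alpha>\<close> by (intro exI[of _ \<alpha>] exI[of _ "\<beta> + \<alpha>'"]) simp
  next
    case 2
    then show ?thesis using eq \<open>ext_dvd _ \<alpha>\<close> \<open>ext_dvd _ \<beta>\<close>
      by (intro exI[of _ \<alpha>] exI[of _ \<beta>]) simp
  next
    case 3
    let ?s = "ext_const ((-1) ^ Suc j) :: ('e, 'k) exterior"
    let ?a = "\<alpha> + ext_const (c ^ j) * (q j * \<alpha>')"
      and ?b = "\<beta> + ?s * (ext_const (c ^ j) * (q j * \<beta>'))"
    \<comment> \<open>The factor \<open>q 0\<close> is kept in front, at the cost of a sign, so that
      any further \<open>q 0\<close> meets it directly.\<close>
    have "q j * (q 0 * \<beta>') = ?s * (q 0 * (q j * \<beta>'))"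
    proof -
      have "q j * (q 0 * \<beta>') = q j * q 0 * \<beta>'" by (simp only: mult.assoc)
      then show ?thesis by (simp only: q_q0 mult.assoc)
    qed
    then have "ext_const (c ^ j) * T j (Suc m) l = ?a + q 0 * ?b"
      unfolding eq distrib_left by (simp only: add_ac ext_const_left_commute[of "q 0"]
          ext_const_left_commute[of "ext_const (c ^ j)" "(-1) ^ Suc j"])
    moreover have "ext_dvd (c ^ (j + Suc m - (j + Suc m) div 4)) ?a"
    proof (intro ext_dvd_add ext_dvd_power_const)
      show "ext_dvd (c ^ (0 + m - (0 + m) div 4)) (q j * \<alpha>')"
        using ext_dvd_mult[OF ext_dvd_one 2(1), of "q j"] by simp
    qed (use \<open>ext_dvd _ \<alpha>\<close> 3 in auto)
    moreover have "ext_dvd (c ^ (j + Suc m - 1 - (j + Suc m - 1) div 4)) ?b"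
    proof (cases "m = 0")
      case True
      then show ?thesis using 2(3) \<open>ext_dvd _ \<beta>\<close> by simp
    next
      case False
      have "ext_dvd (c ^ (0 + m - 1 - (0 + m - 1) div 4)) (q j * \<beta>')"
        using ext_dvd_mult[OF ext_dvd_one 2(2), of "q j"] by simp
      then have "ext_dvd (c ^ (j + Suc m - 1 - (j + Suc m - 1) div 4)) (ext_const (c ^ j) * (q j * \<beta>'))"
        by (rule ext_dvd_power_const) (use 3 False in linarith)
      then show ?thesis using \<open>ext_dvd _ \<beta>\<close> ext_dvd_mult[OF ext_dvd_one, of _ _ ?s]
        by (intro ext_dvd_add) (simp, metis mult_1)
    qed
    ultimately show ?thesis by (intro exI[of _ ?a] exI[of _ ?b]) simp
  qed
qed

text \<open>The first rank-one term has no row to its left and encloses nothing, and one more may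
  belong to \<open>q 0\<close>; each of the others costs four factors. Among n = j + m factors there
  are therefore at most 1 + (n + 2) div 4 rank-one terms, and for n = 4k + 1 this is k + 1.\<close>

lemma U_dvd:
  assumes "a < h" "l < h" "j + m > 0"
  shows "ext_dvd (c ^ (j + m - 1 - (j + m + 2) div 4)) (ext_const (c ^ j) * U j m $$ (a, l))"
  using assms(3)
proof (induction m arbitrary: j)
  case 0
  show ?case by (rule ext_dvd_power_const[of 0]) simp_all
next
  case (Suc m)
  let ?N = "j + Suc m - 1 - (j + Suc m + 2) div 4"
  obtain \<alpha> \<beta> where "ext_const (c ^ 0) * T 0 m l = \<alpha> + q 0 * \<beta>"
      and 2: "ext_dvd (c ^ (0 + m - (0 + m) div 4)) \<alpha>"
      "ext_dvd (c ^ (0 + m - 1 - (0 + m - 1) div 4)) \<beta>" "0 + m = 0 \<longrightarrow> \<beta> = 0"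
    using T_decomposition[OF assms(2), of 0 m] by blast
  then have T0: "T 0 m l = \<alpha> + q 0 * \<beta>" by simp
  have "ext_const (c ^ j) * U j (Suc m) $$ (a, l) =
      ext_const (c ^ Suc j) * U (Suc j) m $$ (a, l) +
      (ext_const (c ^ j) * (v j a * \<alpha>) + ext_const (c ^ j) * (v j a * q 0 * \<beta>))"
    unfolding U_Suc[OF assms(1,2)] T0
    by (simp add: ext_const_mult mult.assoc distrib_left ext_const_left_commute[of "ext_const (c ^ j)" c])
  moreover have "ext_dvd (c ^ ?N) (ext_const (c ^ Suc j) * U (Suc j) m $$ (a, l))"
    using Suc.IH[of "Suc j"] by simp
  moreover have "ext_dvd (c ^ ?N) (ext_const (c ^ j) * (v j a * \<alpha>))"
    by (rule ext_dvd_power_const[OF _ , of "0 + m - (0 + m) div 4"])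
       (use ext_dvd_mult[OF ext_dvd_one 2(1), of "v j a"] in auto)
  moreover have "ext_dvd (c ^ ?N) (ext_const (c ^ j) * (v j a * q 0 * \<beta>))"
  proof (cases "m = 0")
    case False
    show ?thesis
      by (rule ext_dvd_power_const[OF _ , of "0 + m - 1 - (0 + m - 1) div 4"])
         (use ext_dvd_mult[OF ext_dvd_one 2(2), of "v j a * q 0"] False in \<open>simp, linarith\<close>)
  qed (use 2 in simp)
  ultimately show ?case by (simp only: ext_dvd_add)
qed

lemma pow_M_dvd:
  assumes "a < h" "l < h"
  shows "ext_dvd (c ^ (3 * k)) ((M ^\<^sub>m (4 * k + 1)) $$ (a, l))"
proof -
  have "U 0 (4 * k + 1) = M ^\<^sub>m (4 * k + 1)"
    unfolding U_def using left_mult_one_mat[of "M ^\<^sub>m (4 * k + 1)" h h]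
    by (simp del: pow_mat.simps(2))
  moreover have "0 + (4 * k + 1) - 1 - (0 + (4 * k + 1) + 2) div 4 = 3 * k" by simp
  ultimately show ?thesis
    using U_dvd[OF assms, of 0 "4 * k + 1"] by simp
qed

end

lemma pow_mat_const_mult:
  fixes N N' :: "('e::linorder, 'k::comm_ring_1) exterior mat"
  assumes "N \<in> carrier_mat n n" "N' \<in> carrier_mat n n"
    and "\<And>i j. i < n \<Longrightarrow> j < n \<Longrightarrow> N' $$ (i, j) = ext_const a * N $$ (i, j)"
    and "i < n" "j < n"
  shows "(N' ^\<^sub>m m) $$ (i, j) = ext_const (a ^ m) * (N ^\<^sub>m m) $$ (i, j)"
  using assms(4,5)
proof (induction m arbitrary: i j)
  case 0
  then show ?case using assms(1,2) by auto
next
  case (Suc m)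
  have "(N' ^\<^sub>m Suc m) $$ (i, j) = (\<Sum>k<n. (N' ^\<^sub>m m) $$ (i, k) * N' $$ (k, j))"
    using Suc.prems assms(2) by (simp add: mult_mat_entry[of _ n n])
  also have "\<dots> = (\<Sum>k<n. ext_const (a ^ Suc m) * ((N ^\<^sub>m m) $$ (i, k) * N $$ (k, j)))"
    using Suc by (intro sum.cong refl) (simp only: lessThan_iff assms(3) power_Suc2 ext_const_mult mult.assoc
        ext_const_left_commute[of "(N ^\<^sub>m m) $$ _" a])
  also have "\<dots> = ext_const (a ^ Suc m) * (N ^\<^sub>m Suc m) $$ (i, j)"
    using Suc.prems assms(1) by (simp add: mult_mat_entry[of _ n n] sum_distrib_left)
  finally show ?case .
qed

section \<open>The adjugate of a symmetric matrix\<close>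

lemma (in comm_ring_hom) adj_mat_hom: "map_mat hom (adj_mat A) = adj_mat (map_mat hom A)"
proof (rule eq_matI)
  fix i j assume "i < dim_row (adj_mat (map_mat hom A))" "j < dim_col (adj_mat (map_mat hom A))"
  then have ij: "i < dim_row A" "j < dim_col A" by (simp_all add: adj_mat_def)
  then have "map_mat hom (mat_delete A j i) = mat_delete (map_mat hom A) j i"
    by (intro eq_matI) (auto simp: mat_delete_def)
  then have "hom (det (mat_delete A j i)) = det (mat_delete (map_mat hom A) j i)"
    by (metis hom_det)
  then show "map_mat hom (adj_mat A) $$ (i, j) = adj_mat (map_mat hom A) $$ (i, j)"
    using ij by (simp add: adj_mat_def cofactor_def hom_mult hom_power hom_uminus)
qed (simp_all add: adj_mat_def)

lemma adj_mat_symmetric: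
  assumes X: "X \<in> carrier_mat h h"
    and sym: "\<And>i j. i < h \<Longrightarrow> j < h \<Longrightarrow> X $$ (i, j) = X $$ (j, i)"
    and ij: "i < h" "j < h"
  shows "adj_mat X $$ (i, j) = adj_mat X $$ (j, i)"
proof -
  have "mat_delete X j i = transpose_mat (mat_delete X i j)"
    using X ij by (intro eq_matI) (auto simp: mat_delete_def intro!: sym)
  moreover have "mat_delete X i j \<in> carrier_mat (h - 1) (h - 1)" using X by (rule mat_delete_carrier)
  ultimately have "det (mat_delete X j i) = det (mat_delete X i j)" by (simp add: det_transpose)
  then show ?thesis using X ij by (simp add: adj_mat_def cofactor_def add.commute)
qed

text \<open>\<open>adj X * X1 * adj X1\<close> is computed in two ways; \<open>X1\<close> differs from \<open>X\<close> only in the corner, so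
  that the two adjugates have the same first row.\<close>

lemma adj_mat_rank_one:
  fixes X :: "'a::comm_ring_1 mat"
  assumes X: "X \<in> carrier_mat h h" and ij: "i < h" "j < h"
  defines "X1 \<equiv> mat h h (\<lambda>(i, j). X $$ (i, j) + (if i = 0 \<and> j = 0 then 1 else 0))"
  shows "adj_mat X $$ (0, 0) * adj_mat X $$ (i, j) =
      det X * (adj_mat X1 $$ (i, j) - adj_mat X $$ (i, j)) + adj_mat X $$ (i, 0) * adj_mat X $$ (0, j)"
proof -
  let ?A = "adj_mat X" and ?A1 = "adj_mat X1"
  have h: "0 < h" using ij by simp
  have X1: "X1 \<in> carrier_mat h h" by (simp add: X1_def)
  note A = adj_mat[OF X] and A1 = adj_mat[OF X1]
  \<comment> \<open>Deleting column 0 removes the only entry in which the two matrices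
    differ.\<close>
  have cof: "cofactor X1 k 0 = cofactor X k 0" if "k < h" for k
  proof -
    have "mat_delete X1 k 0 = mat_delete X k 0"
      using X that by (intro eq_matI) (auto simp: mat_delete_def X1_def)
    then show ?thesis by (simp add: cofactor_def)
  qed
  have row0: "?A1 $$ (0, k) = ?A $$ (0, k)" if "k < h" for k
    using that X X1 h by (simp add: adj_mat_def cof)
  have "det X1 = (\<Sum>k<h. X1 $$ (k, 0) * cofactor X1 k 0)"
    by (rule laplace_expansion_column[OF X1 h])
  also have "\<dots> = (\<Sum>k<h. X $$ (k, 0) * cofactor X k 0) + (\<Sum>k<h. if k = 0 then cofactor X k 0 else 0)"
    unfolding sum.distrib[symmetric]
  proof (intro sum.cong refl)
    fix k assume "k \<in> {..<h}"
    then have "X1 $$ (k, 0) = X $$ (k, 0) + (if k = 0 then 1 else 0)" "cofactor X1 k 0 = cofactor X k 0"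
      using cof[of k] h by (simp_all add: X1_def)
    then show "X1 $$ (k, 0) * cofactor X1 k 0 = X $$ (k, 0) * cofactor X k 0 + (if k = 0 then cofactor X k 0 else 0)"
      by (simp add: distrib_right)
  qed
  also have "\<dots> = det X + ?A $$ (0, 0)"
    using h X by (simp add: laplace_expansion_column[OF X h] adj_mat_def sum.delta)
  finally have det1: "det X1 = det X + ?A $$ (0, 0)" .
  have AX1: "(?A * X1) $$ (i, k) = (if i = k then det X else 0) + (if k = 0 then ?A $$ (i, 0) else 0)"
    if k: "k < h" for k
  proof -
    have "(?A * X1) $$ (i, k) = (\<Sum>l<h. ?A $$ (i, l) * X $$ (l, k) +
        (if l = 0 then if k = 0 then ?A $$ (i, l) else 0 else 0))"
      unfolding mult_mat_entry[OF A(1) X1 ij(1) k]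
      by (intro sum.cong refl) (use k in \<open>auto simp: X1_def distrib_left\<close>)
    also have "\<dots> = (?A * X) $$ (i, k) + (if k = 0 then ?A $$ (i, 0) else 0)"
      unfolding mult_mat_entry[OF A(1) X ij(1) k] using h by (simp add: sum.distrib sum.delta)
    finally show ?thesis using A(3) ij k by simp
  qed
  have "?A * X1 * ?A1 = ?A * (X1 * ?A1)"
    by (rule assoc_mult_mat) (use A A1 X1 in auto)
  then have "?A * X1 * ?A1 = det X1 \<cdot>\<^sub>m ?A"
    using A A1 by (simp add: mult_smult_distrib[of _ h h _ h])
  then have "det X1 * ?A $$ (i, j) = (?A * X1 * ?A1) $$ (i, j)"
    using ij A by simp
  also have "\<dots> = (\<Sum>k<h. (if i = k then det X * ?A1 $$ (k, j) else 0) +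
      (if k = 0 then ?A $$ (i, 0) * ?A1 $$ (k, j) else 0))"
    unfolding mult_mat_entry[OF mult_square_carrier[OF A(1) X1] A1(1) ij]
    by (intro sum.cong refl) (auto simp: AX1 distrib_right)
  also have "\<dots> = det X * ?A1 $$ (i, j) + ?A $$ (i, 0) * ?A $$ (0, j)"
    using ij h by (simp add: sum.distrib sum.delta row0)
  finally show ?thesis unfolding det1 by (simp add: algebra_simps)
qed

text \<open>The matrix \<open>Y\<close> of one-forms is not tied to \<open>X\<close>, so that
  \<open>X\<close> can later be perturbed while \<open>Y\<close> stays fixed.\<close>

lemma adj_mat_pow_dvd_corner:
  fixes X :: "'k::{idom, ring_char_0} mat" and Y :: "('e::linorder, 'k) exterior mat"
  assumes X: "X \<in> carrier_mat h h" and Y: "Y \<in> carrier_mat h h"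
    and X_sym: "\<And>i j. i < h \<Longrightarrow> j < h \<Longrightarrow> X $$ (i, j) = X $$ (j, i)"
    and Y_sym: "\<And>i j. i < h \<Longrightarrow> j < h \<Longrightarrow> Y $$ (i, j) = Y $$ (j, i)"
    and Y_form: "\<And>i j. i < h \<Longrightarrow> j < h \<Longrightarrow> ext_homogeneous 1 (Y $$ (i, j))"
    and al: "a < h" "l < h"
  shows "det X ^ (3 * k) dvd adj_mat X $$ (0, 0) ^ (4 * k + 1) *
      ext_coeff (((map_mat ext_const (adj_mat X) * Y) ^\<^sub>m (4 * k + 1)) $$ (a, l)) I"
proof -
  define X1 where "X1 = mat h h (\<lambda>(i, j). X $$ (i, j) + (if i = 0 \<and> j = 0 then 1 else 0))"
  \<comment> \<open>No division by \<open>det X\<close> takes place: \<open>C\<close> is the change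
    of the adjugate when the corner entry grows by 1, so its entries lie in the ring and it inherits
    the symmetry.\<close>
  define C where "C = adj_mat X1 - adj_mat X"
  let ?A = "adj_mat X" and ?N = "map_mat ext_const (adj_mat X) * Y"
  have X1: "X1 \<in> carrier_mat h h" by (simp add: X1_def)
  have h: "0 < h" using al by simp
  note A = adj_mat(1)[OF X] and A1 = adj_mat(1)[OF X1]
  interpret symmetric_one_forms h C Y
  proof
    fix i j assume "i < h" "j < h"
    then show "C $$ (i, j) = C $$ (j, i)"
      using adj_mat_symmetric[OF X X_sym, of i j] adj_mat_symmetric[OF X1, of i j] X_sym A A1
      by (simp add: C_def X1_def)
  qed (use A A1 Y Y_sym Y_form in \<open>auto simp: C_def\<close>)
  interpret rank_one_update h C Y "det X" "\<lambda>i. ?A $$ (i, 0)" ..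
  have M: "M $$ (i, j) = ext_const (?A $$ (0, 0)) * ?N $$ (i, j)" if "i < h" "j < h" for i j
  proof -
    have "det X * C $$ (i, p) + ?A $$ (i, 0) * ?A $$ (p, 0) = ?A $$ (0, 0) * ?A $$ (i, p)" if "p < h" for p
      using adj_mat_rank_one[OF X \<open>i < h\<close> that] adj_mat_symmetric[OF X X_sym that h] A A1 that \<open>i < h\<close>
      by (simp add: C_def X1_def)
    then show ?thesis
      using that A Y by (simp add: M_def mult_mat_entry[of _ h h _ h] ext_const_mult sum_distrib_left mult.assoc
          carrier_matD[OF A] cong: sum.cong_simp)
  qed
  have "?N \<in> carrier_mat h h" using A Y by simp
  then have "(M ^\<^sub>m (4 * k + 1)) $$ (a, l) = ext_const (?A $$ (0, 0) ^ (4 * k + 1)) * (?N ^\<^sub>m (4 * k + 1)) $$ (a, l)"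
    using pow_mat_const_mult[OF _ M_carrier M al] by blast
  then show ?thesis using pow_M_dvd[OF al, of k] by (simp add: ext_dvd_def)
qed

section \<open>Removing the corner minor by a generic perturbation\<close>

text \<open>Here \<open>c\<close> is cancellable modulo \<open>d\<close>, a one-sided substitute for
  coprimality that makes sense without greatest common divisors. It is converted into cancelling
  \<open>d\<close> modulo powers of \<open>c\<close>.\<close>

lemma dvd_power_mult_cancel:
  fixes c d :: "'a::idom"
  assumes "d \<noteq> 0" and "\<And>q. d dvd c * q \<Longrightarrow> d dvd q" and "c ^ j dvd d ^ n * f"
  shows "c ^ j dvd f"
proof -
  have 1: "d dvd q" if "d dvd c ^ m * q" for m q
    using that by (induction m) (auto simp: mult.assoc intro: assms(2))
  have 2: "c ^ j dvd g" if dvd: "c ^ j dvd d * g" for g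
  proof -
    obtain q where q: "d * g = c ^ j * q" using dvd by (rule dvdE)
    then have "d dvd q" using 1[of j q] by (metis dvd_triv_left)
    then obtain r where "q = d * r" by (rule dvdE)
    then have "d * g = d * (c ^ j * r)" using q by (simp add: mult_ac)
    then show ?thesis using assms(1) by simp
  qed
  show ?thesis using assms(3) by (induction n) (auto simp: mult.assoc intro: 2)
qed

text \<open>The inner variable is the deformation parameter and the outer one carries the division
  with remainder; only the parameter is specialised.\<close>

abbreviation at_zero :: "'a::comm_ring_1 poly poly \<Rightarrow> 'a poly" where
  "at_zero \<equiv> map_poly (\<lambda>c. poly c 0)"

lemma at_zero_mult: "at_zero (p * q) = at_zero p * at_zero q"
proof -
  interpret map_poly_comm_ring_hom "\<lambda>c::'a poly. poly c 0" by unfold_locales auto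
  show ?thesis by (rule hom_mult)
qed

lemma at_zero_pCons: "at_zero (pCons c p) = pCons (poly c 0) (at_zero p)"
  by (rule poly_eqI) (simp add: coeff_map_poly coeff_pCons split: nat.split)

lemma at_zero_eq_0:
  fixes p :: "'a::idom poly poly"
  assumes "at_zero p = 0"
  obtains q where "p = smult [:0, 1:] q"
proof -
  have "[:0, 1:] dvd Polynomial.coeff p n" for n
  proof -
    have "Polynomial.coeff (at_zero p) n = 0" using assms by simp
    then show ?thesis by (simp add: coeff_map_poly dvd_iff_poly_eq_0)
  qed
  then have "[:[:0, 1:]:] dvd p" by (simp add: const_poly_dvd_iff)
  then show ?thesis using that by (auto elim: dvdE)
qed

text \<open>A remainder modulo the monic \<open>d\<close> that is a multiple of \<open>d\<close> after multiplication by \<open>c\<close>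
  vanishes at parameter \<open>0\<close>, because it has too many roots there; division by the parameter
  gives a descent.\<close>

lemma monic_dvd_cancel:
  fixes c d q :: "'a::idom poly poly"
  assumes monic: "lead_coeff d = 1" and xs: "card xs \<ge> Polynomial.degree d"
    and roots: "\<And>x. x \<in> xs \<Longrightarrow> poly (at_zero d) x = 0 \<and> poly (at_zero c) x \<noteq> 0"
    and dvd: "d dvd c * q"
  shows "d dvd q"
proof -
  have d0: "at_zero d \<noteq> 0"
  proof
    assume "at_zero d = 0"
    then have "Polynomial.coeff (at_zero d) (Polynomial.degree d) = 0" by simp
    then show False by (simp add: coeff_map_poly monic)
  qed
  have zero: "r = 0" if "d dvd c * r" "Polynomial.degree r < Polynomial.degree d" for r
    using that
  \<comment> \<open>The leading coefficient is a polynomial in the parameter. Each division of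
    \<open>r\<close> by the parameter lowers the degree of that coefficient and leaves the outer
    degree of \<open>r\<close> unchanged.\<close>
  proof (induction "Polynomial.degree (lead_coeff r)" arbitrary: r rule: less_induct)
    case less
    obtain g where g: "c * r = d * g" using less.prems(1) by (rule dvdE)
    then have g0: "at_zero c * at_zero r = at_zero d * at_zero g" by (metis at_zero_mult)
    have "at_zero r = 0"
    proof (rule ccontr)
      assume nz: "at_zero r \<noteq> 0"
      have "poly (at_zero r) x = 0" if "x \<in> xs" for x
        using arg_cong[OF g0, of "\<lambda>p. poly p x"] roots[OF that] by simp
      then have "card xs \<le> card {x. poly (at_zero r) x = 0}"
        by (intro card_mono poly_roots_finite nz) auto
      also have "\<dots> \<le> Polynomial.degree (at_zero r)" using nz by (rule card_poly_roots_bound)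
      also have "\<dots> \<le> Polynomial.degree r" by (rule degree_map_poly_le)
      finally show False using xs less.prems by simp
    qed
    then obtain r' where r': "r = smult [:0, 1:] r'" by (rule at_zero_eq_0)
    have "at_zero g = 0" using g0 d0 \<open>at_zero r = 0\<close> by simp
    then obtain g' where g': "g = smult [:0, 1:] g'" by (rule at_zero_eq_0)
    have "smult [:0, 1:] (c * r') = smult [:0, 1:] (d * g')"
      using g unfolding r' g' mult_smult_right .
    then have "smult [:0, 1:] (c * r' - d * g') = 0" unfolding smult_diff_right by (rule right_minus_eq[THEN iffD2])
    then have "c * r' - d * g' = 0" unfolding smult_eq_0_iff by simp
    then have "c * r' = d * g'" by (rule right_minus_eq[THEN iffD1])
    then have dvd': "d dvd c * r'" by simp
    show "r = 0"
    proof (cases "r' = 0")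
      case False
      have "lead_coeff r = [:0, 1:] * lead_coeff r'" unfolding r' by (rule lead_coeff_smult)
      then have "Polynomial.degree (lead_coeff r') < Polynomial.degree (lead_coeff r)"
        using False by (simp add: Polynomial.degree_mult_eq)
      moreover have "Polynomial.degree r' < Polynomial.degree d"
        using less.prems(2) unfolding r' degree_smult_eq by simp
      ultimately have "r' = 0" using less.hyps dvd' by blast
      then show ?thesis unfolding r' by simp
    qed (simp add: r')
  qed
  have dn: "d \<noteq> 0" using monic by auto
  \<comment> \<open>Pseudo-division scales \<open>q\<close> by a power of the leading coefficient of
    \<open>d\<close>, which is 1, so this is an honest division with remainder.\<close>
  obtain s r where sr: "pseudo_divmod q d = (s, r)" by force
  have q: "q = d * s + r" and r: "r = 0 \<or> Polynomial.degree r < Polynomial.degree d"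
    using pseudo_divmod[OF dn sr] monic by simp_all
  have "d dvd c * q - d * (c * s)" using dvd by simp
  then have "d dvd c * r" by (simp add: q algebra_simps)
  then have "r = 0" using r zero by blast
  then show ?thesis using q by simp
qed

text \<open>An arrowhead matrix with diagonal 0, 1, ..., h - 1 and a border of ones. With
  \<open>t\<close> added on the diagonal its corner minor is the product of the t + p for 0 < p < h,
  with distinct roots, and the border keeps the full determinant nonzero at each of them.\<close>

definition arrow :: "nat \<Rightarrow> nat \<Rightarrow> 'a::comm_ring_1" where
  "arrow i j = (if i = 0 \<and> j = 0 then 0 else if i = 0 \<or> j = 0 then 1 else if i = j then of_nat i else 0)"

text \<open>With parameter \<open>s\<close> and variable \<open>t\<close>, this is \<open>s L + (1 - s) arrow + t\<close>.\<close>

definition perturb :: "nat \<Rightarrow> 'a::comm_ring_1 mat \<Rightarrow> 'a poly poly mat" where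
  "perturb h L = mat h h (\<lambda>(i, j). [:[:arrow i j, L $$ (i, j) - arrow i j:], if i = j then 1 else 0:])"

lemma perturb_carrier [simp]: "perturb h L \<in> carrier_mat h h"
  by (simp add: perturb_def)

lemma perturb_specialise:
  assumes "L \<in> carrier_mat h h"
  shows "map_mat (\<lambda>p. poly (poly p 0) 1) (perturb h L) = L"
  using assms by (intro eq_matI) (auto simp: perturb_def)

lemma perturb_at_zero:
  "map_mat (\<lambda>p. poly (at_zero p) x) (perturb h L) =
    mat h h (\<lambda>(i, j). arrow i j + (if i = j then x else 0))"
  by (intro eq_matI) (auto simp: perturb_def at_zero_pCons)

lemma adj_mat_corner: "X \<in> carrier_mat h h \<Longrightarrow> 0 < h \<Longrightarrow> adj_mat X $$ (0, 0) = det (mat_delete X 0 0)"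
  by (simp add: adj_mat_def cofactor_def)

text \<open>The variable \<open>t\<close> sits on the diagonal, so the corner minor is a
  characteristic polynomial over the ring of polynomials in the parameter.\<close>

lemma perturb_corner_monic:
  fixes L :: "'a::idom mat"
  assumes "0 < h"
  shows "lead_coeff (adj_mat (perturb h L) $$ (0, 0)) = 1"
    and "Polynomial.degree (adj_mat (perturb h L) $$ (0, 0)) = h - 1"
proof -
  define K :: "'a poly mat" where "K = mat (h - 1) (h - 1)
      (\<lambda>(i, j). - [:arrow (Suc i) (Suc j), L $$ (Suc i, Suc j) - arrow (Suc i) (Suc j):])"
  have "mat_delete (perturb h L) 0 0 = char_poly_matrix K"
  proof (rule eq_matI)
    fix i j assume "i < dim_row (char_poly_matrix K)" "j < dim_col (char_poly_matrix K)"
    then have ij: "i < h - 1" "j < h - 1" by (simp_all add: K_def char_poly_matrix_def)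
    then have "Suc i < h" "Suc j < h" by auto
    then show "mat_delete (perturb h L) 0 0 $$ (i, j) = char_poly_matrix K $$ (i, j)"
      using ij by (simp add: mat_delete_def perturb_def char_poly_matrix_def K_def)
  qed (simp_all add: K_def char_poly_matrix_def perturb_def)
  then have "adj_mat (perturb h L) $$ (0, 0) = char_poly K"
    by (simp add: adj_mat_corner[OF perturb_carrier assms] char_poly_def)
  moreover have "K \<in> carrier_mat (h - 1) (h - 1)" by (simp add: K_def)
  ultimately show "lead_coeff (adj_mat (perturb h L) $$ (0, 0)) = 1"
    and "Polynomial.degree (adj_mat (perturb h L) $$ (0, 0)) = h - 1"
    using degree_monic_char_poly[of K "h - 1"] by auto
qed

text \<open>Away from the border the matrix is diagonal, and t = -p cancels the entry
  \<open>p\<close>, leaving a zero row in the minor.\<close>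

lemma arrow_corner_zero:
  assumes "0 < p" "p < h"
  shows "det (mat_delete (mat h h (\<lambda>(i, j). arrow i j + (if i = j then - of_nat p else 0))) 0 0) =
    (0 :: 'a::comm_ring_1)" (is "det ?D = 0")
proof -
  have "?D \<in> carrier_mat (h - 1) (h - 1)" by (rule mat_delete_carrier) simp
  then have "det ?D = (\<Sum>j<h - 1. ?D $$ (p - 1, j) * cofactor ?D (p - 1) j)"
    by (rule laplace_expansion_row) (use assms in simp)
  also have "\<dots> = 0"
    by (intro sum.neutral) (use assms in \<open>auto simp: mat_delete_def arrow_def\<close>)
  finally show ?thesis .
qed

text \<open>In a kernel vector, row \<open>p\<close> forces entry 0 to vanish, then row
  \<open>i\<close> forces entry \<open>i\<close> for each other positive \<open>i\<close>, and at
  last row 0 forces entry \<open>p\<close>.\<close>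

lemma arrow_det_nonzero:
  assumes p: "0 < p" "p < h"
  shows "det (mat h h (\<lambda>(i, j). arrow i j + (if i = j then - of_nat p else 0))) \<noteq>
    (0 :: 'a::{idom, ring_char_0})" (is "det ?D \<noteq> 0")
proof
  assume "det ?D = 0"
  moreover have D: "?D \<in> carrier_mat h h" by simp
  ultimately obtain v where v: "v \<in> carrier_vec h" "v \<noteq> 0\<^sub>v h" "?D *\<^sub>v v = 0\<^sub>v h"
    using det_0_iff_vec_prod_zero[OF D] by blast
  have row: "(\<Sum>j<h. (arrow i j + (if i = j then - of_nat p else 0)) * v $ j) = 0" if "i < h" for i
  proof -
    have "(?D *\<^sub>v v) $ i = 0" using v(3) that by simp
    then show ?thesis using that v(1) by (simp add: scalar_prod_def lessThan_atLeast0)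
  qed
  have row_pos: "v $ 0 + (of_nat i - of_nat p) * v $ i = 0" if i: "0 < i" "i < h" for i
  proof -
    have "(\<Sum>j<h. (arrow i j + (if i = j then - of_nat p else 0)) * v $ j) =
        (\<Sum>j\<in>{0, i}. (arrow i j + (if i = j then - of_nat p else 0)) * v $ j)"
      by (rule sum.mono_neutral_right) (use i in \<open>auto simp: arrow_def\<close>)
    then show ?thesis using row[of i] i by (simp add: arrow_def)
  qed
  have v0: "v $ 0 = 0" using row_pos[OF p] by simp
  have vi: "v $ i = 0" if "i < h" "i \<noteq> p" for i
    using row_pos[of i] that v0 by (cases "i = 0") (auto simp: of_nat_eq_iff)
  have "(\<Sum>j<h. (arrow 0 j + (if 0 = j then - of_nat p else 0)) * v $ j) =
      (\<Sum>j\<in>{p}. (arrow 0 j + (if 0 = j then - of_nat p else 0)) * v $ j)"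
    by (rule sum.mono_neutral_right) (use p vi in auto)
  then have "v $ p = 0" using row[of 0] p by (simp add: arrow_def)
  then have "v $ i = 0" if "i < h" for i using vi that by (cases "i = p") auto
  then have "v = 0\<^sub>v h" using v(1) by (intro eq_vecI) auto
  then show False using v(2) by simp
qed

lemma perturb_dvd_cancel:
  fixes L :: "'a::{idom, ring_char_0} mat"
  assumes h: "0 < h" and dvd: "adj_mat (perturb h L) $$ (0, 0) dvd det (perturb h L) * q"
  shows "adj_mat (perturb h L) $$ (0, 0) dvd q"
proof (rule monic_dvd_cancel[OF perturb_corner_monic(1)[OF h] _ _ dvd])
  \<comment> \<open>These are the roots of the corner minor at parameter 0, exactly as many as its
    degree.\<close>
  let ?xs = "(\<lambda>p. - of_nat p :: 'a) ` {1..<h}"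
  have "card ?xs = h - 1" by (subst card_image) (auto simp: inj_on_def)
  then show "Polynomial.degree (adj_mat (perturb h L) $$ (0, 0)) \<le> card ?xs"
    by (simp add: perturb_corner_monic(2)[OF h])
  fix x assume "x \<in> ?xs"
  then obtain p where p: "0 < p" "p < h" "x = - of_nat p" by force
  interpret at0: map_poly_comm_ring_hom "\<lambda>c::'a poly. poly c 0" by unfold_locales auto
  interpret ev: comm_ring_hom "\<lambda>r. poly (at_zero r) x"
    by unfold_locales (auto simp: at0.hom_mult at0.hom_add)
  let ?D = "mat h h (\<lambda>(i, j). arrow i j + (if i = j then - of_nat p else 0)) :: 'a mat"
  have D: "map_mat (\<lambda>r. poly (at_zero r) x) (perturb h L) = ?D"
    unfolding perturb_at_zero p(3) ..
  have "poly (at_zero (det (perturb h L))) x = det ?D" unfolding D[symmetric] ev.hom_det ..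
  moreover have "poly (at_zero (adj_mat (perturb h L) $$ (0, 0))) x = adj_mat ?D $$ (0, 0)"
    unfolding D[symmetric] ev.adj_mat_hom[symmetric] using h by (simp add: adj_mat_def perturb_def)
  ultimately show "poly (at_zero (adj_mat (perturb h L) $$ (0, 0))) x = 0 \<and>
      poly (at_zero (det (perturb h L))) x \<noteq> 0"
    using arrow_corner_zero[OF p(1,2)] arrow_det_nonzero[OF p(1,2)] h
    by (simp add: adj_mat_corner[of ?D h])
qed

theorem adj_mat_pow_dvd:
  fixes X :: "'k::{idom, ring_char_0} mat" and Y :: "('e::linorder, 'k) exterior mat"
  assumes X: "X \<in> carrier_mat h h" and Y: "Y \<in> carrier_mat h h"
    and X_sym: "\<And>i j. i < h \<Longrightarrow> j < h \<Longrightarrow> X $$ (i, j) = X $$ (j, i)"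
    and Y_sym: "\<And>i j. i < h \<Longrightarrow> j < h \<Longrightarrow> Y $$ (i, j) = Y $$ (j, i)"
    and Y_form: "\<And>i j. i < h \<Longrightarrow> j < h \<Longrightarrow> ext_homogeneous 1 (Y $$ (i, j))"
    and al: "a < h" "l < h"
  shows "ext_dvd (det X ^ (3 * k)) (((map_mat ext_const (adj_mat X) * Y) ^\<^sub>m (4 * k + 1)) $$ (a, l))"
  unfolding ext_dvd_def
proof
  fix I
  \<comment> \<open>Only \<open>X\<close> is perturbed; \<open>Y\<close> is carried along with
    constant coefficients. Evaluation at t = 0 and s = 1 recovers the original pair.\<close>
  let ?emb = "\<lambda>r::'k. [:[:r:]:]" and ?ev = "\<lambda>p::'k poly poly. poly (poly p 0) 1"
  let ?P = "perturb h X" and ?Y = "map_mat (ext_map ?emb) Y"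
  let ?N = "map_mat ext_const (adj_mat ?P) * ?Y"
  have h: "0 < h" using al by simp
  interpret emb: comm_ring_hom ?emb by unfold_locales (auto simp: one_pCons)
  interpret ev: comm_ring_hom ?ev by unfold_locales auto
  interpret E: Ring_Hom.ring_hom "ext_map ?ev :: ('e, _) exterior \<Rightarrow> _" by (rule ev.ext_map_ring_hom)
  have A: "adj_mat ?P \<in> carrier_mat h h" by (rule adj_mat(1)) simp
  then have N: "?N \<in> carrier_mat h h" using Y by simp
  have "det ?P ^ (3 * k) dvd adj_mat ?P $$ (0, 0) ^ (4 * k + 1) * ext_coeff ((?N ^\<^sub>m (4 * k + 1)) $$ (a, l)) I"
  proof (rule adj_mat_pow_dvd_corner[OF perturb_carrier _ _ _ _ al])
    show "?P $$ (i, j) = ?P $$ (j, i)" if "i < h" "j < h" for i j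
      using that X_sym by (simp add: perturb_def arrow_def)
    show "?Y $$ (i, j) = ?Y $$ (j, i)" "ext_homogeneous 1 (?Y $$ (i, j))" if "i < h" "j < h" for i j
      using that Y Y_sym Y_form by (auto intro!: ext_homogeneous_map)
  qed (use Y in simp)
  moreover have "adj_mat ?P $$ (0, 0) \<noteq> 0"
    using perturb_corner_monic(1)[OF h, of X] by auto
  ultimately have "det ?P ^ (3 * k) dvd ext_coeff ((?N ^\<^sub>m (4 * k + 1)) $$ (a, l)) I"
    using dvd_power_mult_cancel perturb_dvd_cancel[OF h] by blast
  then have "?ev (det ?P ^ (3 * k)) dvd ?ev (ext_coeff ((?N ^\<^sub>m (4 * k + 1)) $$ (a, l)) I)"
    by (metis dvdE dvdI ev.hom_mult)
  moreover have "?ev (det ?P) = det X"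
    using ev.hom_det[of ?P] perturb_specialise[OF X] by simp
  moreover have "?ev (ext_coeff ((?N ^\<^sub>m n) $$ (a, l)) I) =
      ext_coeff ((map_mat (ext_map ?ev) ?N ^\<^sub>m n) $$ (a, l)) I" for n
    using al by (simp add: ext_coeff_map carrier_matD[OF A] carrier_matD[OF Y] flip: E.mat_hom_pow[OF N])
  moreover have "map_mat (ext_map ?ev) ?N = map_mat ext_const (adj_mat X) * Y"
  proof -
    have "map_mat (ext_map ?ev) (map_mat ext_const (adj_mat ?P) :: ('e, _) exterior mat) =
        map_mat ext_const (map_mat ?ev (adj_mat ?P))"
      by (intro eq_matI) (auto simp: ev.ext_map_const)
    then have "map_mat (ext_map ?ev) (map_mat ext_const (adj_mat ?P) :: ('e, _) exterior mat) =
        map_mat ext_const (adj_mat X)"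
      by (simp only: ev.adj_mat_hom perturb_specialise[OF X])
    moreover have "map_mat (ext_map ?ev) ?Y = Y"
      by (intro eq_matI exterior_eqI) (auto simp: ext_coeff_map)
    ultimately show ?thesis
      using E.mat_hom_mult[of "map_mat ext_const (adj_mat ?P)" h h ?Y h] A Y by simp
  qed
  ultimately show "det X ^ (3 * k) dvd
      ext_coeff (((map_mat ext_const (adj_mat X) * Y) ^\<^sub>m (4 * k + 1)) $$ (a, l)) I"
    by (simp only: ev.hom_power)
qed

section \<open>Polynomials in the edge variables\<close>

lemma of_int_eq_single: "(of_int c :: 'e qpoly) = Poly_Mapping.single 0 (of_int c)"
  by simp

lemma poly_mapping_eq_sum_single:
  fixes p :: "'a \<Rightarrow>\<^sub>0 'b::comm_monoid_add"
  assumes "finite M" "Poly_Mapping.keys p \<subseteq> M"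
  shows "p = (\<Sum>m\<in>M. Poly_Mapping.single m (Poly_Mapping.lookup p m))"
proof (rule poly_mapping_eqI)
  fix k
  have "Poly_Mapping.lookup (\<Sum>m\<in>M. Poly_Mapping.single m (Poly_Mapping.lookup p m)) k =
      (\<Sum>m\<in>M. if m = k then Poly_Mapping.lookup p m else 0)"
    unfolding lookup_sum by (intro sum.cong refl) (simp add: lookup_single when_def)
  also have "\<dots> = Poly_Mapping.lookup p k"
    using assms by (auto simp: sum.delta in_keys_iff)
  finally show "Poly_Mapping.lookup p k =
      Poly_Mapping.lookup (\<Sum>m\<in>M. Poly_Mapping.single m (Poly_Mapping.lookup p m)) k" by simp
qed

subsection \<open>Substitution\<close>

definition monom_subst :: "('e \<Rightarrow> 'f qpoly) \<Rightarrow> ('e \<Rightarrow>\<^sub>0 nat) \<Rightarrow> 'f qpoly" where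
  "monom_subst \<sigma> m = (\<Prod>e\<in>Poly_Mapping.keys m. \<sigma> e ^ Poly_Mapping.lookup m e)"

lemma monom_subst_superset:
  assumes "finite F" "Poly_Mapping.keys m \<subseteq> F"
  shows "monom_subst \<sigma> m = (\<Prod>e\<in>F. \<sigma> e ^ Poly_Mapping.lookup m e)"
  unfolding monom_subst_def
  by (rule prod.mono_neutral_left) (use assms in \<open>auto simp: in_keys_iff\<close>)

lemma monom_subst_add: "monom_subst \<sigma> (m + n) = monom_subst \<sigma> m * monom_subst \<sigma> n"
proof -
  let ?F = "Poly_Mapping.keys m \<union> Poly_Mapping.keys n"
  have "monom_subst \<sigma> (m + n) = (\<Prod>e\<in>?F. \<sigma> e ^ Poly_Mapping.lookup (m + n) e)"
    by (rule monom_subst_superset) (use keys_add[of m n] in auto)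
  then show ?thesis
    by (simp add: monom_subst_superset[of ?F m] monom_subst_superset[of ?F n] lookup_add power_add prod.distrib)
qed

lemma poly_subst_superset:
  assumes "finite M" "Poly_Mapping.keys p \<subseteq> M"
  shows "poly_subst \<sigma> p = (\<Sum>m\<in>M. Poly_Mapping.single 0 (Poly_Mapping.lookup p m) * monom_subst \<sigma> m)"
  unfolding poly_subst_def monom_subst_def
  by (rule sum.mono_neutral_left) (use assms in \<open>auto simp: in_keys_iff\<close>)

lemma poly_subst_single: "poly_subst \<sigma> (Poly_Mapping.single m c) = Poly_Mapping.single 0 c * monom_subst \<sigma> m"
  by (subst poly_subst_superset[of "{m}"]) auto

lemma poly_subst_add: "poly_subst \<sigma> (p + q) = poly_subst \<sigma> p + poly_subst \<sigma> q"
proof -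
  let ?M = "Poly_Mapping.keys p \<union> Poly_Mapping.keys q"
  have "poly_subst \<sigma> (p + q) = (\<Sum>m\<in>?M. Poly_Mapping.single 0 (Poly_Mapping.lookup (p + q) m) * monom_subst \<sigma> m)"
    by (rule poly_subst_superset) (use keys_add[of p q] in auto)
  then show ?thesis
    by (simp add: poly_subst_superset[of ?M p] poly_subst_superset[of ?M q] lookup_add single_add
        distrib_right sum.distrib)
qed

lemma poly_subst_zero: "poly_subst \<sigma> 0 = 0"
  by (simp add: poly_subst_def)

lemma poly_subst_sum: "poly_subst \<sigma> (\<Sum>i\<in>A. f i) = (\<Sum>i\<in>A. poly_subst \<sigma> (f i))"
  by (induction A rule: infinite_finite_induct) (simp_all add: poly_subst_zero poly_subst_add)

lemma poly_subst_mult: "poly_subst \<sigma> (p * q) = poly_subst \<sigma> p * poly_subst \<sigma> q"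
proof -
  let ?p = "\<lambda>m. Poly_Mapping.single m (Poly_Mapping.lookup p m)"
    and ?q = "\<lambda>m. Poly_Mapping.single m (Poly_Mapping.lookup q m)"
    and ?P = "Poly_Mapping.keys p" and ?Q = "Poly_Mapping.keys q"
  have *: "poly_subst \<sigma> (?p m * ?q n) = poly_subst \<sigma> (?p m) * poly_subst \<sigma> (?q n)" for m n
  proof -
    have "poly_subst \<sigma> (?p m * ?q n) =
        Poly_Mapping.single (0 + 0) (Poly_Mapping.lookup p m * Poly_Mapping.lookup q n) *
          (monom_subst \<sigma> m * monom_subst \<sigma> n)"
      by (simp only: mult_single poly_subst_single monom_subst_add add_0)
    then show ?thesis by (simp only: mult_single[symmetric] poly_subst_single mult_ac)
  qed
  have "poly_subst \<sigma> (p * q) = poly_subst \<sigma> ((\<Sum>m\<in>?P. ?p m) * (\<Sum>n\<in>?Q. ?q n))"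
    using poly_mapping_eq_sum_single[of ?P p] poly_mapping_eq_sum_single[of ?Q q] by simp
  also have "\<dots> = (\<Sum>m\<in>?P. \<Sum>n\<in>?Q. poly_subst \<sigma> (?p m) * poly_subst \<sigma> (?q n))"
    unfolding sum_product poly_subst_sum * ..
  also have "\<dots> = poly_subst \<sigma> (\<Sum>m\<in>?P. ?p m) * poly_subst \<sigma> (\<Sum>n\<in>?Q. ?q n)"
    unfolding sum_product poly_subst_sum ..
  finally show ?thesis
    using poly_mapping_eq_sum_single[of ?P p] poly_mapping_eq_sum_single[of ?Q q] by simp
qed

lemma poly_subst_one: "poly_subst \<sigma> 1 = 1"
  using poly_subst_single[of \<sigma> 0 1] by (simp add: monom_subst_def)

lemma comm_ring_hom_poly_subst: "comm_ring_hom (poly_subst \<sigma>)"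
  by unfold_locales (simp_all add: poly_subst_add poly_subst_mult poly_subst_one poly_subst_zero)

lemma poly_subst_xvar: "poly_subst \<sigma> (xvar e) = \<sigma> e"
  unfolding xvar_def poly_subst_single by (simp add: monom_subst_def)

lemma xvar_power: "xvar e ^ k = Poly_Mapping.single (Poly_Mapping.single e k) 1"
  by (induction k) (simp_all add: xvar_def mult_single flip: single_add)

lemma monom_subst_xvar: "monom_subst xvar m = Poly_Mapping.single m 1"
proof -
  have "monom_subst xvar m =
      Poly_Mapping.single (\<Sum>e\<in>F. Poly_Mapping.single e (Poly_Mapping.lookup m e)) 1"
    if "F = Poly_Mapping.keys m" for F
  proof -
    have "finite F" using that by simp
    then have "(\<Prod>e\<in>F. xvar e ^ Poly_Mapping.lookup m e) =
        Poly_Mapping.single (\<Sum>e\<in>F. Poly_Mapping.single e (Poly_Mapping.lookup m e)) 1"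
      by (induction F rule: finite_induct) (simp_all add: xvar_power mult_single)
    then show ?thesis by (simp add: monom_subst_def that)
  qed
  then show ?thesis using poly_mapping_eq_sum_single[of "Poly_Mapping.keys m" m] by simp
qed

lemma poly_subst_id_on:
  assumes "\<And>e. e \<in> pvars p \<Longrightarrow> \<sigma> e = xvar e"
  shows "poly_subst \<sigma> p = p"
proof -
  have "monom_subst \<sigma> m = Poly_Mapping.single m 1" if "m \<in> Poly_Mapping.keys p" for m
  proof -
    have "monom_subst \<sigma> m = monom_subst xvar m"
      unfolding monom_subst_def by (intro prod.cong refl) (metis (no_types, lifting) UN_I assms pvars_def that)
    then show ?thesis by (simp add: monom_subst_xvar)
  qed
  then have "poly_subst \<sigma> p = (\<Sum>m\<in>Poly_Mapping.keys p. Poly_Mapping.single m (Poly_Mapping.lookup p m))"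
    by (simp add: poly_subst_superset[of "Poly_Mapping.keys p"] mult_single)
  then show ?thesis using poly_mapping_eq_sum_single[of "Poly_Mapping.keys p" p] by simp
qed

text \<open>Cross-multiplying two admissible representations and substituting shows that the
  description in \<open>ratfun_subst\<close> has a unique solution.\<close>

lemma ratfun_subst_Fract:
  assumes "q \<noteq> 0" "poly_subst \<sigma> q \<noteq> 0"
  shows "ratfun_subst_defined \<sigma> (Fract p q)"
    and "ratfun_subst \<sigma> (Fract p q) = Fract (poly_subst \<sigma> p) (poly_subst \<sigma> q)"
proof -
  show "ratfun_subst_defined \<sigma> (Fract p q)"
    unfolding ratfun_subst_defined_def using assms by blast
  show "ratfun_subst \<sigma> (Fract p q) = Fract (poly_subst \<sigma> p) (poly_subst \<sigma> q)"
    unfolding ratfun_subst_def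
  proof (rule the_equality)
    fix g assume "\<exists>p' q'. Fract p q = Fract p' q' \<and> q' \<noteq> 0 \<and> poly_subst \<sigma> q' \<noteq> 0 \<and>
        g = Fract (poly_subst \<sigma> p') (poly_subst \<sigma> q')"
    then obtain p' q' where 1: "Fract p q = Fract p' q'" "q' \<noteq> 0" "poly_subst \<sigma> q' \<noteq> 0"
        "g = Fract (poly_subst \<sigma> p') (poly_subst \<sigma> q')" by blast
    have "p * q' = p' * q" using 1 assms by (simp add: eq_fract)
    then have "poly_subst \<sigma> p * poly_subst \<sigma> q' = poly_subst \<sigma> p' * poly_subst \<sigma> q"
      by (metis poly_subst_mult)
    then show "g = Fract (poly_subst \<sigma> p) (poly_subst \<sigma> q)" using 1 assms by (simp add: eq_fract)
  qed (use assms in blast)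
qed

subsection \<open>Variables and degrees\<close>

lemma pvars_zero [simp]: "pvars 0 = {}"
  by (simp add: pvars_def)

lemma pvars_const [simp]: "pvars (Poly_Mapping.single 0 c) = {}"
  by (simp add: pvars_def)

lemma pvars_xvar: "pvars (xvar e) = {e}"
  by (simp add: pvars_def xvar_def)

lemma pvars_add: "pvars (p + q) \<subseteq> pvars p \<union> pvars q"
  using keys_add[of p q] unfolding pvars_def by blast

lemma pvars_sum: "(\<And>i. i \<in> A \<Longrightarrow> pvars (f i) \<subseteq> V) \<Longrightarrow> pvars (\<Sum>i\<in>A. f i) \<subseteq> V"
proof (induction A rule: infinite_finite_induct)
  case (insert x F)
  then show ?case using pvars_add[of "f x" "\<Sum>i\<in>F. f i"] by auto
qed simp_all

lemma pvars_mult: "pvars (p * q) \<subseteq> pvars p \<union> pvars q"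
proof
  fix e assume "e \<in> pvars (p * q)"
  then obtain m where m: "m \<in> Poly_Mapping.keys (p * q)" "e \<in> Poly_Mapping.keys m" by (auto simp: pvars_def)
  then obtain a b where "m = a + b" "a \<in> Poly_Mapping.keys p" "b \<in> Poly_Mapping.keys q"
    using keys_mult[of p q] by blast
  then show "e \<in> pvars p \<union> pvars q" using m keys_add[of a b] unfolding pvars_def by blast
qed

lemma pvars_one [simp]: "pvars 1 = {}"
  by (simp add: pvars_def)

lemma pvars_prod: "(\<And>i. i \<in> A \<Longrightarrow> pvars (f i) \<subseteq> V) \<Longrightarrow> pvars (\<Prod>i\<in>A. f i) \<subseteq> V"
proof (induction A rule: infinite_finite_induct)
  case (insert x F)
  then show ?case using pvars_mult[of "f x" "\<Prod>i\<in>F. f i"] by auto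
qed simp_all

lemma pvars_power: "pvars (p ^ n) \<subseteq> pvars p"
proof (induction n)
  case (Suc n)
  then show ?case using pvars_mult[of p "p ^ n"] by auto
qed simp

lemma pvars_poly_subst:
  assumes "\<And>e. pvars (\<sigma> e) \<subseteq> V"
  shows "pvars (poly_subst \<sigma> p) \<subseteq> V"
  unfolding poly_subst_def
proof (rule pvars_sum)
  fix m
  have "pvars (\<Prod>e\<in>Poly_Mapping.keys m. \<sigma> e ^ Poly_Mapping.lookup m e) \<subseteq> V"
    by (rule pvars_prod) (rule order_trans[OF pvars_power assms])
  then show "pvars (Poly_Mapping.single 0 (Poly_Mapping.lookup p m) *
      (\<Prod>e\<in>Poly_Mapping.keys m. \<sigma> e ^ Poly_Mapping.lookup m e)) \<subseteq> V"
    using pvars_mult[of "Poly_Mapping.single 0 (Poly_Mapping.lookup p m)"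
        "\<Prod>e\<in>Poly_Mapping.keys m. \<sigma> e ^ Poly_Mapping.lookup m e"] by simp
qed

text \<open>Setting the variables outside \<open>V\<close> to 0 fixes \<open>c\<close> and
  \<open>q\<close>, hence by cancellation also \<open>p\<close>.\<close>

lemma pvars_divisor:
  fixes c p q :: "('e::linorder) qpoly"
  assumes "c * p = q" "c \<noteq> 0" "pvars c \<subseteq> V" "pvars q \<subseteq> V"
  shows "pvars p \<subseteq> V"
proof -
  let ?\<sigma> = "\<lambda>e. if e \<in> V then xvar e else 0"
  have c: "poly_subst ?\<sigma> c = c" by (rule poly_subst_id_on) (use assms(3) in auto)
  have q: "poly_subst ?\<sigma> q = q" by (rule poly_subst_id_on) (use assms(4) in auto)
  have "c * poly_subst ?\<sigma> p = c * p"
    using poly_subst_mult[of ?\<sigma> c p] unfolding assms(1) c q by (rule sym)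
  then have "poly_subst ?\<sigma> p = p" using assms(2) by simp
  moreover have "pvars (?\<sigma> e) \<subseteq> V" for e by (simp add: pvars_xvar)
  ultimately show ?thesis using pvars_poly_subst[of ?\<sigma> V p] by simp
qed

lemma homogeneous_poly_zero [simp]: "homogeneous_poly n 0"
  by (simp add: homogeneous_poly_def)

lemma homogeneous_poly_const [simp]: "homogeneous_poly 0 (Poly_Mapping.single 0 c)"
  by (simp add: homogeneous_poly_def)

lemma homogeneous_poly_one [simp]: "homogeneous_poly 0 1"
  by (simp add: homogeneous_poly_def)

lemma homogeneous_poly_xvar: "homogeneous_poly 1 (xvar e)"
  by (simp add: homogeneous_poly_def xvar_def)

lemma homogeneous_poly_add: "homogeneous_poly n p \<Longrightarrow> homogeneous_poly n q \<Longrightarrow> homogeneous_poly n (p + q)"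
  using keys_add[of p q] unfolding homogeneous_poly_def by blast

lemma homogeneous_poly_uminus: "homogeneous_poly n p \<Longrightarrow> homogeneous_poly n (- p)"
  unfolding homogeneous_poly_def by (simp add: in_keys_iff)

lemma homogeneous_poly_sum:
  "(\<And>i. i \<in> A \<Longrightarrow> homogeneous_poly n (f i)) \<Longrightarrow> homogeneous_poly n (\<Sum>i\<in>A. f i)"
  by (induction A rule: infinite_finite_induct) (simp_all add: homogeneous_poly_add)

lemma homogeneous_poly_mult:
  assumes "homogeneous_poly m p" "homogeneous_poly n q"
  shows "homogeneous_poly (m + n) (p * q)"
  unfolding homogeneous_poly_def
proof
  fix k assume "k \<in> Poly_Mapping.keys (p * q)"
  then obtain a b where ab: "k = a + b" "a \<in> Poly_Mapping.keys p" "b \<in> Poly_Mapping.keys q"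
    using keys_mult[of p q] by blast
  let ?F = "Poly_Mapping.keys a \<union> Poly_Mapping.keys b"
  have *: "(\<Sum>e\<in>Poly_Mapping.keys c. Poly_Mapping.lookup c e) = (\<Sum>e\<in>?F. Poly_Mapping.lookup c e)"
    if "Poly_Mapping.keys c \<subseteq> ?F" for c
    by (rule sum.mono_neutral_left) (use that in \<open>auto simp: in_keys_iff\<close>)
  have "(\<Sum>e\<in>Poly_Mapping.keys k. Poly_Mapping.lookup k e) = (\<Sum>e\<in>?F. Poly_Mapping.lookup (a + b) e)"
    unfolding ab(1) by (rule *[OF keys_add])
  also have "\<dots> = (\<Sum>e\<in>?F. Poly_Mapping.lookup a e) + (\<Sum>e\<in>?F. Poly_Mapping.lookup b e)"
    by (simp add: lookup_add sum.distrib)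
  also have "\<dots> = m + n"
    using assms ab(2,3) *[of a] *[of b] by (simp add: homogeneous_poly_def)
  finally show "(\<Sum>e\<in>Poly_Mapping.keys k. Poly_Mapping.lookup k e) = m + n" .
qed

lemma homogeneous_poly_power: "homogeneous_poly m p \<Longrightarrow> homogeneous_poly (n * m) (p ^ n)"
  by (induction n) (simp_all add: homogeneous_poly_mult)

lemma homogeneous_poly_prod:
  assumes "\<And>i. i \<in> A \<Longrightarrow> homogeneous_poly m (f i)"
  shows "homogeneous_poly (card A * m) (\<Prod>i\<in>A. f i)"
  using assms by (induction A rule: infinite_finite_induct) (simp_all add: homogeneous_poly_mult)

lemma homogeneous_poly_det:
  assumes "A \<in> carrier_mat n n" "\<And>i j. i < n \<Longrightarrow> j < n \<Longrightarrow> homogeneous_poly m (A $$ (i, j))"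
  shows "homogeneous_poly (n * m) (det A)"
  unfolding det_def'[OF assms(1)]
proof (rule homogeneous_poly_sum)
  fix p assume "p \<in> {p. p permutes {0..<n}}"
  then have "homogeneous_poly (card {0..<n} * m) (\<Prod>i = 0..<n. A $$ (i, p i))"
    by (intro homogeneous_poly_prod assms(2)) (auto dest: permutes_in_image)
  then show "homogeneous_poly (n * m) (signof p * (\<Prod>i = 0..<n. A $$ (i, p i)))"
    by (cases p rule: sign_cases) (simp_all add: homogeneous_poly_uminus)
qed

lemma pvars_of_int [simp]: "pvars (of_int c :: 'e qpoly) = {}"
  unfolding of_int_eq_single by (rule pvars_const)

lemma pvars_det:
  fixes A :: "'e qpoly mat"
  assumes "A \<in> carrier_mat n n" "\<And>i j. i < n \<Longrightarrow> j < n \<Longrightarrow> pvars (A $$ (i, j)) \<subseteq> V"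
  shows "pvars (det A) \<subseteq> V"
  unfolding det_def'[OF assms(1)]
proof (rule pvars_sum)
  fix p assume p: "p \<in> {p. p permutes {0..<n}}"
  show "pvars (signof p * (\<Prod>i = 0..<n. A $$ (i, p i))) \<subseteq> V"
    using p by (intro order_trans[OF pvars_mult] Un_least pvars_prod assms(2)) (auto dest: permutes_in_image simp del: of_int_minus)
qed

subsection \<open>The differential of a linear form\<close>

lemma partial_deriv_superset:
  assumes "finite M" "Poly_Mapping.keys p \<subseteq> M"
  shows "partial_deriv e p = (\<Sum>m\<in>M. Poly_Mapping.single (m - Poly_Mapping.single e 1)
     (of_nat (Poly_Mapping.lookup m e) * Poly_Mapping.lookup p m))"
  unfolding partial_deriv_def
  by (rule sum.mono_neutral_left) (use assms in \<open>auto simp: in_keys_iff\<close>)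

lemma partial_deriv_add: "partial_deriv e (p + q) = partial_deriv e p + partial_deriv e q"
proof -
  let ?M = "Poly_Mapping.keys p \<union> Poly_Mapping.keys q"
  have "Poly_Mapping.keys (p + q) \<subseteq> ?M" by (rule keys_add)
  then show ?thesis
    by (simp add: partial_deriv_superset[of ?M] lookup_add distrib_left single_add sum.distrib)
qed

lemma partial_deriv_not_in_pvars: "e \<notin> pvars p \<Longrightarrow> partial_deriv e p = 0"
  unfolding partial_deriv_def pvars_def by (intro sum.neutral) (auto simp: in_keys_iff)

lemma finite_pvars [simp]: "finite (pvars p)"
  by (simp add: pvars_def)

lemma dpoly_superset:
  assumes "finite F" "pvars p \<subseteq> F"
  shows "dpoly p = (\<Sum>e\<in>F. ext_const (partial_deriv e p) * dx e)"
  unfolding dpoly_def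
  by (rule sum.mono_neutral_left) (use assms in \<open>auto simp: partial_deriv_not_in_pvars\<close>)

lemma dpoly_zero [simp]: "dpoly 0 = 0"
  by (simp add: dpoly_def)

lemma dpoly_add: "dpoly (p + q) = dpoly p + dpoly q"
proof -
  let ?F = "pvars p \<union> pvars q"
  have "dpoly (p + q) = (\<Sum>e\<in>?F. ext_const (partial_deriv e (p + q)) * dx e)"
    by (rule dpoly_superset) (use pvars_add[of p q] in auto)
  then show ?thesis
    by (simp add: dpoly_superset[of ?F] partial_deriv_add ext_const_add distrib_right sum.distrib)
qed

lemma dpoly_sum: "dpoly (\<Sum>i\<in>A. f i) = (\<Sum>i\<in>A. dpoly (f i))"
  by (induction A rule: infinite_finite_induct) (simp_all add: dpoly_add)

lemma dpoly_single: "dpoly (Poly_Mapping.single (Poly_Mapping.single e 1) c) =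
    ext_const (Poly_Mapping.single 0 c) * dx e"
proof -
  let ?p = "Poly_Mapping.single (Poly_Mapping.single e 1) c :: 'a qpoly"
  have "dpoly ?p = (\<Sum>a\<in>{e}. ext_const (partial_deriv a ?p) * dx a)"
    by (rule dpoly_superset) (auto simp: pvars_def split: if_splits)
  also have "\<dots> = ext_const (partial_deriv e ?p) * dx e" by simp
  also have "partial_deriv e ?p = Poly_Mapping.single 0 c"
    by (subst partial_deriv_superset[of "{Poly_Mapping.single e 1}"]) (auto simp: lookup_single)
  finally show ?thesis .
qed

lemma dpoly_linear:
  "dpoly (\<Sum>e\<in>E. of_int (c e) * xvar e) = (\<Sum>e\<in>E. ext_const (of_int (c e)) * dx e)"
proof -
  have "(of_int k :: 'a qpoly) * xvar e = Poly_Mapping.single (Poly_Mapping.single e 1) (of_int k)" for k e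
    unfolding of_int_eq_single xvar_def by (simp only: mult_single add_0 mult_1_right)
  then show ?thesis by (simp only: dpoly_sum dpoly_single of_int_eq_single)
qed

lemma ext_homogeneous_dpoly: "ext_homogeneous 1 (dpoly p)"
  unfolding dpoly_def
proof (rule ext_homogeneous_sum)
  fix e
  show "ext_homogeneous 1 (ext_const (partial_deriv e p) * dx e)"
    using ext_homogeneous_mult[OF ext_homogeneous_const ext_homogeneous_dx] by simp
qed

section \<open>Canonical forms\<close>

interpretation to_fract: inj_comm_ring_hom "to_fract :: 'a::idom \<Rightarrow> 'a fract"
  by unfold_locales auto

interpretation rat_form: Ring_Hom.ring_hom "rat_of_poly_form :: ('e::linorder) poly_form \<Rightarrow> 'e rat_form"
  unfolding rat_of_poly_form_def by (rule to_fract.ext_map_ring_hom)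

lemma ext_coeff_rat_form [simp]: "ext_coeff (rat_of_poly_form f) I = to_fract (ext_coeff f I)"
  by (simp add: rat_of_poly_form_def ext_coeff_map)

lemma rat_form_const [simp]: "rat_of_poly_form (ext_const c) = ext_const (to_fract c)"
  unfolding rat_of_poly_form_def by (rule to_fract.ext_map_const)

lemma rat_form_dx [simp]: "rat_of_poly_form (dx e) = dx e"
  unfolding rat_of_poly_form_def by (rule to_fract.ext_map_dx)

text \<open>This is the logarithmic derivative of \<Lambda> multiplied by
  \<open>det \<Lambda>\<close>; with the denominator cleared, powers and traces can be computed with
  polynomial coefficients.\<close>

definition adj_form :: "('e::linorder) qpoly mat \<Rightarrow> 'e poly_form mat" where
  "adj_form \<Lambda> = map_mat ext_const (adj_mat \<Lambda>) * map_mat dpoly \<Lambda>"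

lemma adj_form_carrier [simp]: "\<Lambda> \<in> carrier_mat h h \<Longrightarrow> adj_form \<Lambda> \<in> carrier_mat h h"
  by (simp add: adj_form_def adj_mat(1))

lemma adj_form_entry:
  assumes "\<Lambda> \<in> carrier_mat h h" "i < h" "j < h"
  shows "adj_form \<Lambda> $$ (i, j) = (\<Sum>l<h. ext_const (adj_mat \<Lambda> $$ (i, l)) * dpoly (\<Lambda> $$ (l, j)))"
  using assms carrier_matD[OF adj_mat(1)[OF assms(1)]]
  by (simp add: adj_form_def mult_mat_entry[of _ h h _ h] adj_mat(1) cong: sum.cong_simp)

text \<open>Replaces the result of Gauss-Jordan elimination by any explicit left inverse: the scaled
  adjugate, or the transformed inverse after a change of basis.\<close>

lemma canonical_form_left_inverse:
  fixes \<Lambda> :: "('e::linorder) qpoly mat"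
  assumes \<Lambda>: "\<Lambda> \<in> carrier_mat h h" and B: "B \<in> carrier_mat h h" and inv: "B * map_mat to_fract \<Lambda> = 1\<^sub>m h"
  shows "canonical_form n \<Lambda> =
    (\<Sum>i<h. ((map_mat ext_const B * map_mat (\<lambda>p. rat_of_poly_form (dpoly p)) \<Lambda>) ^\<^sub>m n) $$ (i, i))"
proof -
  let ?L = "map_mat to_fract \<Lambda>"
  have L: "?L \<in> carrier_mat h h" using \<Lambda> by simp
  have "det B * det ?L = 1" using det_mult[OF B L] inv by simp
  then have "det ?L \<noteq> 0" by auto
  then have "?L \<in> Units (ring_mat TYPE('e qratfun) h ())" by (rule det_non_zero_imp_unit[OF L])
  then obtain B' where B': "mat_inverse ?L = Some B'"
    using mat_inverse(1)[OF L, of "()"] by (cases "mat_inverse ?L") auto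
  have "?L * B' = 1\<^sub>m h" "B' \<in> carrier_mat h h" using mat_inverse(2)[OF L B'] by auto
  then have "B = B * (?L * B')" using B by simp
  also have "\<dots> = B * ?L * B'"
    by (rule assoc_mult_mat[symmetric, of _ h h _ h _ h]) (use B L \<open>B' \<in> _\<close> in auto)
  finally have "B' = B" using inv \<open>B' \<in> _\<close> by simp
  moreover have "dim_row ((map_mat ext_const B * map_mat (\<lambda>p. rat_of_poly_form (dpoly p)) \<Lambda>) ^\<^sub>m n) = h"
    using B by simp
  ultimately show ?thesis by (simp add: canonical_form_def B')
qed

context
  fixes \<Lambda> :: "('e::linorder) qpoly mat" and h :: nat
  assumes \<Lambda>: "\<Lambda> \<in> carrier_mat h h" and det: "det \<Lambda> \<noteq> 0"
begin

definition "inv_mat = (1 / to_fract (det \<Lambda>)) \<cdot>\<^sub>m map_mat to_fract (adj_mat \<Lambda>)"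

lemma inv_mat_carrier: "inv_mat \<in> carrier_mat h h"
  using adj_mat(1)[OF \<Lambda>] by (simp add: inv_mat_def)

lemma inv_mat_left: "inv_mat * map_mat to_fract \<Lambda> = 1\<^sub>m h"
proof -
  have "inv_mat * map_mat to_fract \<Lambda> = (1 / to_fract (det \<Lambda>)) \<cdot>\<^sub>m map_mat to_fract (adj_mat \<Lambda> * \<Lambda>)"
    unfolding inv_mat_def to_fract.mat_hom_mult[OF adj_mat(1)[OF \<Lambda>] \<Lambda>]
    by (rule mult_smult_assoc_mat[of _ h h _ h]) (use \<Lambda> adj_mat(1)[OF \<Lambda>] in auto)
  also have "\<dots> = 1\<^sub>m h"
    unfolding adj_mat(3)[OF \<Lambda>] by (rule eq_matI) (use det in auto)
  finally show ?thesis .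
qed

lemma inv_form_pow:
  assumes "i < h" "j < h"
  shows "((map_mat ext_const inv_mat * map_mat (\<lambda>p. rat_of_poly_form (dpoly p)) \<Lambda>) ^\<^sub>m n) $$ (i, j) =
    ext_const ((1 / to_fract (det \<Lambda>)) ^ n) * rat_of_poly_form ((adj_form \<Lambda> ^\<^sub>m n) $$ (i, j))"
proof -
  note A = adj_mat(1)[OF \<Lambda>]
  have "((map_mat ext_const inv_mat * map_mat (\<lambda>p. rat_of_poly_form (dpoly p)) \<Lambda>) ^\<^sub>m n) $$ (i, j) =
      ext_const ((1 / to_fract (det \<Lambda>)) ^ n) * ((map_mat rat_of_poly_form (adj_form \<Lambda>)) ^\<^sub>m n) $$ (i, j)"
  proof (rule pow_mat_const_mult[OF _ _ _ assms])
    fix i j assume "i < h" "j < h"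
    then show "(map_mat ext_const inv_mat * map_mat (\<lambda>p. rat_of_poly_form (dpoly p)) \<Lambda>) $$ (i, j) =
        ext_const (1 / to_fract (det \<Lambda>)) * map_mat rat_of_poly_form (adj_form \<Lambda>) $$ (i, j)"
      using \<Lambda> A carrier_matD[OF A] inv_mat_carrier carrier_matD[OF adj_form_carrier[OF \<Lambda>]]
      by (simp add: mult_mat_entry[of _ h h _ h] adj_form_entry[OF \<Lambda>] inv_mat_def rat_form.hom_sum
          rat_form.hom_mult sum_distrib_left cong: sum.cong_simp flip: ext_const_mult mult.assoc)
  qed (use \<Lambda> inv_mat_carrier in auto)
  also have "(map_mat rat_of_poly_form (adj_form \<Lambda>)) ^\<^sub>m n = map_mat rat_of_poly_form (adj_form \<Lambda> ^\<^sub>m n)"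
    by (rule rat_form.mat_hom_pow[symmetric, of _ h]) (use \<Lambda> in simp)
  finally show ?thesis
    using assms carrier_matD[OF pow_mat_carrier[OF adj_form_carrier[OF \<Lambda>], of n]] by simp
qed

lemma canonical_form_eq:
  "canonical_form n \<Lambda> = ext_const ((1 / to_fract (det \<Lambda>)) ^ n) *
    rat_of_poly_form (\<Sum>i<h. (adj_form \<Lambda> ^\<^sub>m n) $$ (i, i))"
  unfolding canonical_form_left_inverse[OF \<Lambda> inv_mat_carrier inv_mat_left]
  by (simp add: inv_form_pow rat_form.hom_sum sum_distrib_left)

end

subsection \<open>The pole\<close>

lemma ext_dvd_quotient:
  assumes "ext_dvd a f"
  obtains g where "f = ext_const a * g"
proof -
  define q where "q c = (SOME q. c = a * q)" for c
  have "ext_coeff f I = a * ext_coeff (ext_map q f) I" for I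
  proof -
    have "ext_coeff (ext_map q f) I = (if ext_coeff f I = 0 then 0 else q (ext_coeff f I))"
      by transfer simp
    moreover have "ext_coeff f I = a * q (ext_coeff f I)"
      unfolding q_def by (rule someI_ex) (use assms in \<open>auto simp: ext_dvd_def dvd_def\<close>)
    ultimately show ?thesis by simp
  qed
  then have "f = ext_const a * ext_map q f" by (intro exterior_eqI) simp
  then show ?thesis by (rule that)
qed

lemma pvars_shuffle_sign [simp]: "pvars (shuffle_sign A B :: 'e qpoly) = {}"
proof -
  have "(shuffle_sign A B :: 'e qpoly) = of_int (shuffle_sign A B)" by (simp add: shuffle_sign_def)
  then show ?thesis by (simp only: pvars_of_int)
qed

lemma homogeneous_poly_shuffle_sign [simp]: "homogeneous_poly 0 (shuffle_sign A B :: 'e qpoly)"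
proof -
  have "(shuffle_sign A B :: 'e qpoly) = of_int (shuffle_sign A B)" by (simp add: shuffle_sign_def)
  then show ?thesis by (simp only: of_int_eq_single homogeneous_poly_const)
qed

section \<open>Variables and degrees of polynomial forms\<close>

lemma poly_form_in_pvars: "poly_form_in E f \<Longrightarrow> pvars (ext_coeff f I) \<subseteq> E"
  unfolding poly_form_in_def by (cases "ext_coeff f I = 0") auto

lemma poly_form_in_add:
  assumes "poly_form_in E f" "poly_form_in E g"
  shows "poly_form_in E (f + g)"
  unfolding poly_form_in_def
proof (intro allI impI conjI)
  fix I assume "ext_coeff (f + g) I \<noteq> 0"
  then have "ext_coeff f I \<noteq> 0 \<or> ext_coeff g I \<noteq> 0" by auto
  then show "I \<subseteq> E" using assms unfolding poly_form_in_def by blast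
  show "pvars (ext_coeff (f + g) I) \<subseteq> E"
    using pvars_add[of "ext_coeff f I" "ext_coeff g I"] poly_form_in_pvars[OF assms(1), of I]
      poly_form_in_pvars[OF assms(2), of I] by auto
qed

lemma poly_form_in_zero: "poly_form_in E 0"
  by (simp add: poly_form_in_def)

lemma poly_form_in_sum: "(\<And>i. i \<in> A \<Longrightarrow> poly_form_in E (f i)) \<Longrightarrow> poly_form_in E (\<Sum>i\<in>A. f i)"
  by (induction A rule: infinite_finite_induct) (simp_all add: poly_form_in_zero poly_form_in_add)

lemma poly_form_in_mult:
  assumes f: "poly_form_in E f" and g: "poly_form_in E g"
  shows "poly_form_in E (f * g)"
  unfolding poly_form_in_def
proof (intro allI impI conjI)
  fix I assume "ext_coeff (f * g) I \<noteq> 0"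
  then obtain A where "A \<in> Pow I" "shuffle_sign A (I - A) * ext_coeff f A * ext_coeff g (I - A) \<noteq> 0"
    unfolding ext_coeff_mult by (meson sum.not_neutral_contains_not_neutral)
  then have "ext_coeff f A \<noteq> 0" "ext_coeff g (I - A) \<noteq> 0" by auto
  then have "A \<subseteq> E" "I - A \<subseteq> E" using f g unfolding poly_form_in_def by blast+
  then show "I \<subseteq> E" by blast
  show "pvars (ext_coeff (f * g) I) \<subseteq> E"
    unfolding ext_coeff_mult
  proof (rule pvars_sum)
    fix A
    have "pvars (shuffle_sign A (I - A) * ext_coeff f A) \<subseteq> E"
      using pvars_mult[of "shuffle_sign A (I - A)" "ext_coeff f A"] poly_form_in_pvars[OF f, of A] by simp
    then show "pvars (shuffle_sign A (I - A) * ext_coeff f A * ext_coeff g (I - A)) \<subseteq> E"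
      using pvars_mult[of "shuffle_sign A (I - A) * ext_coeff f A" "ext_coeff g (I - A)"]
        poly_form_in_pvars[OF g, of "I - A"] by auto
  qed
qed

lemma poly_form_in_const: "pvars c \<subseteq> E \<Longrightarrow> poly_form_in E (ext_const c)"
  by (simp add: poly_form_in_def ext_coeff_const)

lemma poly_form_in_dx: "e \<in> E \<Longrightarrow> poly_form_in E (dx e)"
  by (simp add: poly_form_in_def ext_coeff_dx)

definition homogeneous_coeffs :: "nat \<Rightarrow> ('e::linorder) poly_form \<Rightarrow> bool" where
  "homogeneous_coeffs r f \<longleftrightarrow> (\<forall>I. homogeneous_poly r (ext_coeff f I))"

lemma homogeneous_coeffs_sum:
  "(\<And>i. i \<in> A \<Longrightarrow> homogeneous_coeffs r (f i)) \<Longrightarrow> homogeneous_coeffs r (\<Sum>i\<in>A. f i)"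
  by (simp add: homogeneous_coeffs_def homogeneous_poly_sum)

lemma homogeneous_coeffs_mult:
  assumes "homogeneous_coeffs r f" "homogeneous_coeffs s g"
  shows "homogeneous_coeffs (r + s) (f * g)"
  unfolding homogeneous_coeffs_def ext_coeff_mult
proof (intro allI homogeneous_poly_sum)
  fix I A
  have "homogeneous_poly (0 + r + s) (shuffle_sign A (I - A) * ext_coeff f A * ext_coeff g (I - A))"
    using assms unfolding homogeneous_coeffs_def
    by (intro homogeneous_poly_mult homogeneous_poly_shuffle_sign) auto
  then show "homogeneous_poly (r + s) (shuffle_sign A (I - A) * ext_coeff f A * ext_coeff g (I - A))" by simp
qed

lemma homogeneous_coeffs_const: "homogeneous_poly r c \<Longrightarrow> homogeneous_coeffs r (ext_const c)"
  by (simp add: homogeneous_coeffs_def ext_coeff_const)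

lemma homogeneous_coeffs_dx: "homogeneous_coeffs 0 (dx e)"
  by (simp add: homogeneous_coeffs_def ext_coeff_dx)

lemma xvar_nonzero [simp]: "xvar e \<noteq> 0"
  using pvars_xvar[of e] by auto

text \<open>\<open>homogeneous_form\<close> asks for a representation of the zero coefficients too,
  in degree minus the size of the index set; 0 divided by a power of a variable provides it.\<close>

lemma homogeneous_ratfun_zero: "homogeneous_ratfun (- int n) (0 :: ('e::linorder) qratfun)"
proof -
  obtain e :: 'e where True by blast
  have "homogeneous_poly n (xvar e ^ n)"
    using homogeneous_poly_power[OF homogeneous_poly_xvar, of n e] by simp
  moreover have "xvar e ^ n \<noteq> 0" by simp
  moreover have "(0 :: 'e qratfun) = Fract 0 (xvar e ^ n)" by (simp add: Fract_conv_to_fract)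
  moreover have "int 0 - int n = - int n" by simp
  ultimately show ?thesis
    unfolding homogeneous_ratfun_def using homogeneous_poly_zero by blast
qed

lemma pvars_of_int_mult: "pvars (of_int z * p) \<subseteq> pvars p"
  using pvars_mult[of "of_int z" p] by simp

lemma homogeneous_poly_of_int_mult: "homogeneous_poly n p \<Longrightarrow> homogeneous_poly n (of_int z * p)"
  using homogeneous_poly_mult[OF homogeneous_poly_const[of "of_int z"], of n p] by simp

text \<open>Isolates what contraction, homogeneity and pullback use of a graph Laplacian: its
  entries are integral linear forms, so their differentials have constant coefficients.\<close>

locale linear_form_mat =
  fixes E :: "('e::linorder) set" and h :: nat and c :: "nat \<Rightarrow> nat \<Rightarrow> 'e \<Rightarrow> int" and \<Lambda> :: "'e qpoly mat"
  assumes fin: "finite E" and \<Lambda>: "\<Lambda> \<in> carrier_mat h h" and det: "det \<Lambda> \<noteq> 0"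
    and entry: "\<And>i j. i < h \<Longrightarrow> j < h \<Longrightarrow> \<Lambda> $$ (i, j) = (\<Sum>e\<in>E. of_int (c i j e) * xvar e)"
begin

abbreviation "tr_pow n \<equiv> (\<Sum>i<h. (adj_form \<Lambda> ^\<^sub>m n) $$ (i, i))"

lemmas adj_carrier = adj_mat(1)[OF \<Lambda>]
lemmas \<Lambda>_form = adj_form_carrier[OF \<Lambda>]

lemma dpoly_entry: "i < h \<Longrightarrow> j < h \<Longrightarrow> dpoly (\<Lambda> $$ (i, j)) = (\<Sum>e\<in>E. ext_const (of_int (c i j e)) * dx e)"
  by (simp only: entry dpoly_linear)

lemma pvars_entry: "i < h \<Longrightarrow> j < h \<Longrightarrow> pvars (\<Lambda> $$ (i, j)) \<subseteq> E"
  unfolding entry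
proof (rule pvars_sum)
  fix e assume "e \<in> E"
  then show "pvars (of_int (c i j e) * xvar e) \<subseteq> E"
    using pvars_of_int_mult[of "c i j e" "xvar e"] by (auto simp: pvars_xvar)
qed

lemma homogeneous_entry: "i < h \<Longrightarrow> j < h \<Longrightarrow> homogeneous_poly 1 (\<Lambda> $$ (i, j))"
  unfolding entry
by (intro homogeneous_poly_sum homogeneous_poly_of_int_mult homogeneous_poly_xvar)

lemma mat_delete_entry:
  assumes "i < h" "j < h" "a < h - 1" "b < h - 1"
  obtains a' b' where "a' < h" "b' < h" "mat_delete \<Lambda> i j $$ (a, b) = \<Lambda> $$ (a', b')"
  by (rule that[of "if a < i then a else Suc a" "if b < j then b else Suc b"])
     (use assms \<Lambda> in \<open>auto simp: mat_delete_def\<close>)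

lemma adj_entry:
  assumes "i < h" "j < h"
  shows "pvars (adj_mat \<Lambda> $$ (i, j)) \<subseteq> E" "homogeneous_poly (h - 1) (adj_mat \<Lambda> $$ (i, j))"
proof -
  let ?D = "mat_delete \<Lambda> j i"
  have D: "?D \<in> carrier_mat (h - 1) (h - 1)" using \<Lambda> by (rule mat_delete_carrier)
  have eq: "adj_mat \<Lambda> $$ (i, j) = of_int ((-1) ^ (j + i)) * det ?D"
    using assms carrier_matD[OF \<Lambda>] by (simp add: adj_mat_def cofactor_def)
  have "pvars (det ?D) \<subseteq> E"
  proof (rule pvars_det[OF D])
    fix a b assume "a < h - 1" "b < h - 1"
    then obtain a' b' where "a' < h" "b' < h" "?D $$ (a, b) = \<Lambda> $$ (a', b')"
      by (rule mat_delete_entry[OF assms(2,1)])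
    then show "pvars (?D $$ (a, b)) \<subseteq> E" using pvars_entry by simp
  qed
  then show "pvars (adj_mat \<Lambda> $$ (i, j)) \<subseteq> E"
    unfolding eq by (rule order_trans[OF pvars_of_int_mult])
  have "homogeneous_poly ((h - 1) * 1) (det ?D)"
  proof (rule homogeneous_poly_det[OF D])
    fix a b assume "a < h - 1" "b < h - 1"
    then obtain a' b' where "a' < h" "b' < h" "?D $$ (a, b) = \<Lambda> $$ (a', b')"
      by (rule mat_delete_entry[OF assms(2,1)])
    then show "homogeneous_poly 1 (?D $$ (a, b))" using homogeneous_entry by simp
  qed
  then show "homogeneous_poly (h - 1) (adj_mat \<Lambda> $$ (i, j))"
    unfolding eq by (intro homogeneous_poly_of_int_mult) simp
qed

text \<open>Each factor contributes an adjugate entry of degree h - 1 and the differential of a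
  linear form, which adds 1 to the exterior degree and nothing to the degree of the
  coefficients.\<close>

lemma adj_form_in:
  assumes "i < h" "j < h"
  shows "poly_form_in E ((adj_form \<Lambda> ^\<^sub>m n) $$ (i, j))"
    and "homogeneous_coeffs (n * (h - 1)) ((adj_form \<Lambda> ^\<^sub>m n) $$ (i, j))"
    and "ext_homogeneous n ((adj_form \<Lambda> ^\<^sub>m n) $$ (i, j))"
proof -
  have 1: "poly_form_in E (adj_form \<Lambda> $$ (i, j)) \<and> homogeneous_coeffs (h - 1) (adj_form \<Lambda> $$ (i, j)) \<and>
      ext_homogeneous 1 (adj_form \<Lambda> $$ (i, j))" if ij: "i < h" "j < h" for i j
  proof (intro conjI)
    show "poly_form_in E (adj_form \<Lambda> $$ (i, j))"
      unfolding adj_form_entry[OF \<Lambda> ij]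
    proof (intro poly_form_in_sum poly_form_in_mult)
      fix l assume l: "l \<in> {..<h}"
      then show "poly_form_in E (ext_const (adj_mat \<Lambda> $$ (i, l)))"
        using adj_entry(1) ij by (intro poly_form_in_const) simp
      have "poly_form_in E (\<Sum>e\<in>E. ext_const (of_int (c l j e)) * dx e)"
        by (intro poly_form_in_sum poly_form_in_mult poly_form_in_const poly_form_in_dx) simp
      then show "poly_form_in E (dpoly (\<Lambda> $$ (l, j)))" using l ij by (simp add: dpoly_entry)
    qed
    have "homogeneous_coeffs (h - 1 + (0 + 0)) (adj_form \<Lambda> $$ (i, j))"
      unfolding adj_form_entry[OF \<Lambda> ij]
    proof (intro homogeneous_coeffs_sum homogeneous_coeffs_mult)
      fix l assume l: "l \<in> {..<h}"
      then show "homogeneous_coeffs (h - 1) (ext_const (adj_mat \<Lambda> $$ (i, l)))"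
        using adj_entry(2) ij by (intro homogeneous_coeffs_const) simp
      show "homogeneous_coeffs (0 + 0) (dpoly (\<Lambda> $$ (l, j)))"
        using l ij by (simp only: lessThan_iff dpoly_entry of_int_eq_single)
          (intro homogeneous_coeffs_sum homogeneous_coeffs_mult homogeneous_coeffs_const homogeneous_coeffs_dx
            homogeneous_poly_const)
    qed
    then show "homogeneous_coeffs (h - 1) (adj_form \<Lambda> $$ (i, j))" by simp
    have "ext_homogeneous (0 + 1) (adj_form \<Lambda> $$ (i, j))"
      unfolding adj_form_entry[OF \<Lambda> ij]
      by (intro ext_homogeneous_sum ext_homogeneous_mult ext_homogeneous_const ext_homogeneous_dpoly)
    then show "ext_homogeneous 1 (adj_form \<Lambda> $$ (i, j))" by simp
  qed
  have "poly_form_in E ((adj_form \<Lambda> ^\<^sub>m n) $$ (i, j)) \<and>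
      homogeneous_coeffs (n * (h - 1)) ((adj_form \<Lambda> ^\<^sub>m n) $$ (i, j)) \<and>
      ext_homogeneous n ((adj_form \<Lambda> ^\<^sub>m n) $$ (i, j))"
    using assms
  proof (induction n arbitrary: i j)
    case 0
    have "poly_form_in E 1" "poly_form_in E 0" "homogeneous_coeffs 0 (1 :: 'e poly_form)" "homogeneous_coeffs 0 (0 :: 'e poly_form)"
      by (simp_all add: poly_form_in_def homogeneous_coeffs_def ext_coeff_one)
    then show ?case using 0 \<Lambda>_form by simp
  next
    case (Suc n)
    have "(adj_form \<Lambda> ^\<^sub>m Suc n) $$ (i, j) = (\<Sum>k<h. (adj_form \<Lambda> ^\<^sub>m n) $$ (i, k) * adj_form \<Lambda> $$ (k, j))"
      using Suc.prems \<Lambda>_form by (simp add: mult_mat_entry[of _ h h _ h])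
    moreover have "poly_form_in E (\<Sum>k<h. (adj_form \<Lambda> ^\<^sub>m n) $$ (i, k) * adj_form \<Lambda> $$ (k, j))"
      using Suc 1 by (intro poly_form_in_sum poly_form_in_mult) auto
    moreover have "homogeneous_coeffs (n * (h - 1) + (h - 1)) (\<Sum>k<h. (adj_form \<Lambda> ^\<^sub>m n) $$ (i, k) * adj_form \<Lambda> $$ (k, j))"
      using Suc 1 by (intro homogeneous_coeffs_sum homogeneous_coeffs_mult) auto
    moreover have "ext_homogeneous (n + 1) (\<Sum>k<h. (adj_form \<Lambda> ^\<^sub>m n) $$ (i, k) * adj_form \<Lambda> $$ (k, j))"
      using Suc 1 by (intro ext_homogeneous_sum ext_homogeneous_mult) auto
    ultimately show ?case by (simp add: add.commute)
  qed
  then show "poly_form_in E ((adj_form \<Lambda> ^\<^sub>m n) $$ (i, j))"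
    "homogeneous_coeffs (n * (h - 1)) ((adj_form \<Lambda> ^\<^sub>m n) $$ (i, j))"
    "ext_homogeneous n ((adj_form \<Lambda> ^\<^sub>m n) $$ (i, j))" by blast+
qed

lemma pvars_det_\<Lambda>: "pvars (det \<Lambda>) \<subseteq> E"
  by (rule pvars_det[OF \<Lambda> pvars_entry])

lemma canonical_form_coeff:
  "ext_coeff (canonical_form n \<Lambda>) I = Fract (ext_coeff (tr_pow n) I) (det \<Lambda> ^ n)"
  unfolding canonical_form_eq[OF \<Lambda> det] using det
  by (simp add: Fract_conv_to_fract to_fract.hom_power power_one_over del: ext_coeff_sum)

lemma homogeneous_canonical_form: "homogeneous_form 0 (canonical_form n \<Lambda>)"
  unfolding homogeneous_form_def
proof
  fix I
  show "homogeneous_ratfun (0 - int (card I)) (ext_coeff (canonical_form n \<Lambda>) I)"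
  proof (cases "ext_coeff (tr_pow n) I = 0")
    case True
    have "Fract 0 (det \<Lambda> ^ n) = 0" by (simp add: Fract_conv_to_fract)
    then show ?thesis
      using homogeneous_ratfun_zero[of "card I"] unfolding canonical_form_coeff True by simp
  next
    case False
    have "ext_homogeneous n (tr_pow n)" using adj_form_in(3) by (intro ext_homogeneous_sum) auto
    then have card: "card I = n" using False by (simp add: ext_homogeneous_def)
    \<comment> \<open>For h = 0 the truncated \<open>h - 1\<close> would spoil the degree count, but
      then the trace is an empty sum.\<close>
    have "h \<noteq> 0"
    proof
      assume "h = 0"
      then have "tr_pow n = 0" by simp
      then show False using False by (simp del: ext_coeff_sum)
    qed
    have "homogeneous_coeffs (n * (h - 1)) (tr_pow n)"
      using adj_form_in(2) by (intro homogeneous_coeffs_sum) auto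
    then have "homogeneous_poly (n * (h - 1)) (ext_coeff (tr_pow n) I)"
      unfolding homogeneous_coeffs_def by blast
    moreover have "homogeneous_poly (n * (h * 1)) (det \<Lambda> ^ n)"
      by (intro homogeneous_poly_power homogeneous_poly_det[OF \<Lambda>] homogeneous_entry)
    moreover have "int (n * (h - 1)) - int (n * (h * 1)) = 0 - int (card I)"
      using \<open>h \<noteq> 0\<close> by (cases h) (simp_all add: card algebra_simps)
    moreover have "det \<Lambda> ^ n \<noteq> 0" using det by simp
    ultimately show ?thesis unfolding homogeneous_ratfun_def canonical_form_coeff by blast
  qed
qed

lemma canonical_form_pole:
  assumes sym: "\<And>i j. i < h \<Longrightarrow> j < h \<Longrightarrow> \<Lambda> $$ (i, j) = \<Lambda> $$ (j, i)"
  obtains N where "poly_form_in E N"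
    and "canonical_form (4 * k + 1) \<Lambda> = ext_const (1 / to_fract (det \<Lambda>) ^ (k + 1)) * rat_of_poly_form N"
proof -
  let ?n = "4 * k + 1"
  have "ext_dvd (det \<Lambda> ^ (3 * k)) (tr_pow ?n)"
  proof (rule ext_dvd_sum)
    fix i assume "i \<in> {..<h}"
    then show "ext_dvd (det \<Lambda> ^ (3 * k)) ((adj_form \<Lambda> ^\<^sub>m ?n) $$ (i, i))"
      unfolding adj_form_def using \<Lambda> sym ext_homogeneous_dpoly
      by (intro adj_mat_pow_dvd[of \<Lambda> h]) auto
  qed
  then obtain N where N: "tr_pow ?n = ext_const (det \<Lambda> ^ (3 * k)) * N" by (rule ext_dvd_quotient)
  let ?d = "to_fract (det \<Lambda>)"
  have d: "?d \<noteq> 0" using det by simp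
  have "(1 / ?d) ^ ?n * to_fract (det \<Lambda> ^ (3 * k)) = 1 / ?d ^ (k + 1)"
  proof -
    have "?d ^ ?n = ?d ^ (k + 1) * ?d ^ (3 * k)" by (simp add: mult.commute flip: power_add)
    then show ?thesis using d by (simp add: to_fract.hom_power power_one_over del: power_Suc)
  qed
  then have "canonical_form ?n \<Lambda> = ext_const (1 / ?d ^ (k + 1)) * rat_of_poly_form N"
    unfolding canonical_form_eq[OF \<Lambda> det] N rat_form.hom_mult rat_form_const mult.assoc[symmetric] ext_const_mult[symmetric]
    by simp
  \<comment> \<open>The quotient was found in the polynomial ring in all variables; its restriction
    to those of \<open>E\<close> is recovered by \<open>pvars_divisor\<close>.\<close>
  moreover have "poly_form_in E N"
    unfolding poly_form_in_def
  proof (intro allI impI)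
    fix I assume nz: "ext_coeff N I \<noteq> 0"
    have eq: "det \<Lambda> ^ (3 * k) * ext_coeff N I = ext_coeff (tr_pow ?n) I" unfolding N by simp
    have tr: "poly_form_in E (tr_pow ?n)" by (intro poly_form_in_sum adj_form_in(1)) auto
    have "ext_coeff (tr_pow ?n) I \<noteq> 0" unfolding eq[symmetric] using nz det by simp
    then have "I \<subseteq> E" using tr unfolding poly_form_in_def by blast
    moreover have "pvars (ext_coeff N I) \<subseteq> E"
    proof (rule pvars_divisor[OF eq])
      show "pvars (det \<Lambda> ^ (3 * k)) \<subseteq> E" by (rule order_trans[OF pvars_power pvars_det_\<Lambda>])
      show "pvars (ext_coeff (tr_pow ?n) I) \<subseteq> E" using tr by (rule poly_form_in_pvars)
    qed (use det in simp)
    ultimately show "I \<subseteq> E \<and> pvars (ext_coeff N I) \<subseteq> E" by blast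
  qed
  ultimately show ?thesis using that by blast
qed

end

subsection \<open>Contraction with the Euler vector field\<close>

context linear_form_mat
begin

text \<open>Moving one factor from the end of the product to its front passes \<open>p\<close>
  one-forms. As \<open>p\<close> is odd, the trace equals its own negative.\<close>

lemma tr_pow_even:
  assumes "odd p"
  shows "tr_pow (Suc p) = 0"
proof (rule eq_minus_self_imp_zero)
  let ?N = "adj_form \<Lambda>"
  have "tr_pow (Suc p) = (\<Sum>i<h. \<Sum>j<h. (?N ^\<^sub>m p) $$ (i, j) * ?N $$ (j, i))"
    using \<Lambda>_form by (simp add: mult_mat_entry[of _ h h _ h])
  also have "\<dots> = (\<Sum>i<h. \<Sum>j<h. ext_const (-1) * (?N $$ (j, i) * (?N ^\<^sub>m p) $$ (i, j)))"
  proof (intro sum.cong refl)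
    fix i j assume "i \<in> {..<h}" "j \<in> {..<h}"
    then have "ext_homogeneous 1 (?N $$ (j, i))" "ext_homogeneous p ((?N ^\<^sub>m p) $$ (i, j))"
      using adj_form_in(3)[of j i 1] adj_form_in(3)[of i j p] \<Lambda>_form by simp_all
    from graded_commute[OF this] show "(?N ^\<^sub>m p) $$ (i, j) * ?N $$ (j, i) =
        ext_const (-1) * (?N $$ (j, i) * (?N ^\<^sub>m p) $$ (i, j))"
      using assms by simp
  qed
  also have "\<dots> = ext_const (-1) * (\<Sum>j<h. \<Sum>i<h. ?N $$ (j, i) * (?N ^\<^sub>m p) $$ (i, j))"
    unfolding sum_distrib_left by (rule sum.swap)
  also have "(\<Sum>j<h. \<Sum>i<h. ?N $$ (j, i) * (?N ^\<^sub>m p) $$ (i, j)) = tr_pow (Suc p)"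
    unfolding pow_mat_Suc_left[OF \<Lambda>_form]
    by (intro sum.cong refl) (simp add: mult_mat_entry[OF \<Lambda>_form pow_mat_carrier[OF \<Lambda>_form]])
  finally show "tr_pow (Suc p) = ext_const (-1) * tr_pow (Suc p)" .
qed

definition "log_form = map_mat ext_const (inv_mat \<Lambda>) * map_mat (\<lambda>p. rat_of_poly_form (dpoly p)) \<Lambda>"

lemma log_form_carrier: "log_form \<in> carrier_mat h h"
  using inv_mat_carrier[OF \<Lambda> det] \<Lambda> by (simp add: log_form_def)

text \<open>Contraction with the Euler field sends the differential of a linear form to the form
  itself, so it turns the differential of \<Lambda> back into \<Lambda>, which the inverse
  cancels.\<close>

lemma contraction_log_form_mult:
  assumes ij: "i < h" "j < h"
  shows "euler_contraction E (log_form $$ (i, j) * f) =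
    ext_const (if i = j then 1 else 0) * f - log_form $$ (i, j) * euler_contraction E f"
proof -
  let ?B = "inv_mat \<Lambda>"
  note B = inv_mat_carrier[OF \<Lambda> det]
  let ?m = "\<lambda>e. \<Sum>k<h. ?B $$ (i, k) * to_fract (of_int (c k j e))"
  have "rat_of_poly_form (dpoly (\<Lambda> $$ (k, j))) = (\<Sum>e\<in>E. ext_const (to_fract (of_int (c k j e))) * dx e)"
    if "k < h" for k
    using that ij by (simp only: dpoly_entry rat_form.hom_sum rat_form.hom_mult rat_form_const rat_form_dx)
  then have "log_form $$ (i, j) = (\<Sum>k<h. \<Sum>e\<in>E. ext_const (?B $$ (i, k) * to_fract (of_int (c k j e))) * dx e)"
    unfolding log_form_def using ij B \<Lambda> carrier_matD[OF B] carrier_matD[OF \<Lambda>]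
    by (simp add: mult_mat_entry[of _ h h _ h] ext_const_mult sum_distrib_left mult.assoc cong: sum.cong_simp)
  also have "\<dots> = (\<Sum>e\<in>E. ext_const (?m e) * dx e)"
    by (subst sum.swap) (simp only: ext_const_sum sum_distrib_right)
  finally have log: "log_form $$ (i, j) = (\<Sum>e\<in>E. ext_const (?m e) * dx e)" .
  have "(\<Sum>e\<in>E. ?m e * to_fract (xvar e)) = (\<Sum>k<h. \<Sum>e\<in>E. ?B $$ (i, k) * to_fract (of_int (c k j e)) * to_fract (xvar e))"
    by (subst sum.swap) (simp only: sum_distrib_right)
  also have "\<dots> = (\<Sum>k<h. ?B $$ (i, k) * to_fract (\<Lambda> $$ (k, j)))"
    using ij by (intro sum.cong refl) (simp only: lessThan_iff entry to_fract.hom_sum to_fract.hom_mult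
        sum_distrib_left mult.assoc)
  also have "\<dots> = (?B * map_mat to_fract \<Lambda>) $$ (i, j)"
    using ij B \<Lambda> carrier_matD[OF \<Lambda>] by (simp add: mult_mat_entry[of _ h h _ h] cong: sum.cong_simp)
  also have "\<dots> = (if i = j then 1 else 0)"
    using ij inv_mat_left[OF \<Lambda> det] by simp
  finally show ?thesis
    unfolding euler_contraction_def log contraction_one_form_mult[OF fin] by simp
qed

text \<open>The antiderivation rule produces \<open>m\<close> copies of the power
  \<open>m - 1\<close> with alternating signs, beginning with plus; one copy survives for odd
  \<open>m\<close> and none for even \<open>m\<close>.\<close>

lemma contraction_log_form_pow:
  assumes "i < h" "l < h"
  shows "euler_contraction E ((log_form ^\<^sub>m m) $$ (i, l)) = (if odd m then (log_form ^\<^sub>m (m - 1)) $$ (i, l) else 0)"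
  using assms
proof (induction m arbitrary: i l)
  case 0
  then show ?case using log_form_carrier by (simp add: euler_contraction_def)
next
  case (Suc m)
  let ?M = log_form
  note M = log_form_carrier
  have "(?M ^\<^sub>m Suc m) $$ (i, l) = (\<Sum>j<h. ?M $$ (i, j) * (?M ^\<^sub>m m) $$ (j, l))"
    unfolding pow_mat_Suc_left[OF M] by (rule mult_mat_entry[OF M pow_mat_carrier[OF M] Suc.prems])
  then have "euler_contraction E ((?M ^\<^sub>m Suc m) $$ (i, l)) =
      (\<Sum>j<h. euler_contraction E (?M $$ (i, j) * (?M ^\<^sub>m m) $$ (j, l)))"
    by (simp only: euler_contraction_def contraction_sum)
  also have "\<dots> = (\<Sum>j<h. (if i = j then (?M ^\<^sub>m m) $$ (j, l) else 0) -
      ?M $$ (i, j) * (if odd m then (?M ^\<^sub>m (m - 1)) $$ (j, l) else 0))"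
    using Suc.prems by (intro sum.cong refl) (simp add: contraction_log_form_mult Suc.IH)
  also have "\<dots> = (?M ^\<^sub>m m) $$ (i, l) - (if odd m then \<Sum>j<h. ?M $$ (i, j) * (?M ^\<^sub>m (m - 1)) $$ (j, l) else 0)"
    using Suc.prems by (simp add: sum_subtractf sum.delta')
  also have "\<dots> = (if odd (Suc m) then (?M ^\<^sub>m m) $$ (i, l) else 0)"
  proof (cases m)
    case (Suc p)
    have "(?M ^\<^sub>m Suc p) $$ (i, l) = (\<Sum>j<h. ?M $$ (i, j) * (?M ^\<^sub>m p) $$ (j, l))"
      unfolding pow_mat_Suc_left[OF M] by (rule mult_mat_entry[OF M pow_mat_carrier[OF M] Suc.prems])
    then show ?thesis unfolding Suc by (simp del: pow_mat.simps)
  qed simp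
  finally show ?case by simp
qed

lemma euler_contraction_canonical_form:
  assumes "k \<ge> 1"
  shows "euler_contraction E (canonical_form (4 * k + 1) \<Lambda>) = 0"
proof -
  have "canonical_form (4 * k + 1) \<Lambda> = (\<Sum>i<h. (log_form ^\<^sub>m (4 * k + 1)) $$ (i, i))"
    unfolding log_form_def
    by (rule canonical_form_left_inverse[OF \<Lambda> inv_mat_carrier[OF \<Lambda> det] inv_mat_left[OF \<Lambda> det]])
  then have "euler_contraction E (canonical_form (4 * k + 1) \<Lambda>) = (\<Sum>i<h. (log_form ^\<^sub>m (4 * k)) $$ (i, i))"
    using contraction_log_form_pow[where m = "4 * k + 1"]
    by (simp add: euler_contraction_def contraction_sum del: pow_mat.simps cong: sum.cong_simp)
  also have "\<dots> = ext_const ((1 / to_fract (det \<Lambda>)) ^ (4 * k)) * rat_of_poly_form (tr_pow (4 * k))"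
    unfolding log_form_def
    by (simp add: inv_form_pow[OF \<Lambda> det] rat_form.hom_sum sum_distrib_left)
  \<comment> \<open>Here k \<ge> 1 enters: for k = 0 the power is the identity matrix, whose trace
    is \<open>h\<close>.\<close>
  also have "tr_pow (4 * k) = 0"
    using tr_pow_even[of "4 * k - 1"] assms by simp
  finally show ?thesis by simp
qed

end

subsection \<open>Change of basis\<close>

lemma dpoly_of_int_mult: "dpoly (of_int z * p) = ext_const (of_int z) * dpoly p"
proof -
  have nat: "dpoly (of_nat n * p) = ext_const (of_nat n) * dpoly p" for n
    by (induction n) (simp_all add: distrib_right dpoly_add ext_const_add)
  have minus: "dpoly (- q) = - dpoly q" for q :: "'a qpoly"
    using dpoly_add[of q "- q"] by (simp add: eq_neg_iff_add_eq_0 add.commute)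
  show ?thesis
    by (cases z rule: int_cases2) (simp_all add: nat minus ext_const_uminus)
qed

text \<open>The conjugating matrices have entries of exterior degree 0, which commute with all
  forms, so cyclicity holds without signs.\<close>

lemma trace_conjugate:
  fixes X :: "('e::linorder, 'k::comm_ring_1) exterior mat"
  assumes X: "X \<in> carrier_mat h h" and p: "p \<in> carrier_mat h h" and q: "q \<in> carrier_mat h h"
    and pq: "p * q = 1\<^sub>m h"
  shows "(\<Sum>i<h. (map_mat ext_const q * X * map_mat ext_const p) $$ (i, i)) = (\<Sum>i<h. X $$ (i, i))"
proof -
  let ?t = "\<lambda>i k j. ext_const (q $$ (i, k) * p $$ (j, i)) * X $$ (k, j)"
  have "map_mat ext_const q * X * map_mat ext_const p = map_mat ext_const q * (X * map_mat ext_const p)"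
    by (rule assoc_mult_mat) (use X p q in auto)
  then have "(\<Sum>i<h. (map_mat ext_const q * X * map_mat ext_const p) $$ (i, i)) = (\<Sum>i<h. \<Sum>k<h. \<Sum>j<h. ?t i k j)"
    using X p q carrier_matD[OF p] carrier_matD[OF q]
    by (simp add: mult_mat_entry[of _ h h _ h] sum_distrib_left ext_const_mult mult.assoc
        ext_const_commute[of "X $$ _"] cong: sum.cong_simp)
  also have "\<dots> = (\<Sum>k<h. \<Sum>i<h. \<Sum>j<h. ?t i k j)"
    by (rule sum.swap)
  also have "\<dots> = (\<Sum>k<h. \<Sum>j<h. \<Sum>i<h. ?t i k j)"
    by (intro sum.cong refl sum.swap)
  also have "\<dots> = (\<Sum>k<h. \<Sum>j<h. ext_const ((p * q) $$ (j, k)) * X $$ (k, j))"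
    using p q by (intro sum.cong refl)
      (simp add: mult_mat_entry[of _ h h _ h] ext_const_sum sum_distrib_right mult.commute[of "q $$ _"])
  also have "\<dots> = (\<Sum>k<h. \<Sum>j<h. if j = k then X $$ (k, j) else 0)"
    unfolding pq by (intro sum.cong refl) simp
  finally show ?thesis by (simp add: sum.delta)
qed

text \<open>The entries of \<open>P\<close> are integers with zero differential, so the logarithmic
  derivative of the transformed matrix is that of \<Lambda> conjugated by \<open>P\<close>, and
  likewise for its powers.\<close>

lemma canonical_form_change_basis:
  fixes \<Lambda> :: "('e::linorder) qpoly mat" and P Q :: "int mat"
  assumes \<Lambda>: "\<Lambda> \<in> carrier_mat h h" and P: "P \<in> carrier_mat h h" and Q: "Q \<in> carrier_mat h h"
    and PQ: "P * Q = 1\<^sub>m h" and QP: "Q * P = 1\<^sub>m h" and det: "det \<Lambda> \<noteq> 0"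
  shows "canonical_form n (transpose_mat (map_mat of_int P) * \<Lambda> * map_mat of_int P) = canonical_form n \<Lambda>"
proof -
  let ?\<Lambda>' = "transpose_mat (map_mat of_int P) * \<Lambda> * map_mat of_int P"
  define p :: "'e qratfun mat" where "p = map_mat of_int P"
  define q :: "'e qratfun mat" where "q = map_mat of_int Q"
  define B where "B = inv_mat \<Lambda>"
  define L where "L = map_mat to_fract \<Lambda>"
  define D where "D = map_mat (\<lambda>p. rat_of_poly_form (dpoly p)) \<Lambda>"
  let ?x = "map_mat ext_const :: _ \<Rightarrow> 'e rat_form mat"
  have [simp]: "p \<in> carrier_mat h h" "q \<in> carrier_mat h h" "B \<in> carrier_mat h h" "L \<in> carrier_mat h h"
      "D \<in> carrier_mat h h" "transpose_mat p \<in> carrier_mat h h" "transpose_mat q \<in> carrier_mat h h"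
    using P Q \<Lambda> inv_mat_carrier[OF \<Lambda> det] by (auto simp: p_def q_def B_def L_def D_def)
  have [simp]: "?x X \<in> carrier_mat h h" if "X \<in> carrier_mat h h" for X using that by simp
  have pq: "p * q = 1\<^sub>m h" and qp: "q * p = 1\<^sub>m h"
    unfolding p_def q_def
    using of_int_hom.mat_hom_mult[OF P Q, where 'a = "'e qratfun"] of_int_hom.mat_hom_mult[OF Q P, where 'a = "'e qratfun"]
    by (simp_all add: PQ QP of_int_hom.mat_hom_one)
  have qpT: "transpose_mat q * transpose_mat p = 1\<^sub>m h"
    using transpose_mult[of p h h q h] pq by simp
  note assoc = assoc_mult_mat[of _ h h _ h _ h]
  have L': "map_mat to_fract ?\<Lambda>' = transpose_mat p * L * p"
  proof -
    have "map_mat to_fract (map_mat of_int P :: 'e qpoly mat) = p"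
      unfolding p_def by (rule eq_matI) (auto simp: to_fract.hom_of_int)
    moreover from this have "map_mat to_fract (transpose_mat (map_mat of_int P :: 'e qpoly mat)) = transpose_mat p"
      by (metis map_mat_transpose)
    ultimately show ?thesis
      using P \<Lambda> by (simp add: L_def to_fract.mat_hom_mult[of _ h h _ h] assoc)
  qed
  have D': "map_mat (\<lambda>p. rat_of_poly_form (dpoly p)) ?\<Lambda>' = ?x (transpose_mat p) * D * ?x p"
  proof (rule eq_matI)
    fix i j assume "i < dim_row (?x (transpose_mat p) * D * ?x p)" "j < dim_col (?x (transpose_mat p) * D * ?x p)"
    then have ij: "i < h" "j < h" by (simp_all add: carrier_matD[of p h h])
    have "?\<Lambda>' $$ (i, j) = (\<Sum>a<h. \<Sum>b<h. of_int (P $$ (a, i) * P $$ (b, j)) * \<Lambda> $$ (a, b))"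
      using ij P \<Lambda> carrier_matD[OF P]
      by (simp add: assoc mult_mat_entry[of _ h h _ h] sum_distrib_left mult_ac cong: sum.cong_simp)
    then have "rat_of_poly_form (dpoly (?\<Lambda>' $$ (i, j))) = (\<Sum>a<h. \<Sum>b<h.
        ext_const (of_int (P $$ (a, i) * P $$ (b, j))) * rat_of_poly_form (dpoly (\<Lambda> $$ (a, b))))"
      by (simp only: dpoly_sum dpoly_of_int_mult rat_form.hom_sum rat_form.hom_mult rat_form_const to_fract.hom_of_int)
    also have "\<dots> = (?x (transpose_mat p) * D * ?x p) $$ (i, j)"
    proof -
      have "(?x (transpose_mat p) * D * ?x p) $$ (i, j) = (\<Sum>a<h. \<Sum>b<h. ext_const (of_int (P $$ (a, i))) *
          (ext_const (of_int (P $$ (b, j))) * rat_of_poly_form (dpoly (\<Lambda> $$ (a, b)))))"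
        using ij P \<Lambda> carrier_matD[OF P] carrier_matD[OF \<Lambda>]
        by (simp add: assoc mult_mat_entry[of _ h h _ h] sum_distrib_left p_def D_def
            ext_const_commute[of "rat_of_poly_form _"] cong: sum.cong_simp)
      then show ?thesis by (simp add: mult.assoc[symmetric] ext_const_mult[symmetric])
    qed
    finally show "map_mat (\<lambda>p. rat_of_poly_form (dpoly p)) ?\<Lambda>' $$ (i, j) = (?x (transpose_mat p) * D * ?x p) $$ (i, j)"
      using ij P \<Lambda> by simp
  qed (use P \<Lambda> in \<open>auto simp: p_def\<close>)
  have \<Lambda>': "?\<Lambda>' \<in> carrier_mat h h" using P \<Lambda> by simp
  let ?B' = "q * B * transpose_mat q"
  have cancel: "transpose_mat q * (transpose_mat p * X) = X" if "X \<in> carrier_mat h h" for X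
    using that qpT assoc[of "transpose_mat q" "transpose_mat p" X] by simp
  have "B * L = 1\<^sub>m h" using inv_mat_left[OF \<Lambda> det] by (simp add: B_def L_def)
  then have BL: "B * (L * X) = X" if "X \<in> carrier_mat h h" for X
    using that assoc[of B L X] by simp
  have B': "?B' * map_mat to_fract ?\<Lambda>' = 1\<^sub>m h"
    unfolding L' by (simp add: assoc cancel BL qp)
  let ?X = "?x B * D"
  have X_hom: "?x (R * S) = ?x R * ?x S" if "R \<in> carrier_mat h h" "S \<in> carrier_mat h h" for R S
    using that carrier_matD[OF that(1)] carrier_matD[OF that(2)]
    by (intro eq_matI) (auto simp: mult_mat_entry[of _ h h _ h] ext_const_sum ext_const_mult)
  have x1: "?x (1\<^sub>m h) = 1\<^sub>m h" by (rule eq_matI) auto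
  have xqp: "?x q * ?x p = 1\<^sub>m h" and xpq: "?x p * ?x q = 1\<^sub>m h"
    using qp pq x1 X_hom[of q p] X_hom[of p q] by simp_all
  have "?x (transpose_mat q) * ?x (transpose_mat p) = 1\<^sub>m h"
    using X_hom[of "transpose_mat q" "transpose_mat p"] unfolding qpT x1 by simp
  then have xcancel: "?x (transpose_mat q) * (?x (transpose_mat p) * X) = X" if "X \<in> carrier_mat h h" for X
    using that assoc[of "?x (transpose_mat q)" "?x (transpose_mat p)" X] by simp
  have xpq_cancel: "?x p * (?x q * X) = X" if "X \<in> carrier_mat h h" for X
    using that xpq assoc[of "?x p" "?x q" X] by simp
  have conj: "?x ?B' * map_mat (\<lambda>p. rat_of_poly_form (dpoly p)) ?\<Lambda>' = ?x q * ?X * ?x p"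
    unfolding D' by (simp add: X_hom assoc xcancel)
  have pow: "(?x q * ?X * ?x p) ^\<^sub>m m = ?x q * ?X ^\<^sub>m m * ?x p" for m
  proof (induction m)
    case 0
    then show ?case using xqp by (simp add: carrier_matD[of B h h] carrier_matD[of q h h])
  next
    case (Suc m)
    then show ?case by (simp add: assoc xpq_cancel)
  qed
  have "canonical_form n ?\<Lambda>' = (\<Sum>i<h. (?x q * ?X ^\<^sub>m n * ?x p) $$ (i, i))"
    unfolding canonical_form_left_inverse[OF \<Lambda>' _ B', simplified] conj pow ..
  also have "\<dots> = (\<Sum>i<h. (?X ^\<^sub>m n) $$ (i, i))"
    by (rule trace_conjugate) (simp_all add: pq)
  also have "\<dots> = canonical_form n \<Lambda>"
    unfolding B_def D_def
    by (rule canonical_form_left_inverse[OF \<Lambda> inv_mat_carrier[OF \<Lambda> det] inv_mat_left[OF \<Lambda> det], symmetric])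
  finally show ?thesis .
qed

section \<open>Pullback\<close>

definition dsubst_monom :: "('e::linorder \<Rightarrow> ('f::linorder) qpoly) \<Rightarrow> 'e set \<Rightarrow> 'f poly_form" where
  "dsubst_monom \<sigma> I = prod_list (map (\<lambda>e. dpoly (\<sigma> e)) (sorted_list_of_set I))"

lemma dsubst_monom_insert_min:
  assumes "finite A" "\<And>a. a \<in> A \<Longrightarrow> b < a"
  shows "dsubst_monom \<sigma> (insert b A) = dpoly (\<sigma> b) * dsubst_monom \<sigma> A"
proof -
  have "sorted_list_of_set (insert b A) = b # sorted_list_of_set A"
  proof -
    have "A - {b} = A" using assms(2) by blast
    then show ?thesis using assms by (subst sorted_list_of_set_nonempty) (auto simp: Min_insert2 less_imp_le)
  qed
  then show ?thesis by (simp add: dsubst_monom_def)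
qed

lemma dpoly_anticommute: "dpoly p * dpoly q = - (dpoly q * dpoly p)"
  using graded_commute[OF ext_homogeneous_dpoly ext_homogeneous_dpoly, of p q]
  by (simp add: ext_const_uminus)

lemma dpoly_square: "dpoly p * dpoly p = 0"
  by (rule one_form_square[OF ext_homogeneous_dpoly])

text \<open>The index set grows by a new minimum because its differential then stands first in the
  monomial; a factor of larger index moves past it at the cost of one sign.\<close>

lemma dpoly_mult_dsubst_monom:
  assumes "finite I"
  shows "dpoly (\<sigma> e) * dsubst_monom \<sigma> I =
    (if e \<in> I then 0 else ext_const (shuffle_sign {e} I) * dsubst_monom \<sigma> (insert e I))"
  using assms
proof (induction I rule: finite_linorder_min_induct)
  case empty
  then show ?case by (simp add: dsubst_monom_def)
next
  case (insert b A)
  let ?t = "\<lambda>a. dpoly (\<sigma> a)" and ?W = "dsubst_monom \<sigma>"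
  have W: "?W (insert b A) = ?t b * ?W A" by (rule dsubst_monom_insert_min) (use insert in auto)
  consider "e < b" | "e = b" | "b < e" by fastforce
  then show ?case
  proof cases
    case 1
    then have "\<And>a. a \<in> insert b A \<Longrightarrow> e < a" using insert.hyps(2) by force
    moreover from this have "{(x, y). x \<in> {e} \<and> y \<in> insert b A \<and> y < x} = {}"
      using less_asym by blast
    then have "shuffle_sign {e} (insert b A) = (1 :: 'b qpoly)"
      unfolding shuffle_sign_def by (simp only: card.empty power_0)
    ultimately show ?thesis
      using insert.hyps(1) dsubst_monom_insert_min[of "insert b A" e \<sigma>] by force
  next
    case 2
    then show ?thesis unfolding W by (simp add: dpoly_square flip: mult.assoc)
  next
    case 3
    have "?t e * ?W (insert b A) = - (?t b * (?t e * ?W A))"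
      unfolding W mult.assoc[symmetric] dpoly_anticommute[of "\<sigma> e" "\<sigma> b"] by simp
    also have "\<dots> = (if e \<in> insert b A then 0 else
        ext_const (shuffle_sign {e} (insert b A)) * ?W (insert e (insert b A)))"
    proof (cases "e \<in> A")
      case True
      then show ?thesis by (simp add: insert.IH)
    next
      case False
      have "b \<notin> A" "e \<noteq> b" using insert.hyps(2) 3 by auto
      have "shuffle_sign {e} {b} = (-1 :: 'b qpoly)"
      proof -
        have "{(x, y). x \<in> {e} \<and> y \<in> {b} \<and> y < x} = {(e, b)}" using 3 by auto
        then show ?thesis by (simp add: shuffle_sign_def)
      qed
      then have "shuffle_sign {e} (insert b A) = - (shuffle_sign {e} A :: 'b qpoly)"
        using shuffle_sign_Un_right[of "{e}" "{b}" A, where ?'k = "'b qpoly"] insert.hyps(1) \<open>b \<notin> A\<close> by simp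
      moreover have "?W (insert b (insert e A)) = ?t b * ?W (insert e A)"
        by (rule dsubst_monom_insert_min) (use insert.hyps 3 in auto)
      ultimately show ?thesis
        using False \<open>e \<noteq> b\<close> by (simp add: insert.IH ext_const_uminus insert_commute ext_const_left_commute)
    qed
    finally show ?thesis .
  qed
qed

text \<open>Pullback before fractions appear. Additivity and compatibility with left multiplication
  by scalars and by each \<open>dx e\<close> suffice for what follows, since the entries of
  \<open>adj_form\<close> are sums of such products.\<close>

definition poly_pullback :: "('e::linorder \<Rightarrow> ('f::linorder) qpoly) \<Rightarrow> 'e poly_form \<Rightarrow> 'f poly_form" where
  "poly_pullback \<sigma> f = (\<Sum>I | ext_coeff f I \<noteq> 0. ext_const (poly_subst \<sigma> (ext_coeff f I)) * dsubst_monom \<sigma> I)"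

lemma poly_pullback_superset:
  assumes "finite S" "{I. ext_coeff f I \<noteq> 0} \<subseteq> S"
  shows "poly_pullback \<sigma> f = (\<Sum>I\<in>S. ext_const (poly_subst \<sigma> (ext_coeff f I)) * dsubst_monom \<sigma> I)"
  unfolding poly_pullback_def
  by (rule sum.mono_neutral_left) (use assms in \<open>auto simp: poly_subst_zero\<close>)

lemma poly_pullback_zero: "poly_pullback \<sigma> 0 = 0"
  by (simp add: poly_pullback_def)

lemma poly_pullback_add: "poly_pullback \<sigma> (f + g) = poly_pullback \<sigma> f + poly_pullback \<sigma> g"
proof -
  let ?S = "{I. ext_coeff f I \<noteq> 0} \<union> {I. ext_coeff g I \<noteq> 0}"
  have S: "finite ?S" using finite_ext_support[of f] finite_ext_support[of g] by simp
  have "poly_pullback \<sigma> (f + g) =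
      (\<Sum>I\<in>?S. ext_const (poly_subst \<sigma> (ext_coeff (f + g) I)) * dsubst_monom \<sigma> I)"
    by (rule poly_pullback_superset[OF S]) auto
  also have "\<dots> = (\<Sum>I\<in>?S. ext_const (poly_subst \<sigma> (ext_coeff f I)) * dsubst_monom \<sigma> I) +
      (\<Sum>I\<in>?S. ext_const (poly_subst \<sigma> (ext_coeff g I)) * dsubst_monom \<sigma> I)"
    by (simp add: poly_subst_add ext_const_add distrib_right sum.distrib)
  also have "\<dots> = poly_pullback \<sigma> f + poly_pullback \<sigma> g"
    by (subst (1 2) poly_pullback_superset[OF S]) auto
  finally show ?thesis .
qed

lemma poly_pullback_sum: "poly_pullback \<sigma> (\<Sum>i\<in>A. f i) = (\<Sum>i\<in>A. poly_pullback \<sigma> (f i))"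
  by (induction A rule: infinite_finite_induct) (simp_all add: poly_pullback_zero poly_pullback_add)

lemma poly_pullback_const_mult:
  "poly_pullback \<sigma> (ext_const p * f) = ext_const (poly_subst \<sigma> p) * poly_pullback \<sigma> f"
proof -
  let ?S = "{I. ext_coeff f I \<noteq> 0}"
  have "poly_pullback \<sigma> (ext_const p * f) =
      (\<Sum>I\<in>?S. ext_const (poly_subst \<sigma> (ext_coeff (ext_const p * f) I)) * dsubst_monom \<sigma> I)"
    by (rule poly_pullback_superset[OF finite_ext_support]) auto
  then show ?thesis
    by (simp add: poly_pullback_def poly_subst_mult ext_const_mult mult.assoc sum_distrib_left)
qed

lemma poly_pullback_dx_mult: "poly_pullback \<sigma> (dx e * f) = dpoly (\<sigma> e) * poly_pullback \<sigma> f"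
proof -
  let ?S = "{I. ext_coeff f I \<noteq> 0}"
  let ?T = "{I \<in> ?S. e \<notin> I}"
  let ?c = "\<lambda>I. ext_const (poly_subst \<sigma> (ext_coeff f I))"
  have fin: "finite I" if "I \<in> ?S" for I using that ext_coeff_infinite by blast
  have S: "finite ?S" by (rule finite_ext_support)
  have sub: "{I. ext_coeff (dx e * f) I \<noteq> 0} \<subseteq> insert e ` ?T"
  proof
    fix I assume "I \<in> {I. ext_coeff (dx e * f) I \<noteq> 0}"
    then have "e \<in> I" "ext_coeff f (I - {e}) \<noteq> 0" by (auto simp: dx_mult_coeff split: if_splits)
    then show "I \<in> insert e ` ?T" by (intro image_eqI[of _ _ "I - {e}"]) auto
  qed
  have inj: "inj_on (insert e) ?T" by (auto simp: inj_on_def)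
  have "poly_pullback \<sigma> (dx e * f) = (\<Sum>I\<in>insert e ` ?T.
      ext_const (poly_subst \<sigma> (ext_coeff (dx e * f) I)) * dsubst_monom \<sigma> I)"
    by (rule poly_pullback_superset[OF _ sub]) (use S in simp)
  also have "\<dots> = (\<Sum>I\<in>?T. ext_const (poly_subst \<sigma> (ext_coeff (dx e * f) (insert e I))) * dsubst_monom \<sigma> (insert e I))"
    by (rule sum.reindex[OF inj, unfolded comp_def])
  also have "\<dots> = (\<Sum>I\<in>?T. dpoly (\<sigma> e) * (?c I * dsubst_monom \<sigma> I))"
  proof (rule sum.cong[OF refl])
    fix I assume I: "I \<in> ?T"
    interpret comm_ring_hom "poly_subst \<sigma>" by (rule comm_ring_hom_poly_subst)
    have "poly_subst \<sigma> (ext_coeff (dx e * f) (insert e I)) = shuffle_sign {e} I * poly_subst \<sigma> (ext_coeff f I)"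
      using I by (simp add: dx_mult_coeff poly_subst_mult shuffle_sign_hom)
    moreover have "dpoly (\<sigma> e) * dsubst_monom \<sigma> I = ext_const (shuffle_sign {e} I) * dsubst_monom \<sigma> (insert e I)"
      using dpoly_mult_dsubst_monom[OF fin, of I \<sigma> e] I by simp
    ultimately show "ext_const (poly_subst \<sigma> (ext_coeff (dx e * f) (insert e I))) * dsubst_monom \<sigma> (insert e I) =
        dpoly (\<sigma> e) * (?c I * dsubst_monom \<sigma> I)"
      by (simp add: ext_const_left_commute[of "dpoly _"] ext_const_mult mult.assoc
          ext_const_left_commute[of "ext_const (shuffle_sign {e} I)"])
  qed
  \<comment> \<open>Index sets that contain \<open>e\<close> may be added back: their terms repeat
    the one-form \<open>dpoly (\<sigma> e)\<close> and vanish.\<close>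
  also have "\<dots> = (\<Sum>I\<in>?S. dpoly (\<sigma> e) * (?c I * dsubst_monom \<sigma> I))"
  proof (rule sum.mono_neutral_left[OF S])
    show "\<forall>I\<in>?S - ?T. dpoly (\<sigma> e) * (?c I * dsubst_monom \<sigma> I) = 0"
      using dpoly_mult_dsubst_monom[OF fin, of _ \<sigma> e] by (auto simp: ext_const_left_commute[of "dpoly _"])
  qed auto
  finally show ?thesis by (simp add: poly_pullback_def sum_distrib_left)
qed

lemma poly_pullback_one: "poly_pullback \<sigma> 1 = 1"
  by (subst poly_pullback_superset[of "{{}}"])
     (auto simp: ext_coeff_one poly_subst_one dsubst_monom_def split: if_splits)

lemma rat_form_prod_list: "rat_of_poly_form (prod_list fs) = prod_list (map rat_of_poly_form fs)"
  by (induction fs) (simp_all add: rat_form.hom_mult)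

text \<open>A common denominator that survives the substitution evaluates all coefficients at once
  and reduces the pullback to polynomial forms.\<close>

lemma pullback_fraction:
  assumes "\<And>I. ext_coeff \<omega> I = Fract (ext_coeff f I) q" and "q \<noteq> 0" and "poly_subst \<sigma> q \<noteq> 0"
  shows "pullback_defined \<sigma> \<omega>"
    and "pullback \<sigma> \<omega> = ext_const (1 / to_fract (poly_subst \<sigma> q)) * rat_of_poly_form (poly_pullback \<sigma> f)"
proof -
  show "pullback_defined \<sigma> \<omega>"
    unfolding pullback_defined_def assms(1) using ratfun_subst_Fract(1)[OF assms(2,3)] by blast
  have "(ext_coeff \<omega> I \<noteq> 0) = (ext_coeff f I \<noteq> 0)" for I
    unfolding assms(1) using assms(2) by (simp add: Fract_conv_to_fract)
  moreover have "ext_const (ratfun_subst \<sigma> (ext_coeff \<omega> I)) *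
      prod_list (map (\<lambda>e. rat_of_poly_form (dpoly (\<sigma> e))) (sorted_list_of_set I)) =
      ext_const (1 / to_fract (poly_subst \<sigma> q)) *
        rat_of_poly_form (ext_const (poly_subst \<sigma> (ext_coeff f I)) * dsubst_monom \<sigma> I)" for I
  proof -
    have "ratfun_subst \<sigma> (ext_coeff \<omega> I) = 1 / to_fract (poly_subst \<sigma> q) * to_fract (poly_subst \<sigma> (ext_coeff f I))"
      unfolding assms(1) ratfun_subst_Fract(2)[OF assms(2,3)] by (simp add: Fract_conv_to_fract)
    then show ?thesis
      by (simp only: dsubst_monom_def rat_form_prod_list rat_form.hom_mult rat_form_const map_map comp_def
          ext_const_mult mult.assoc)
  qed
  ultimately show "pullback \<sigma> \<omega> = ext_const (1 / to_fract (poly_subst \<sigma> q)) * rat_of_poly_form (poly_pullback \<sigma> f)"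
    unfolding pullback_def poly_pullback_def by (simp only: rat_form.hom_sum sum_distrib_left)
qed

context linear_form_mat
begin

text \<open>The adjugate commutes with ring homomorphisms, and for the linear entries of \<Lambda>
  the chain rule is additivity of the differential.\<close>

lemma poly_pullback_adj_form_mult:
  assumes ij: "i < h" "j < h"
  shows "poly_pullback \<sigma> (adj_form \<Lambda> $$ (i, j) * f) =
    adj_form (map_mat (poly_subst \<sigma>) \<Lambda>) $$ (i, j) * poly_pullback \<sigma> f"
proof -
  interpret comm_ring_hom "poly_subst \<sigma>" by (rule comm_ring_hom_poly_subst)
  let ?s = "poly_subst \<sigma>"
  have \<sigma>\<Lambda>: "map_mat ?s \<Lambda> \<in> carrier_mat h h" using \<Lambda> by simp
  have d: "poly_pullback \<sigma> (dpoly (\<Lambda> $$ (l, j)) * f) = dpoly (?s (\<Lambda> $$ (l, j))) * poly_pullback \<sigma> f"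
    if l: "l < h" for l
  proof -
    have "?s (\<Lambda> $$ (l, j)) = (\<Sum>e\<in>E. of_int (c l j e) * \<sigma> e)"
      using l ij by (simp only: entry poly_subst_sum poly_subst_mult poly_subst_xvar hom_of_int)
    then have "dpoly (?s (\<Lambda> $$ (l, j))) = (\<Sum>e\<in>E. ext_const (of_int (c l j e)) * dpoly (\<sigma> e))"
      by (simp only: dpoly_sum dpoly_of_int_mult)
    moreover have "poly_pullback \<sigma> (dpoly (\<Lambda> $$ (l, j)) * f) =
        (\<Sum>e\<in>E. ext_const (of_int (c l j e)) * (dpoly (\<sigma> e) * poly_pullback \<sigma> f))"
      using l ij by (simp only: dpoly_entry sum_distrib_right mult.assoc poly_pullback_sum
          poly_pullback_const_mult poly_pullback_dx_mult hom_of_int)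
    ultimately show ?thesis by (simp only: sum_distrib_right mult.assoc)
  qed
  have "poly_pullback \<sigma> (adj_form \<Lambda> $$ (i, j) * f) =
      (\<Sum>l<h. ext_const (?s (adj_mat \<Lambda> $$ (i, l))) * (dpoly (?s (\<Lambda> $$ (l, j))) * poly_pullback \<sigma> f))"
    unfolding adj_form_entry[OF \<Lambda> ij] sum_distrib_right mult.assoc poly_pullback_sum poly_pullback_const_mult
    by (intro sum.cong refl) (simp add: d)
  also have "\<dots> = (\<Sum>l<h. ext_const (adj_mat (map_mat ?s \<Lambda>) $$ (i, l)) * dpoly (map_mat ?s \<Lambda> $$ (l, j))) * poly_pullback \<sigma> f"
    unfolding sum_distrib_right mult.assoc adj_mat_hom[symmetric]
    using ij carrier_matD[OF \<Lambda>] carrier_matD[OF adj_carrier] by (intro sum.cong refl) simp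
  finally show ?thesis unfolding adj_form_entry[OF \<sigma>\<Lambda> ij] .
qed

lemma poly_pullback_adj_form_pow:
  assumes "i < h" "j < h"
  shows "poly_pullback \<sigma> ((adj_form \<Lambda> ^\<^sub>m n) $$ (i, j)) =
    (adj_form (map_mat (poly_subst \<sigma>) \<Lambda>) ^\<^sub>m n) $$ (i, j)"
  using assms
proof (induction n arbitrary: i j)
  case 0
  then show ?case
    using carrier_matD[OF \<Lambda>_form] carrier_matD[OF \<Lambda>] by (simp add: adj_form_def poly_pullback_one poly_pullback_zero adj_mat_def)
next
  case (Suc n)
  let ?N = "adj_form \<Lambda>" and ?N' = "adj_form (map_mat (poly_subst \<sigma>) \<Lambda>)"
  have N': "?N' \<in> carrier_mat h h" using \<Lambda> by simp
  have "poly_pullback \<sigma> ((?N ^\<^sub>m Suc n) $$ (i, j)) =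
      (\<Sum>k<h. poly_pullback \<sigma> (?N $$ (i, k) * (?N ^\<^sub>m n) $$ (k, j)))"
    unfolding pow_mat_Suc_left[OF \<Lambda>_form] mult_mat_entry[OF \<Lambda>_form pow_mat_carrier[OF \<Lambda>_form] Suc.prems]
    by (rule poly_pullback_sum)
  also have "\<dots> = (\<Sum>k<h. ?N' $$ (i, k) * (?N' ^\<^sub>m n) $$ (k, j))"
    using Suc by (intro sum.cong refl) (simp add: poly_pullback_adj_form_mult)
  also have "\<dots> = (?N' ^\<^sub>m Suc n) $$ (i, j)"
    unfolding pow_mat_Suc_left[OF N'] mult_mat_entry[OF N' pow_mat_carrier[OF N'] Suc.prems] ..
  finally show ?case .
qed

lemma pullback_canonical_form:
  assumes "poly_subst \<sigma> (det \<Lambda>) \<noteq> 0"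
  shows "pullback_defined \<sigma> (canonical_form n \<Lambda>)"
    and "pullback \<sigma> (canonical_form n \<Lambda>) = canonical_form n (map_mat (poly_subst \<sigma>) \<Lambda>)"
proof -
  interpret comm_ring_hom "poly_subst \<sigma>" by (rule comm_ring_hom_poly_subst)
  have q: "det \<Lambda> ^ n \<noteq> 0" "poly_subst \<sigma> (det \<Lambda> ^ n) \<noteq> 0"
    using det assms by (simp_all add: hom_power)
  note frac = pullback_fraction[OF canonical_form_coeff q]
  show "pullback_defined \<sigma> (canonical_form n \<Lambda>)" by (rule frac(1))
  have \<sigma>\<Lambda>: "map_mat (poly_subst \<sigma>) \<Lambda> \<in> carrier_mat h h" using \<Lambda> by simp
  have "poly_pullback \<sigma> (tr_pow n) = (\<Sum>i<h. (adj_form (map_mat (poly_subst \<sigma>) \<Lambda>) ^\<^sub>m n) $$ (i, i))"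
    unfolding poly_pullback_sum by (intro sum.cong refl) (simp add: poly_pullback_adj_form_pow)
  then show "pullback \<sigma> (canonical_form n \<Lambda>) = canonical_form n (map_mat (poly_subst \<sigma>) \<Lambda>)"
    using assms unfolding frac(2) canonical_form_eq[OF \<sigma>\<Lambda>, unfolded hom_det, OF assms]
    by (simp add: hom_power to_fract.hom_power power_one_over)
qed

end

section \<open>Graph Laplacians\<close>

text \<open>The matrix, on the span of \<open>bs\<close>, of the quadratic form that sums the
  \<open>x_e\<close> times the squared values at \<open>e\<close>. No listing of the edges is
  involved, so edge sets can be reindexed freely.\<close>

definition gram :: "('e::linorder) set \<Rightarrow> ('e \<Rightarrow> int) list \<Rightarrow> 'e qpoly mat" where
  "gram E bs = mat (length bs) (length bs) (\<lambda>(i, j). \<Sum>e\<in>E. of_int ((bs ! i) e * (bs ! j) e) * xvar e)"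

lemma gram_carrier: "gram E bs \<in> carrier_mat (length bs) (length bs)"
  by (simp add: gram_def)

lemma laplacian_eq_gram:
  assumes "finite E"
  shows "transpose_mat (homology_mat E bs) * variable_mat E * homology_mat E bs = gram E bs"
proof -
  let ?m = "card E" and ?h = "length bs" and ?s = "sorted_list_of_set E"
  let ?H = "homology_mat E bs" and ?D = "variable_mat E"
  have H: "?H \<in> carrier_mat ?m ?h" by (simp add: homology_mat_def)
  have D: "?D \<in> carrier_mat ?m ?m" by (simp add: variable_mat_def)
  have HT: "transpose_mat ?H \<in> carrier_mat ?h ?m" using H by simp
  have HD: "(transpose_mat ?H * ?D) $$ (i, a) = of_int ((bs ! i) (?s ! a)) * xvar (?s ! a)"
    if "i < ?h" "a < ?m" for i a
  proof -
    have "(transpose_mat ?H * ?D) $$ (i, a) = (\<Sum>b<?m. if b = a then of_int ((bs ! i) (?s ! a)) * xvar (?s ! a) else 0)"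
      unfolding mult_mat_entry[OF HT D that] using that
      by (intro sum.cong refl) (simp add: homology_mat_def variable_mat_def mat_diag_def)
    then show ?thesis using that by (simp add: sum.delta)
  qed
  have bij: "bij_betw ((!) ?s) {..<?m} E"
    by (rule bij_betw_nth) (use assms in auto)
  show ?thesis
  proof (rule eq_matI)
    fix i j assume "i < dim_row (gram E bs)" "j < dim_col (gram E bs)"
    then have ij: "i < ?h" "j < ?h" by (simp_all add: gram_def)
    have "(transpose_mat ?H * ?D * ?H) $$ (i, j) =
        (\<Sum>a<?m. (transpose_mat ?H * ?D) $$ (i, a) * ?H $$ (a, j))"
      by (rule mult_mat_entry[OF _ H ij]) (use HT D in simp)
    also have "\<dots> = (\<Sum>a<?m. of_int ((bs ! i) (?s ! a) * (bs ! j) (?s ! a)) * xvar (?s ! a))"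
    proof (intro sum.cong refl)
      fix a assume "a \<in> {..<?m}"
      then have a: "a < ?m" by simp
      have "?H $$ (a, j) = of_int ((bs ! j) (?s ! a))" using a ij by (simp add: homology_mat_def)
      then show "(transpose_mat ?H * ?D) $$ (i, a) * ?H $$ (a, j) =
          of_int ((bs ! i) (?s ! a) * (bs ! j) (?s ! a)) * xvar (?s ! a)"
        unfolding HD[OF ij(1) a] by (simp add: mult_ac)
    qed
    also have "\<dots> = (\<Sum>e\<in>E. of_int ((bs ! i) e * (bs ! j) e) * xvar e)"
      by (rule sum.reindex_bij_betw[OF bij])
    finally show "(transpose_mat ?H * ?D * ?H) $$ (i, j) = gram E bs $$ (i, j)"
      using ij by (simp add: gram_def)
  qed (use H in \<open>auto simp: gram_def\<close>)
qed

text \<open>Positive definiteness: a kernel vector gives a combination of the \<open>b i\<close>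
  whose values on \<open>E\<close> have square sum 0.\<close>

lemma det_int_gram_nonzero:
  fixes b :: "nat \<Rightarrow> 'e \<Rightarrow> int"
  assumes "finite E"
    and indep: "\<And>v. (\<And>e. e \<in> E \<Longrightarrow> (\<Sum>i<h. v i * b i e) = 0) \<Longrightarrow> \<forall>i<h. v i = 0"
  shows "det (mat h h (\<lambda>(i, j). \<Sum>e\<in>E. b i e * b j e)) \<noteq> 0" (is "det ?Z \<noteq> 0")
proof
  assume "det ?Z = 0"
  moreover have Z: "?Z \<in> carrier_mat h h" by simp
  ultimately obtain v where v: "v \<in> carrier_vec h" "v \<noteq> 0\<^sub>v h" "?Z *\<^sub>v v = 0\<^sub>v h"
    using det_0_iff_vec_prod_zero[OF Z] by blast
  have row: "(\<Sum>j<h. (\<Sum>e\<in>E. b i e * b j e) * v $ j) = 0" if "i < h" for i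
  proof -
    have "(?Z *\<^sub>v v) $ i = 0" using v(3) that by simp
    then show ?thesis using that v(1) by (simp add: scalar_prod_def lessThan_atLeast0)
  qed
  let ?t = "\<lambda>e. \<Sum>i<h. v $ i * b i e"
  have "(\<Sum>e\<in>E. ?t e * ?t e) = (\<Sum>e\<in>E. \<Sum>i<h. \<Sum>j<h. v $ i * (b i e * b j e * v $ j))"
    by (simp add: sum_product mult_ac)
  also have "\<dots> = (\<Sum>i<h. \<Sum>j<h. \<Sum>e\<in>E. v $ i * (b i e * b j e * v $ j))"
    by (subst sum.swap) (intro sum.cong refl sum.swap)
  also have "\<dots> = (\<Sum>i<h. v $ i * (\<Sum>j<h. (\<Sum>e\<in>E. b i e * b j e) * v $ j))"
    by (simp add: sum_distrib_left sum_distrib_right)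
  also have "\<dots> = 0" by (intro sum.neutral) (simp add: row)
  finally have "?t e = 0" if "e \<in> E" for e
    using that sum_nonneg_eq_0_iff[OF assms(1), of "\<lambda>e. ?t e * ?t e"] by simp
  then have "\<forall>i<h. v $ i = 0" by (rule indep)
  then have "v = 0\<^sub>v h" using v(1) by (intro eq_vecI) auto
  then show False using v(2) by simp
qed

lemma int_basis_span:
  assumes "int_basis bs L" "z \<in> L"
  obtains a where "\<And>e. z e = (\<Sum>i<length bs. a i * (bs ! i) e)"
proof -
  have "\<exists>!c. length c = length bs \<and> (\<forall>e. z e = (\<Sum>i<length bs. c ! i * (bs ! i) e))"
    using assms by (simp add: int_basis_def)
  then obtain c where "\<forall>e. z e = (\<Sum>i<length bs. c ! i * (bs ! i) e)" by blast
  then show ?thesis using that[of "(!) c"] by blast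
qed

lemma int_basis_unique:
  assumes "int_basis bs L" "z \<in> L"
    and "\<And>e. z e = (\<Sum>i<length bs. a i * (bs ! i) e)" "\<And>e. z e = (\<Sum>i<length bs. a' i * (bs ! i) e)"
    and "i < length bs"
  shows "a i = a' i"
proof -
  let ?P = "\<lambda>c. length c = length bs \<and> (\<forall>e. z e = (\<Sum>i<length bs. c ! i * (bs ! i) e))"
  have "\<exists>!c. ?P c" using assms(1,2) by (simp add: int_basis_def)
  moreover have "?P (map a [0..<length bs])" by (simp add: assms(3)[symmetric])
  moreover have "?P (map a' [0..<length bs])" by (simp add: assms(4)[symmetric])
  ultimately have "map a [0..<length bs] = map a' [0..<length bs]" by blast
  then show ?thesis using assms(5) by simp
qed

text \<open>Setting all variables to 1 gives an integral Gram matrix. The independence that it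
  requires is the uniqueness of the coordinates of the zero vector.\<close>

lemma gram_det_nonzero:
  fixes bs :: "('e::linorder \<Rightarrow> int) list"
  assumes E: "finite E" and bs: "int_basis bs L" and zero: "(\<lambda>_. 0) \<in> L"
    and supp: "\<And>z e. z \<in> L \<Longrightarrow> e \<notin> E \<Longrightarrow> z e = 0"
  shows "det (gram E bs) \<noteq> 0"
proof
  let ?h = "length bs" and ?ev = "poly_subst (\<lambda>_. 1) :: 'e qpoly \<Rightarrow> 'e qpoly"
  let ?Z = "mat ?h ?h (\<lambda>(i, j). \<Sum>e\<in>E. (bs ! i) e * (bs ! j) e) :: int mat"
  interpret comm_ring_hom ?ev by (rule comm_ring_hom_poly_subst)
  assume "det (gram E bs) = 0"
  then have "det (map_mat ?ev (gram E bs)) = 0" by (simp add: hom_det poly_subst_zero)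
  moreover have "map_mat ?ev (gram E bs) = map_mat of_int ?Z"
    by (rule eq_matI) (auto simp: gram_def poly_subst_sum poly_subst_mult poly_subst_xvar hom_of_int hom_mult)
  ultimately have "det ?Z = 0" by (simp add: of_int_hom.hom_det)
  moreover have "det ?Z \<noteq> 0"
  proof (rule det_int_gram_nonzero[OF E])
    fix v assume v: "\<And>e. e \<in> E \<Longrightarrow> (\<Sum>i<?h. v i * (bs ! i) e) = 0"
    have "(\<Sum>i<?h. v i * (bs ! i) e) = 0" for e
    proof (cases "e \<in> E")
      case False
      then have "(bs ! i) e = 0" if "i < ?h" for i
      proof -
        have "bs ! i \<in> L" using bs that by (auto simp: int_basis_def)
        then show ?thesis using False by (rule supp)
      qed
      then show ?thesis by simp
    qed (rule v)
    then show "\<forall>i<?h. v i = 0"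
      using int_basis_unique[OF bs zero, of v "\<lambda>_. 0"] by simp
  qed
  ultimately show False by contradiction
qed

text \<open>\<open>P\<close> is the matrix of \<open>f\<close> in the two bases and \<open>Q\<close>
  that of its inverse. The assumption \<open>closed\<close> keeps combinations of basis vectors
  inside \<open>L\<close>, where \<open>f\<close> is injective.\<close>

lemma basis_change:
  fixes f :: "('e \<Rightarrow> int) \<Rightarrow> 'f \<Rightarrow> int"
  assumes bs: "int_basis bs L" and bs': "int_basis bs' L'" and bij: "bij_betw f L L'"
    and lin: "\<And>a g n. f (\<lambda>e. \<Sum>i<n::nat. a i * g i e) = (\<lambda>x. \<Sum>i<n. a i * f (g i) x)"
    and closed: "\<And>a. (\<lambda>e. \<Sum>i<length bs. a i * (bs ! i) e) \<in> L"
  obtains P Q where "P \<in> carrier_mat (length bs) (length bs)" "Q \<in> carrier_mat (length bs) (length bs)"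
    "P * Q = 1\<^sub>m (length bs)" "Q * P = 1\<^sub>m (length bs)" "length bs' = length bs"
    "\<And>i x. i < length bs \<Longrightarrow> f (bs ! i) x = (\<Sum>k<length bs. P $$ (k, i) * (bs' ! k) x)"
proof -
  let ?h = "length bs" and ?m = "length bs'"
  have b: "bs ! i \<in> L" if "i < ?h" for i using bs that by (auto simp: int_basis_def)
  have b': "bs' ! k \<in> L'" if "k < ?m" for k using bs' that by (auto simp: int_basis_def)
  have fb: "f (bs ! i) \<in> L'" if "i < ?h" for i using bij b[OF that] by (auto simp: bij_betw_def)
  define p where "p i = (SOME a. \<forall>x. f (bs ! i) x = (\<Sum>k<?m. a k * (bs' ! k) x))" for i
  have p: "f (bs ! i) x = (\<Sum>k<?m. p i k * (bs' ! k) x)" if "i < ?h" for i x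
  proof -
    have "\<exists>a. \<forall>x. f (bs ! i) x = (\<Sum>k<?m. a k * (bs' ! k) x)"
      using int_basis_span[OF bs' fb[OF that]] by blast
    from someI_ex[OF this] show ?thesis unfolding p_def by blast
  qed
  define q where "q k = (SOME a. f (\<lambda>e. \<Sum>i<?h. a i * (bs ! i) e) = bs' ! k)" for k
  have q: "f (\<lambda>e. \<Sum>i<?h. q k i * (bs ! i) e) = bs' ! k" if "k < ?m" for k
  proof -
    have "bs' ! k \<in> f ` L" using bij b'[OF that] by (simp add: bij_betw_def)
    then obtain z where z: "z \<in> L" "f z = bs' ! k" by force
    obtain a where "\<And>e. z e = (\<Sum>i<?h. a i * (bs ! i) e)" using int_basis_span[OF bs z(1)] by blast
    then have "z = (\<lambda>e. \<Sum>i<?h. a i * (bs ! i) e)" by blast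
    then have "\<exists>a. f (\<lambda>e. \<Sum>i<?h. a i * (bs ! i) e) = bs' ! k" using z by blast
    from someI_ex[OF this] show ?thesis unfolding q_def .
  qed
  have pq: "(\<Sum>i<?h. p i l * q k i) = (if l = k then 1 else 0)" if k: "k < ?m" and l: "l < ?m" for k l
  proof -
    have 1: "(bs' ! k) x = (\<Sum>l<?m. (\<Sum>i<?h. p i l * q k i) * (bs' ! l) x)" for x
    proof -
      have "(bs' ! k) x = (\<Sum>i<?h. q k i * f (bs ! i) x)" using q[OF k] unfolding lin by (rule fun_cong[OF sym])
      also have "\<dots> = (\<Sum>i<?h. \<Sum>l<?m. p i l * q k i * (bs' ! l) x)"
        by (intro sum.cong refl) (simp add: p sum_distrib_left mult_ac)
      also have "\<dots> = (\<Sum>l<?m. \<Sum>i<?h. p i l * q k i * (bs' ! l) x)" by (rule sum.swap)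
      finally show ?thesis by (simp add: sum_distrib_right)
    qed
    have 2: "(bs' ! k) x = (\<Sum>l<?m. (if l = k then 1 else 0) * (bs' ! l) x)" for x
    proof -
      have "(\<Sum>l<?m. (if l = k then 1 else 0) * (bs' ! l) x) = (\<Sum>l<?m. if l = k then (bs' ! l) x else 0)"
        by (intro sum.cong refl) simp
      then show ?thesis using k by (simp add: sum.delta)
    qed
    show ?thesis by (rule int_basis_unique[OF bs' b'[OF k] 1 2 l])
  qed
  have qp: "(\<Sum>k<?m. q k j * p i k) = (if j = i then 1 else 0)" if i: "i < ?h" and j: "j < ?h" for i j
  proof -
    let ?z = "\<lambda>e. \<Sum>j<?h. (\<Sum>k<?m. q k j * p i k) * (bs ! j) e"
    have "f ?z x = f (bs ! i) x" for x
    proof -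
      have "f ?z x = (\<Sum>j<?h. (\<Sum>k<?m. q k j * p i k) * f (bs ! j) x)" unfolding lin ..
      also have "\<dots> = (\<Sum>j<?h. \<Sum>k<?m. p i k * (q k j * f (bs ! j) x))"
        by (simp add: sum_distrib_left sum_distrib_right mult_ac)
      also have "\<dots> = (\<Sum>k<?m. \<Sum>j<?h. p i k * (q k j * f (bs ! j) x))" by (rule sum.swap)
      also have "\<dots> = (\<Sum>k<?m. p i k * (bs' ! k) x)"
      proof (intro sum.cong refl)
        fix k assume "k \<in> {..<?m}"
        then have k: "k < ?m" by simp
        have "(bs' ! k) x = (\<Sum>j<?h. q k j * f (bs ! j) x)"
          using q[OF k] unfolding lin by (rule fun_cong[OF sym])
        then show "(\<Sum>j<?h. p i k * (q k j * f (bs ! j) x)) = p i k * (bs' ! k) x"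
          by (simp add: sum_distrib_left)
      qed
      finally show ?thesis using p[OF i] by simp
    qed
    then have "f ?z = f (bs ! i)" by (rule ext)
    then have z: "?z = bs ! i"
      by (rule inj_onD[OF bij_betw_imp_inj_on[OF bij] _ closed b[OF i]])
    have 1: "(bs ! i) e = (\<Sum>j<?h. (\<Sum>k<?m. q k j * p i k) * (bs ! j) e)" for e
      using fun_cong[OF z, of e] by (rule sym)
    have 2: "(bs ! i) e = (\<Sum>j<?h. (if j = i then 1 else 0) * (bs ! j) e)" for e
    proof -
      have "(\<Sum>j<?h. (if j = i then 1 else 0) * (bs ! j) e) = (\<Sum>j<?h. if j = i then (bs ! j) e else 0)"
        by (intro sum.cong refl) simp
      then show ?thesis using i by (simp add: sum.delta)
    qed
    show ?thesis by (rule int_basis_unique[OF bs b[OF i] 1 2 j])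
  qed
  \<comment> \<open>The bases have equal length because both products of the coefficient matrices
    are identities and have the same trace.\<close>
  have "int ?m = (\<Sum>k<?m. 1)" by simp
  also have "\<dots> = (\<Sum>k<?m. \<Sum>i<?h. p i k * q k i)"
  proof (rule sum.cong[OF refl])
    fix k assume "k \<in> {..<?m}"
    then show "1 = (\<Sum>i<?h. p i k * q k i)" using pq[of k k] by simp
  qed
  also have "\<dots> = (\<Sum>i<?h. \<Sum>k<?m. p i k * q k i)" by (rule sum.swap)
  also have "\<dots> = (\<Sum>i<?h. 1)"
  proof (rule sum.cong[OF refl])
    fix i assume "i \<in> {..<?h}"
    then show "(\<Sum>k<?m. p i k * q k i) = 1" using qp[of i i] by (simp add: mult.commute)
  qed
  also have "\<dots> = int ?h" by simp
  finally have mh: "?m = ?h" by simp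
  let ?P = "mat ?h ?h (\<lambda>(k, i). p i k)" and ?Q = "mat ?h ?h (\<lambda>(i, k). q k i)"
  have P: "?P \<in> carrier_mat ?h ?h" and Q: "?Q \<in> carrier_mat ?h ?h" by simp_all
  have PQ: "?P * ?Q = 1\<^sub>m ?h"
  proof (rule eq_matI)
    fix l k assume "l < dim_row (1\<^sub>m ?h :: int mat)" "k < dim_col (1\<^sub>m ?h :: int mat)"
    then have lk: "l < ?h" "k < ?h" by simp_all
    then have "(?P * ?Q) $$ (l, k) = (\<Sum>i<?h. p i l * q k i)"
      unfolding mult_mat_entry[OF P Q lk] by (intro sum.cong refl) simp
    then show "(?P * ?Q) $$ (l, k) = 1\<^sub>m ?h $$ (l, k)" using pq[of k l] lk mh by simp
  qed simp_all
  have QP: "?Q * ?P = 1\<^sub>m ?h"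
  proof (rule eq_matI)
    fix j i assume "j < dim_row (1\<^sub>m ?h :: int mat)" "i < dim_col (1\<^sub>m ?h :: int mat)"
    then have ji: "j < ?h" "i < ?h" by simp_all
    then have "(?Q * ?P) $$ (j, i) = (\<Sum>k<?h. q k j * p i k)"
      unfolding mult_mat_entry[OF Q P ji] by (intro sum.cong refl) simp
    then show "(?Q * ?P) $$ (j, i) = 1\<^sub>m ?h $$ (j, i)" using qp[of i j] ji mh by simp
  qed simp_all
  have fP: "f (bs ! i) x = (\<Sum>k<?h. ?P $$ (k, i) * (bs' ! k) x)" if "i < ?h" for i x
    unfolding p[OF that, of x] mh using that by (intro sum.cong refl) simp
  show ?thesis by (rule that[OF P Q PQ QP mh fP])
qed

lemma gram_linear_form_mat:
  assumes "finite E" "det (gram E bs) \<noteq> 0"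
  shows "linear_form_mat E (length bs) (\<lambda>i j e. (bs ! i) e * (bs ! j) e) (gram E bs)"
  by unfold_locales (use assms in \<open>auto simp: gram_def\<close>)

text \<open>Both the contraction of an edge and an isomorphism of graphs restrict cycles along an injection
  \<open>\<rho>\<close> of edge sets, up to signs \<open>\<epsilon>\<close> caused by the choice of orientations.\<close>

lemma pullback_gram:
  fixes bs :: "('e::linorder \<Rightarrow> int) list" and bs' :: "('f::linorder \<Rightarrow> int) list" and \<epsilon> :: "'f \<Rightarrow> int"
  assumes E: "finite E" and E': "finite E'"
    and bs: "int_basis bs L" and bs': "int_basis bs' L'"
    and det: "det (gram E bs) \<noteq> 0" and det': "det (gram E' bs') \<noteq> 0"
    and closed: "\<And>a. (\<lambda>e. \<Sum>i<length bs. a i * (bs ! i) e) \<in> L"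
    and bij: "bij_betw (\<lambda>z x. if x \<in> E' then \<epsilon> x * z (\<rho> x) else 0) L L'"
    and \<epsilon>: "\<And>x. x \<in> E' \<Longrightarrow> \<epsilon> x * \<epsilon> x = 1"
    and \<rho>: "inj_on \<rho> E'" "\<rho> ` E' \<subseteq> E"
    and \<sigma>: "\<And>x. x \<in> E' \<Longrightarrow> \<sigma> (\<rho> x) = xvar x" "\<And>e. e \<in> E - \<rho> ` E' \<Longrightarrow> \<sigma> e = 0"
  shows "pullback_defined \<sigma> (canonical_form n (gram E bs))"
    and "pullback \<sigma> (canonical_form n (gram E bs)) = canonical_form n (gram E' bs')"
proof -
  let ?h = "length bs" and ?f = "\<lambda>z x. if x \<in> E' then \<epsilon> x * z (\<rho> x) else 0"
  obtain P Q where P: "P \<in> carrier_mat ?h ?h" and Q: "Q \<in> carrier_mat ?h ?h"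
    and PQ: "P * Q = 1\<^sub>m ?h" and QP: "Q * P = 1\<^sub>m ?h" and len: "length bs' = ?h"
    and fb: "\<And>i x. i < ?h \<Longrightarrow> ?f (bs ! i) x = (\<Sum>k<?h. P $$ (k, i) * (bs' ! k) x)"
  proof (rule basis_change[OF bs bs' bij _ closed])
    show "?f (\<lambda>e. \<Sum>i<n::nat. a i * g i e) = (\<lambda>x. \<Sum>i<n. a i * ?f (g i) x)" for a g n
      by (rule ext) (simp add: sum_distrib_left mult_ac)
  qed blast
  interpret s: comm_ring_hom "poly_subst \<sigma>" by (rule comm_ring_hom_poly_subst)
  interpret linear_form_mat E ?h "\<lambda>i j e. (bs ! i) e * (bs ! j) e" "gram E bs"
    by (rule gram_linear_form_mat[OF E det])
  let ?p = "map_mat of_int P :: 'f qpoly mat"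
  have G': "gram E' bs' \<in> carrier_mat ?h ?h" using gram_carrier[of E' bs'] len by simp
  have p: "?p \<in> carrier_mat ?h ?h" using P by simp
  have eq: "map_mat (poly_subst \<sigma>) (gram E bs) = transpose_mat ?p * gram E' bs' * ?p"
  proof (rule eq_matI)
    fix i j assume "i < dim_row (transpose_mat ?p * gram E' bs' * ?p)" "j < dim_col (transpose_mat ?p * gram E' bs' * ?p)"
    then have ij: "i < ?h" "j < ?h" using P by auto
    have "map_mat (poly_subst \<sigma>) (gram E bs) $$ (i, j) = (\<Sum>e\<in>E. of_int ((bs ! i) e * (bs ! j) e) * \<sigma> e)"
      using ij by (simp add: gram_def poly_subst_sum poly_subst_mult poly_subst_xvar s.hom_of_int s.hom_mult)
    also have "\<dots> = (\<Sum>e\<in>\<rho> ` E'. of_int ((bs ! i) e * (bs ! j) e) * \<sigma> e)"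
      by (rule sum.mono_neutral_right) (use E \<rho>(2) \<sigma>(2) in auto)
    also have "\<dots> = (\<Sum>x\<in>E'. of_int ((bs ! i) (\<rho> x) * (bs ! j) (\<rho> x)) * xvar x)"
      unfolding sum.reindex[OF \<rho>(1)] comp_def by (intro sum.cong refl) (simp add: \<sigma>(1))
    also have "\<dots> = (\<Sum>x\<in>E'. of_int ((\<Sum>k<?h. P $$ (k, i) * (bs' ! k) x) * (\<Sum>l<?h. P $$ (l, j) * (bs' ! l) x)) * xvar x)"
    proof (intro sum.cong refl)
      fix x assume x: "x \<in> E'"
      \<comment> \<open>Only products of two values on the same edge occur, so the orientation signs
        cancel in pairs.\<close>
      have "(bs ! i) (\<rho> x) * (bs ! j) (\<rho> x) = (\<epsilon> x * \<epsilon> x) * ((bs ! i) (\<rho> x) * (bs ! j) (\<rho> x))"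
        using \<epsilon>[OF x] by simp
      also have "\<dots> = ?f (bs ! i) x * ?f (bs ! j) x" using x by (simp add: mult_ac)
      finally show "of_int ((bs ! i) (\<rho> x) * (bs ! j) (\<rho> x)) * xvar x =
          of_int ((\<Sum>k<?h. P $$ (k, i) * (bs' ! k) x) * (\<Sum>l<?h. P $$ (l, j) * (bs' ! l) x)) * xvar x"
        unfolding fb[OF ij(1)] fb[OF ij(2)] by simp
    qed
    also have "\<dots> = (\<Sum>x\<in>E'. \<Sum>k<?h. \<Sum>l<?h. of_int (P $$ (k, i)) * (of_int ((bs' ! k) x * (bs' ! l) x) * xvar x * of_int (P $$ (l, j))))"
      unfolding sum_product unfolding of_int_sum sum_distrib_right by (intro sum.cong refl) (simp add: mult_ac)
    also have "\<dots> = (\<Sum>k<?h. \<Sum>l<?h. \<Sum>x\<in>E'. of_int (P $$ (k, i)) * (of_int ((bs' ! k) x * (bs' ! l) x) * xvar x * of_int (P $$ (l, j))))"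
      by (subst sum.swap) (intro sum.cong refl sum.swap)
    also have "\<dots> = (\<Sum>k<?h. \<Sum>l<?h. of_int (P $$ (k, i)) * (gram E' bs' $$ (k, l) * of_int (P $$ (l, j))))"
      by (intro sum.cong refl) (simp add: gram_def len sum_distrib_left sum_distrib_right)
    also have "\<dots> = (transpose_mat ?p * (gram E' bs' * ?p)) $$ (i, j)"
      using ij P p G' carrier_matD[OF P]
      by (simp add: mult_mat_entry[of _ ?h ?h _ ?h] sum_distrib_left cong: sum.cong_simp)
    also have "transpose_mat ?p * (gram E' bs' * ?p) = transpose_mat ?p * gram E' bs' * ?p"
      by (rule assoc_mult_mat[symmetric, of _ ?h ?h _ ?h _ ?h]) (use p G' in auto)
    finally show "map_mat (poly_subst \<sigma>) (gram E bs) $$ (i, j) = (transpose_mat ?p * gram E' bs' * ?p) $$ (i, j)" .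
  qed (use P in \<open>auto simp: gram_def\<close>)
  \<comment> \<open>The substituted determinant is the square of \<open>det P\<close> times the
    determinant for the target, hence nonzero: the image of the substitution does not lie in the
    pole.\<close>
  have "det P * det Q = 1" using det_mult[OF P Q] PQ by simp
  then have "det P \<noteq> 0" by auto
  then have "det ?p \<noteq> 0" by (simp add: of_int_hom.hom_det)
  moreover have "det (map_mat (poly_subst \<sigma>) (gram E bs)) = det ?p * det (gram E' bs') * det ?p"
    unfolding eq using p G' by (simp add: det_mult[of _ ?h] det_transpose[OF p])
  ultimately have sdet: "poly_subst \<sigma> (det (gram E bs)) \<noteq> 0" using det' by (simp add: s.hom_det)
  show "pullback_defined \<sigma> (canonical_form n (gram E bs))"
    by (rule pullback_canonical_form(1)[OF sdet])
  show "pullback \<sigma> (canonical_form n (gram E bs)) = canonical_form n (gram E' bs')"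
    unfolding pullback_canonical_form(2)[OF sdet] eq
    by (rule canonical_form_change_basis[OF G' P Q PQ QP det'])
qed

subsection \<open>Cycles\<close>

text \<open>A single sum over all edges with signed incidences, to which reindexing and linearity
  apply directly, in place of the two filtered sums in \<open>H1\<close>.\<close>

definition boundary :: "('v, 'e) multigraph \<Rightarrow> ('e \<Rightarrow> 'v) \<Rightarrow> ('e \<Rightarrow> 'v) \<Rightarrow> ('e \<Rightarrow> int) \<Rightarrow> 'v \<Rightarrow> int" where
  "boundary G src tgt z v = (\<Sum>e\<in>edges G. z e * (of_bool (tgt e = v) - of_bool (src e = v)))"

lemma H1_iff:
  fixes G :: "('v, 'e) multigraph"
  assumes "finite (edges G)"
  shows "z \<in> H1 G src tgt \<longleftrightarrow>
    (\<forall>e. e \<notin> edges G \<longrightarrow> z e = 0) \<and> (\<forall>v\<in>verts G. boundary G src tgt z v = 0)"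
proof -
  have "(\<Sum>e | e \<in> edges G \<and> p e = v. z e) = (\<Sum>e\<in>edges G. z e * of_bool (p e = v))" for p :: "'e \<Rightarrow> 'v" and v
  proof -
    have "(\<Sum>e | e \<in> edges G \<and> p e = v. z e) = (\<Sum>e\<in>edges G. if p e = v then z e else 0)"
      by (rule sum.inter_filter[OF assms])
    then show ?thesis by (simp add: of_bool_def if_distrib cong: if_cong)
  qed
  then show ?thesis
    unfolding H1_def boundary_def by (simp add: right_diff_distrib sum_subtractf)
qed

lemma boundary_combination:
  "boundary G src tgt (\<lambda>e. \<Sum>i<n. a i * g i e) v = (\<Sum>i<n. a i * boundary G src tgt (g i) v)"
proof -
  have "boundary G src tgt (\<lambda>e. \<Sum>i<n. a i * g i e) v =
      (\<Sum>e\<in>edges G. \<Sum>i<n. a i * (g i e * (of_bool (tgt e = v) - of_bool (src e = v))))"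
    unfolding boundary_def by (simp add: sum_distrib_right mult.assoc)
  also have "\<dots> = (\<Sum>i<n. a i * boundary G src tgt (g i) v)"
    unfolding boundary_def by (subst sum.swap) (simp add: sum_distrib_left)
  finally show ?thesis .
qed

lemma H1_combination:
  assumes "finite (edges G)" "int_basis bs (H1 G src tgt)"
  shows "(\<lambda>e. \<Sum>i<length bs. a i * (bs ! i) e) \<in> H1 G src tgt"
proof -
  have b: "bs ! i \<in> H1 G src tgt" if "i < length bs" for i
    using assms(2) that by (auto simp: int_basis_def)
  show ?thesis
    using b unfolding H1_iff[OF assms(1)] boundary_combination by (auto intro!: sum.neutral)
qed

lemma H1_gram_det_nonzero:
  fixes G :: "('v, 'e::linorder) multigraph"
  assumes "finite (edges G)" "int_basis bs (H1 G src tgt)"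
  shows "det (gram (edges G) bs) \<noteq> 0"
proof (rule gram_det_nonzero[OF assms])
  show "(\<lambda>_. 0) \<in> H1 G src tgt" by (simp add: H1_def)
  show "\<And>z e. z \<in> H1 G src tgt \<Longrightarrow> e \<notin> edges G \<Longrightarrow> z e = 0" by (simp add: H1_def)
qed

lemma graph_laplacianE:
  fixes G :: "('v, 'e::linorder) multigraph"
  assumes "graph_laplacian G \<Lambda>" "finite (edges G)"
  obtains src tgt bs where "orientation G src tgt" "int_basis bs (H1 G src tgt)" "\<Lambda> = gram (edges G) bs"
  using assms unfolding graph_laplacian_def by (auto simp: laplacian_eq_gram)

text \<open>Compares two orientations of an edge with given ends. On a self-loop the two
  orientations coincide as pairs, and the sign is 1.\<close>

definition orientation_sign :: "'v \<Rightarrow> 'v \<Rightarrow> 'v \<Rightarrow> 'v \<Rightarrow> int" where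
  "orientation_sign s t s' t' = (if s = s' \<and> t = t' then 1 else -1)"

lemma orientation_sign_square: "orientation_sign s t s' t' * orientation_sign s t s' t' = 1"
  by (simp add: orientation_sign_def)

lemma orientation_sign_boundary:
  assumes "Upair s t = Upair s' t'"
  shows "orientation_sign s t s' t' * (of_bool (t = x) - of_bool (s = x)) = of_bool (t' = x) - of_bool (s' = x)"
  using assms by (auto simp: orientation_sign_def)

text \<open>Cycles are taken from \<open>G'\<close> back to \<open>G\<close>, the direction in which
  the forms are pulled back. Signed by the orientations, this map transports the boundary vertex by
  vertex.\<close>

lemma H1_iso_bij:
  fixes G :: "('v, 'e) multigraph" and G' :: "('w, 'f) multigraph"
  assumes G: "finite_graph G" and iso: "graph_iso \<phi> \<pi> G G'"
    and o: "orientation G src tgt" and o': "orientation G' src' tgt'"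
  shows "bij_betw (\<lambda>z x. if x \<in> edges G
      then orientation_sign (\<phi> (src x)) (\<phi> (tgt x)) (src' (\<pi> x)) (tgt' (\<pi> x)) * z (\<pi> x) else 0)
    (H1 G' src' tgt') (H1 G src tgt)"
proof -
  let ?E = "edges G" and ?E' = "edges G'"
  let ?s = "\<lambda>x. orientation_sign (\<phi> (src x)) (\<phi> (tgt x)) (src' (\<pi> x)) (tgt' (\<pi> x))"
  let ?f = "\<lambda>z x. if x \<in> ?E then ?s x * z (\<pi> x) else 0"
  have \<phi>: "bij_betw \<phi> (verts G) (verts G')" and \<pi>: "bij_betw \<pi> ?E ?E'"
    using iso by (auto simp: graph_iso_def)
  have fin: "finite ?E" using G by (simp add: finite_graph_def)
  then have fin': "finite ?E'" using \<pi> bij_betw_finite by blast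
  have ends: "Upair (\<phi> (src x)) (\<phi> (tgt x)) = Upair (src' (\<pi> x)) (tgt' (\<pi> x))" if "x \<in> ?E" for x
  proof -
    have "\<pi> x \<in> ?E'" using \<pi> that by (auto simp: bij_betw_def)
    then show ?thesis using iso o o' that by (auto simp: graph_iso_def orientation_def)
  qed
  have vert: "src x \<in> verts G" "tgt x \<in> verts G" if "x \<in> ?E" for x
    using G o that unfolding finite_graph_def orientation_def by fastforce+
  have bd: "boundary G src tgt (?f z) v = boundary G' src' tgt' z (\<phi> v)" if v: "v \<in> verts G" for z v
  proof -
    have "boundary G src tgt (?f z) v = (\<Sum>x\<in>?E. z (\<pi> x) * (of_bool (tgt' (\<pi> x) = \<phi> v) - of_bool (src' (\<pi> x) = \<phi> v)))"
      unfolding boundary_def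
    proof (intro sum.cong refl)
      fix x assume x: "x \<in> ?E"
      have "(\<phi> (tgt x) = \<phi> v) = (tgt x = v)" "(\<phi> (src x) = \<phi> v) = (src x = v)"
        using \<phi> vert[OF x] v by (auto simp: bij_betw_def inj_on_def)
      then show "?f z x * (of_bool (tgt x = v) - of_bool (src x = v)) =
          z (\<pi> x) * (of_bool (tgt' (\<pi> x) = \<phi> v) - of_bool (src' (\<pi> x) = \<phi> v))"
        using x orientation_sign_boundary[OF ends[OF x], of "\<phi> v"] by (simp add: mult_ac)
    qed
    also have "\<dots> = boundary G' src' tgt' z (\<phi> v)"
      unfolding boundary_def by (rule sum.reindex_bij_betw[OF \<pi>])
    finally show ?thesis .
  qed
  show ?thesis
    unfolding bij_betw_def
  proof (intro conjI inj_onI equalityI subsetI)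
    fix z w assume z: "z \<in> H1 G' src' tgt'" and w: "w \<in> H1 G' src' tgt'" and eq: "?f z = ?f w"
    show "z = w"
    proof
      fix y
      show "z y = w y"
      proof (cases "y \<in> ?E'")
        case True
        then obtain x where x: "x \<in> ?E" "y = \<pi> x" using \<pi> by (auto simp: bij_betw_def)
        have "?s x * z (\<pi> x) = ?s x * w (\<pi> x)" using fun_cong[OF eq, of x] x by simp
        then have "?s x * ?s x * z (\<pi> x) = ?s x * ?s x * w (\<pi> x)" by (simp add: mult.assoc)
        then show ?thesis by (simp add: orientation_sign_square x)
      next
        case False
        then show ?thesis using z w by (simp add: H1_def)
      qed
    qed
  next
    fix u assume "u \<in> ?f ` H1 G' src' tgt'"
    then obtain z where z: "z \<in> H1 G' src' tgt'" "u = ?f z" by blast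
    have "boundary G src tgt u v = 0" if "v \<in> verts G" for v
      unfolding z(2) bd[OF that] using z(1) that \<phi> by (auto simp: H1_iff[OF fin'] bij_betw_def)
    then show "u \<in> H1 G src tgt" using z(2) by (simp add: H1_iff[OF fin])
  next
    fix u assume u: "u \<in> H1 G src tgt"
    define z where "z y = (if y \<in> ?E' then ?s (inv_into ?E \<pi> y) * u (inv_into ?E \<pi> y) else 0)" for y
    have fz: "?f z = u"
    proof
      fix x
      show "?f z x = u x"
      proof (cases "x \<in> ?E")
        case True
        then have "inv_into ?E \<pi> (\<pi> x) = x" "\<pi> x \<in> ?E'" using \<pi> by (auto simp: bij_betw_def)
        then show ?thesis using True by (simp add: z_def orientation_sign_square flip: mult.assoc)
      next
        case False
        then show ?thesis using u by (simp add: H1_def)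
      qed
    qed
    have "boundary G' src' tgt' z v' = 0" if v': "v' \<in> verts G'" for v'
    proof -
      obtain v where v: "v \<in> verts G" "v' = \<phi> v" using \<phi> v' by (auto simp: bij_betw_def)
      show ?thesis using bd[OF v(1), of z] u v unfolding fz by (simp add: H1_iff[OF fin])
    qed
    then have "z \<in> H1 G' src' tgt'" by (simp add: H1_iff[OF fin'] z_def)
    then show "u \<in> ?f ` H1 G' src' tgt'" using fz by blast
  qed
qed

text \<open>A cycle of \<open>G/e\<close> lifts uniquely to \<open>G\<close>: the value at \<open>e\<close> is determined by the boundary at one
  endpoint of \<open>e\<close>, and the boundary at the other endpoint then vanishes as well.\<close>

lemma H1_contract_bij:
  fixes G :: "('v, 'e) multigraph"
  assumes G: "finite_graph G" and e: "e \<in> edges G" and proper: "proper_uprod (ends G e)"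
    and o: "orientation G src tgt" and o': "orientation (contract_edge G e) src' tgt'"
  shows "bij_betw (\<lambda>z x. if x \<in> edges G - {e}
      then orientation_sign (contract_class G e (src x)) (contract_class G e (tgt x)) (src' x) (tgt' x) * z x else 0)
    (H1 G src tgt) (H1 (contract_edge G e) src' tgt')"
proof -
  let ?E = "edges G" and ?c = "contract_class G e" and ?G' = "contract_edge G e"
  let ?s = "\<lambda>x. orientation_sign (?c (src x)) (?c (tgt x)) (src' x) (tgt' x)"
  let ?f = "\<lambda>z x. if x \<in> ?E - {e} then ?s x * z x else 0"
  let ?b = "boundary G src tgt" and ?b' = "boundary ?G' src' tgt'"
  let ?S = "{src e, tgt e}"
  have E': "edges ?G' = ?E - {e}" and V': "verts ?G' = ?c ` verts G" by (simp_all add: contract_edge_def)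
  have fin: "finite ?E" using G by (simp add: finite_graph_def)
  then have fin': "finite (edges ?G')" by (simp add: E')
  have ends_e: "ends G e = Upair (src e) (tgt e)" using o e by (simp add: orientation_def)
  have ne: "src e \<noteq> tgt e" using proper by (simp add: ends_e)
  have S: "set_uprod (ends G e) = ?S" by (simp add: ends_e)
  have vert: "src e \<in> verts G" "tgt e \<in> verts G" using G e ends_e unfolding finite_graph_def by fastforce+
  have c: "?c u = ?c v \<longleftrightarrow> u = v \<or> u \<in> ?S \<and> v \<in> ?S" for u v
    unfolding contract_class_def S by auto
  have ends: "Upair (?c (src x)) (?c (tgt x)) = Upair (src' x) (tgt' x)" if "x \<in> ?E - {e}" for x
  proof -
    have "ends ?G' x = Upair (src' x) (tgt' x)" using o' that by (simp add: orientation_def E')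
    moreover have "ends ?G' x = map_uprod ?c (ends G x)" by (simp add: contract_edge_def)
    ultimately show ?thesis using o that by (simp add: orientation_def)
  qed
  \<comment> \<open>At the merged vertex the boundaries at the two ends of \<open>e\<close> add up,
    and the contributions of \<open>e\<close> itself cancel; at all other vertices nothing
    changes.\<close>
  have bd: "?b' (?f z) (?c v) = (if v \<in> ?S then ?b z (src e) + ?b z (tgt e) else ?b z v)" for z v
  proof -
    have "?b' (?f z) (?c v) = (\<Sum>x\<in>?E - {e}. z x * (of_bool (?c (tgt x) = ?c v) - of_bool (?c (src x) = ?c v)))"
      unfolding boundary_def E'
    proof (intro sum.cong refl)
      fix x assume x: "x \<in> ?E - {e}"
      let ?t = "of_bool (?c (tgt x) = ?c v) - of_bool (?c (src x) = ?c v) :: int"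
      have 1: "of_bool (tgt' x = ?c v) - of_bool (src' x = ?c v) = ?s x * ?t"
        by (rule orientation_sign_boundary[OF ends[OF x], symmetric])
      have 2: "?f z x = ?s x * z x" using x by simp
      have "?f z x * (of_bool (tgt' x = ?c v) - of_bool (src' x = ?c v)) = (?s x * ?s x) * (z x * ?t)"
        unfolding 1 2 by (simp only: mult_ac)
      then show "?f z x * (of_bool (tgt' x = ?c v) - of_bool (src' x = ?c v)) = z x * ?t"
        by (simp only: orientation_sign_square mult_1)
    qed
    \<comment> \<open>The identified ends would make \<open>e\<close> a self-loop, so including it
      in the sum adds 0.\<close>
    also have "\<dots> = (\<Sum>x\<in>?E. z x * (of_bool (?c (tgt x) = ?c v) - of_bool (?c (src x) = ?c v)))"
    proof (rule sum.mono_neutral_left[OF fin])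
      have "?c (tgt e) = ?c (src e)" unfolding c by blast
      then show "\<forall>x\<in>?E - (?E - {e}). z x * (of_bool (?c (tgt x) = ?c v) - of_bool (?c (src x) = ?c v)) = 0"
        by (metis Diff_iff diff_self mult_zero_right singletonD)
    qed blast
    also have "\<dots> = (if v \<in> ?S then ?b z (src e) + ?b z (tgt e) else ?b z v)"
    proof (cases "v \<in> ?S")
      case True
      have *: "of_bool (?c u = ?c v) = of_bool (u = src e) + (of_bool (u = tgt e) :: int)" for u
      proof -
        have "(?c u = ?c v) = (u = src e \<or> u = tgt e)" using True unfolding c by blast
        then show ?thesis using ne by (cases "u = src e") simp_all
      qed
      show ?thesis
        using True unfolding * boundary_def sum.distrib[symmetric]
        by (simp only: if_True) (intro sum.cong refl, simp add: algebra_simps)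
    next
      case False
      then have "(?c u = ?c v) = (u = v)" for u unfolding c by blast
      then show ?thesis unfolding boundary_def using False by (simp only: if_False)
    qed
    finally show ?thesis .
  qed
  \<comment> \<open>Since \<open>e\<close> has distinct ends, its coefficient in the boundary at its
    target is 1, so the value at \<open>e\<close> can be solved for over the integers.\<close>
  have split: "?b z (tgt e) = z e + (\<Sum>x\<in>?E - {e}. z x * (of_bool (tgt x = tgt e) - of_bool (src x = tgt e)))" for z
    unfolding boundary_def using ne by (subst sum.remove[OF fin e]) simp
  show ?thesis
    unfolding bij_betw_def
  proof (intro conjI inj_onI equalityI subsetI)
    fix z w assume z: "z \<in> H1 G src tgt" and w: "w \<in> H1 G src tgt" and eq: "?f z = ?f w"
    have off: "z x = w x" if "x \<noteq> e" for x
    proof (cases "x \<in> ?E")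
      case True
      then have "?s x * z x = ?s x * w x" using fun_cong[OF eq, of x] that by simp
      then have "?s x * ?s x * z x = ?s x * ?s x * w x" by (simp add: mult.assoc)
      then show ?thesis by (simp add: orientation_sign_square)
    next
      case False
      then show ?thesis using z w by (simp add: H1_def)
    qed
    have "?b z (tgt e) = ?b w (tgt e)" using z w vert by (simp add: H1_iff[OF fin])
    moreover have "(\<Sum>x\<in>?E - {e}. z x * (of_bool (tgt x = tgt e) - of_bool (src x = tgt e))) =
        (\<Sum>x\<in>?E - {e}. w x * (of_bool (tgt x = tgt e) - of_bool (src x = tgt e)))"
      by (intro sum.cong refl) (simp add: off)
    ultimately have "z e = w e" unfolding split by simp
    then show "z = w" using off by (intro ext) metis
  next
    fix u assume "u \<in> ?f ` H1 G src tgt"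
    then obtain z where z: "z \<in> H1 G src tgt" "u = ?f z" by blast
    have "?b' u (?c v) = 0" if "v \<in> verts G" for v
      unfolding z(2) bd using z(1) that vert by (simp add: H1_iff[OF fin])
    then show "u \<in> H1 ?G' src' tgt'" using z(2) by (simp add: H1_iff[OF fin'] E' V')
  next
    fix u assume u: "u \<in> H1 ?G' src' tgt'"
    let ?r = "\<Sum>x\<in>?E - {e}. ?s x * u x * (of_bool (tgt x = tgt e) - of_bool (src x = tgt e))"
    define z where "z x = (if x = e then - ?r else if x \<in> ?E then ?s x * u x else 0)" for x
    have fz: "?f z = u"
    proof
      fix x
      show "?f z x = u x"
      proof (cases "x \<in> ?E - {e}")
        case True
        then show ?thesis by (simp add: z_def orientation_sign_square flip: mult.assoc)
      next
        case False
        then show ?thesis using u by (auto simp: H1_iff[OF fin'] E')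
      qed
    qed
    have "(\<Sum>x\<in>?E - {e}. z x * (of_bool (tgt x = tgt e) - of_bool (src x = tgt e))) = ?r"
      by (intro sum.cong refl) (simp add: z_def)
    then have t: "?b z (tgt e) = 0" unfolding split by (simp add: z_def)
    have "?b' u (?c v) = 0" if "v \<in> verts G" for v
      using u that by (simp add: H1_iff[OF fin'] V')
    then have b': "(if v \<in> ?S then ?b z (src e) + ?b z (tgt e) else ?b z v) = 0" if "v \<in> verts G" for v
      using bd[of z v] that unfolding fz by simp
    have "?b z v = 0" if "v \<in> verts G" for v
      using b'[OF that] t by (cases "v = tgt e") (auto split: if_splits)
    then have "z \<in> H1 G src tgt" using e by (auto simp: H1_iff[OF fin] z_def)
    then show "u \<in> ?f ` H1 G src tgt" using fz by blast
  qed
qed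

theorem theorem2p1:
  fixes G :: "('v, 'e::linorder) multigraph"
    and G' :: "('w, 'f::linorder) multigraph"
    and k :: nat
    and \<Lambda> :: "'e qpoly mat"
  assumes "finite_graph G" and "connected_graph G" and "k \<ge> 1"
    and "graph_laplacian G \<Lambda>"
  shows
    "projective_form_off (edges G) (det \<Lambda>) (canonical_form (4 * k + 1) \<Lambda>) \<and>
     (\<forall>e \<Lambda>e. e \<in> edges G \<and> proper_uprod (ends G e) \<and> graph_laplacian (contract_edge G e) \<Lambda>e \<longrightarrow>
        pullback_defined (hyperplane_incl e) (canonical_form (4 * k + 1) \<Lambda>) \<and>
        pullback (hyperplane_incl e) (canonical_form (4 * k + 1) \<Lambda>) =
          canonical_form (4 * k + 1) \<Lambda>e) \<and>
     (\<forall>\<phi> \<pi> \<Lambda>'. finite_graph G' \<and> graph_iso \<phi> \<pi> G G' \<and> graph_laplacian G' \<Lambda>' \<longrightarrow>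
        pullback_defined (coord_perm (edges G) \<pi>) (canonical_form (4 * k + 1) \<Lambda>') \<and>
        pullback (coord_perm (edges G) \<pi>) (canonical_form (4 * k + 1) \<Lambda>') =
          canonical_form (4 * k + 1) \<Lambda>) \<and>
     (\<exists>N. poly_form_in (edges G) N \<and>
        canonical_form (4 * k + 1) \<Lambda> =
          ext_const (1 / to_fract (det \<Lambda>) ^ (k + 1)) * rat_of_poly_form N)"
proof -
  let ?E = "edges G" and ?n = "4 * k + 1"
  have fin: "finite ?E" using assms(1) by (simp add: finite_graph_def)
  obtain src tgt bs where o: "orientation G src tgt" and bs: "int_basis bs (H1 G src tgt)"
    and lap: "\<Lambda> = gram ?E bs"
    using assms(4) fin by (rule graph_laplacianE)
  have det_G: "det (gram ?E bs) \<noteq> 0" by (rule H1_gram_det_nonzero[OF fin bs])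
  interpret linear_form_mat ?E "length bs" "\<lambda>i j e. (bs ! i) e * (bs ! j) e" \<Lambda>
    unfolding lap by (rule gram_linear_form_mat[OF fin det_G])
  obtain N where N: "poly_form_in ?E N"
    "canonical_form ?n \<Lambda> = ext_const (1 / to_fract (det \<Lambda>) ^ (k + 1)) * rat_of_poly_form N"
  proof (rule canonical_form_pole)
    show "\<Lambda> $$ (i, j) = \<Lambda> $$ (j, i)" if "i < length bs" "j < length bs" for i j
      using that by (simp add: lap gram_def mult.commute)
  qed blast
  have "regular_off ?E (det \<Lambda>) (canonical_form ?n \<Lambda>)"
    unfolding regular_off_def
  proof (intro allI impI conjI)
    fix I assume nz: "ext_coeff (canonical_form ?n \<Lambda>) I \<noteq> 0"
    have eq: "ext_coeff (canonical_form ?n \<Lambda>) I = to_fract (ext_coeff N I) / to_fract (det \<Lambda>) ^ (k + 1)"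
      unfolding N(2) by simp
    then have "ext_coeff N I \<noteq> 0" using nz by auto
    then show "I \<subseteq> ?E" using N(1) unfolding poly_form_in_def by blast
    show "\<exists>p n. pvars p \<subseteq> ?E \<and> ext_coeff (canonical_form ?n \<Lambda>) I = to_fract p / to_fract (det \<Lambda>) ^ n"
      using eq poly_form_in_pvars[OF N(1)] by blast
  qed
  then have projective: "projective_form_off ?E (det \<Lambda>) (canonical_form ?n \<Lambda>)"
    unfolding projective_form_off_def
    using homogeneous_canonical_form euler_contraction_canonical_form[OF assms(3)] by blast
  have contract: "pullback_defined (hyperplane_incl e) (canonical_form ?n \<Lambda>) \<and>
      pullback (hyperplane_incl e) (canonical_form ?n \<Lambda>) = canonical_form ?n \<Lambda>e"
    if e: "e \<in> ?E" "proper_uprod (ends G e)" and lap_e: "graph_laplacian (contract_edge G e) \<Lambda>e" for e \<Lambda>e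
  proof -
    have E': "edges (contract_edge G e) = ?E - {e}" by (simp add: contract_edge_def)
    then have fin': "finite (edges (contract_edge G e))" using fin by simp
    obtain src' tgt' bs' where o': "orientation (contract_edge G e) src' tgt'"
      and bs': "int_basis bs' (H1 (contract_edge G e) src' tgt')" and \<Lambda>e: "\<Lambda>e = gram (?E - {e}) bs'"
      using graph_laplacianE[OF lap_e fin'] unfolding E' by blast
    have det': "det (gram (?E - {e}) bs') \<noteq> 0"
      using H1_gram_det_nonzero[OF fin' bs'] unfolding E' .
    let ?\<epsilon> = "\<lambda>x. orientation_sign (contract_class G e (src x)) (contract_class G e (tgt x)) (src' x) (tgt' x)"
    have "finite (?E - {e})" using fin by simp
    \<comment> \<open>Here \<rho> is the inclusion of the edges other than \<open>e\<close>, and the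
      one coordinate outside its image is the one that the hyperplane sets to 0.\<close>
    note pb = pullback_gram[where \<rho> = "\<lambda>x. x" and \<epsilon> = ?\<epsilon> and \<sigma> = "hyperplane_incl e" and n = ?n,
        OF fin this bs bs' det_G det' H1_combination[OF fin bs] H1_contract_bij[OF assms(1) e o o']
        orientation_sign_square]
    show ?thesis
      unfolding lap \<Lambda>e by (intro conjI pb) (auto simp: hyperplane_incl_def)
  qed
  have iso: "pullback_defined (coord_perm ?E \<pi>) (canonical_form ?n \<Lambda>') \<and>
      pullback (coord_perm ?E \<pi>) (canonical_form ?n \<Lambda>') = canonical_form ?n \<Lambda>"
    if G': "finite_graph G'" and iso: "graph_iso \<phi> \<pi> G G'" and lap': "graph_laplacian G' \<Lambda>'" for \<phi> \<pi> \<Lambda>'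
  proof -
    have fin': "finite (edges G')" using G' by (simp add: finite_graph_def)
    obtain src' tgt' bs' where o': "orientation G' src' tgt'"
      and bs': "int_basis bs' (H1 G' src' tgt')" and \<Lambda>': "\<Lambda>' = gram (edges G') bs'"
      using lap' fin' by (rule graph_laplacianE)
    have \<pi>: "inj_on \<pi> ?E" "\<pi> ` ?E = edges G'" using iso by (auto simp: graph_iso_def bij_betw_def)
    let ?\<epsilon> = "\<lambda>x. orientation_sign (\<phi> (src x)) (\<phi> (tgt x)) (src' (\<pi> x)) (tgt' (\<pi> x))"
    \<comment> \<open>The form being pulled back lives on \<open>G'\<close>, so \<open>G'\<close>
      takes the role of the source and \<pi> embeds the edges of \<open>G\<close> into its
      edges.\<close>
    note pb = pullback_gram[where \<rho> = \<pi> and \<epsilon> = ?\<epsilon> and \<sigma> = "coord_perm ?E \<pi>" and n = ?n,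
        OF fin' fin bs' bs H1_gram_det_nonzero[OF fin' bs'] det_G H1_combination[OF fin' bs']
        H1_iso_bij[OF assms(1) iso o o'] orientation_sign_square \<pi>(1)]
    show ?thesis
      unfolding lap \<Lambda>' by (intro conjI pb) (use \<pi> in \<open>auto simp: coord_perm_def\<close>)
  qed
  show ?thesis using projective contract iso N by blast
qed

end
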